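(* Let $E$ be a complex Banach lattice and let $(e^{tA})_{t\ge0}$ be a real $C_0$-semigroup on $E$ with generator $A$. Suppose that $s(A)$ is a dominant spectral value of $A$ and a pole of the resolvent $\mathcal{R}(\cdot,A)$. Suppose that $\mathcal{R}(\cdot,A)$ is uniformly eventually strongly positive at $s(A)$ with respect to a quasi-interior point $u$ of $E_+$. Assume moreover that $(e^{tA})_{t\ge0}$ is eventually norm continuous and that $E_u=E$. Then there is an $\varepsilon>0$ such that for every compact operator $0\le B\in\mathcal{L}(E)$ with $\|B\|<\varepsilon$ the semigroup generated by $A+B$ is individually eventually strongly positive with respect to $u$.
   Context: A complex Banach lattice $E$ is the complexification of a real Banach lattice $E_{\mathbb{R}}$; $E_+$ is its positive cone, $f\ge 0$ means $f\in E_+$, and $f>0$ means $f\ge 0$, $f\ne 0$. $\mathcal{L}(E)$ is the space of bounded linear operators on $E$; $T\in\mathcal{L}(E)$ is positive ($T\ge0$) if $TE_+\subseteq E_+$. A linear operator $A\colon E\supseteq D(A)\to E$ is real if $D(A)=E_{\mathbb{R}}\cap D(A)+i\,(E_{\mathbb{R}}\cap D(A))$ and $A$ maps $E_{\mathbb{R}}\cap D(A)$ into $E_{\mathbb{R}}$; a $C_0$-semigroup is real if all its operators are real (equivalently, its generator is real). $\mathcal{R}(\lambda,A)=(\lambda I-A)^{-1}$ for $\lambda\in\rho(A)$. The spectral bound is $s(A)=\sup\{\operatorname{Re}\lambda:\lambda\in\sigma(A)\}$; it is a dominant spectral value of $A$ if $s(A)\in\sigma(A)$ and every $\lambda\in\sigma(A)\setminus\{s(A)\}$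 satisfies $\operatorname{Re}\lambda<s(A)$. A semigroup is eventually norm continuous if there is $t_0\ge0$ such that $t\mapsto e^{tA}$ is operator norm continuous on $(t_0,\infty)$. For $u\in E_+$ let $E_u=\{x\in E:\ |x|\le cu\text{ for some }c\ge 0\}$; $u\in E_+$ is a quasi-interior point of $E_+$ if $E_u$ is dense in $E$. Write $f\gg_u0$ if there is $\varepsilon>0$ with $f\ge\varepsilon u$. The resolvent of $A$ is uniformly eventually strongly positive with respect to $u$ at a real spectral value $\lambda_0$ of $A$ if there exists a real number $\lambda_1>\lambda_0$ such that $(\lambda_0,\lambda_1]\subseteq\rho(A)$ and $\mathcal{R}(\lambda,A)f\gg_u 0$ for all $\lambda\in(\lambda_0,\lambda_1]$ and all $0<f\in E$. A $C_0$-semigroup $(e^{tC})_{t\ge0}$ on $E$ is individually eventually strongly positive with respect to $u$ if for every $0<f\in E$ there is $t_0\ge0$ such that $e^{tC}f\gg_u0$ for all $t\ge t_0$. *)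

theory Defs
  imports "HOL-Analysis.Analysis" "HOL-Library.Lattice_Algebras"
begin

section \<open>Real Banach lattices\<close>

text \<open>Here \<open>\<bar>x\<bar> = sup x (- x)\<close>, by the axioms of the class \<^class>\<open>lattice_ab_group_add_abs\<close>.\<close>

class banach_lattice = banach + ordered_real_vector + lattice_ab_group_add_abs +
  assumes norm_mono_abs: "\<bar>x\<bar> \<le> \<bar>y\<bar> \<Longrightarrow> norm x \<le> norm y"

instance real :: banach_lattice
  by standard (auto simp: sup_real_def)

lemma norm_abs_eq: "norm \<bar>x\<bar> = norm (x :: 'a::banach_lattice)"
  by (intro antisym norm_mono_abs) simp_all

lemma norm_mono_nonneg:
  fixes x y :: "'a::banach_lattice"
  assumes "0 \<le> x" "x \<le> y"
  shows "norm x \<le> norm y"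
  using assms by (intro norm_mono_abs) (simp add: abs_of_nonneg order_trans[of 0 x y])

lemma scaleR_le_abs: "a *\<^sub>R x \<le> \<bar>a\<bar> *\<^sub>R \<bar>x :: 'a::banach_lattice\<bar>"
proof (cases "a \<ge> 0")
  case True
  then show ?thesis by (simp add: scaleR_left_mono abs_ge_self)
next
  case False
  then have "\<bar>a\<bar> *\<^sub>R (- x) \<le> \<bar>a\<bar> *\<^sub>R \<bar>x\<bar>"
    by (intro scaleR_left_mono abs_ge_minus_self) simp
  with False show ?thesis by simp
qed

lemma LIMSEQ_nonneg:
  fixes X :: "nat \<Rightarrow> 'a::banach_lattice"
  assumes lim: "X \<longlonglongrightarrow> l" and nn: "\<And>n. 0 \<le> X n"
  shows "0 \<le> l"
proof -
  define m where "m = sup (- l) 0"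
  have m0: "0 \<le> m" by (simp add: m_def)
  have bound: "norm m \<le> norm (X n - l)" for n
  proof -
    have "- l \<le> X n - l" using nn[of n] by simp
    also have "\<dots> \<le> \<bar>X n - l\<bar>" by (rule abs_ge_self)
    finally have "m \<le> \<bar>X n - l\<bar>" by (simp add: m_def)
    from norm_mono_nonneg[OF m0 this] show ?thesis by (simp add: norm_abs_eq)
  qed
  have "(\<lambda>n. norm (X n - l)) \<longlonglongrightarrow> 0"
    using lim by (simp add: LIM_zero_iff tendsto_norm_zero)
  then have "norm m \<le> 0"
    by (rule LIMSEQ_le_const) (use bound in blast)
  then have "m = 0" by simp
  then have "- l \<le> 0" unfolding m_def by (metis sup_ge1)
  then show ?thesis by simp
qed

lemma LIMSEQ_le_lattice:
  fixes X Y :: "nat \<Rightarrow> 'a::banach_lattice"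
  assumes "X \<longlonglongrightarrow> x" "Y \<longlonglongrightarrow> y" "\<And>n. X n \<le> Y n"
  shows "x \<le> y"
  using LIMSEQ_nonneg[of "\<lambda>n. Y n - X n" "y - x"] assms by (auto intro: tendsto_diff)


section \<open>The complexification of a real Banach lattice\<close>

text \<open>\<open>Cpl x y\<close> is the vector \<open>x + i y\<close>.\<close>

datatype 'a complexification = Cpl (rpart: 'a) (ipart: 'a)

text \<open>The modulus is \<open>\<bar>x + i y\<bar> = sup {cos \<theta> x + sin \<theta> y | \<theta>}\<close>; this supremum exists in every
  Banach lattice (lemma \<open>modulus_lub\<close> below).\<close>

definition rot :: "'a::real_vector complexification \<Rightarrow> real \<Rightarrow> 'a" where
  "rot z \<theta> = cos \<theta> *\<^sub>R rpart z + sin \<theta> *\<^sub>R ipart z"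

definition modulus :: "'a::banach_lattice complexification \<Rightarrow> 'a" where
  "modulus z = (THE m. (\<forall>\<theta>. rot z \<theta> \<le> m) \<and> (\<forall>b. (\<forall>\<theta>. rot z \<theta> \<le> b) \<longrightarrow> m \<le> b))"

lemma cos_lipschitz: "\<bar>cos a - cos b\<bar> \<le> \<bar>a - b :: real\<bar>"
  and sin_lipschitz: "\<bar>sin a - sin b\<bar> \<le> \<bar>a - b :: real\<bar>"
proof -
  have *: "\<bar>f a - f b\<bar> \<le> \<bar>a - b\<bar>"
    if d: "\<And>x. (f has_field_derivative f' x) (at x)" and b: "\<And>x. \<bar>f' x\<bar> \<le> (1::real)" for f f'
    using field_differentiable_bound[of UNIV f f' 1 a b] d b by auto
  show "\<bar>cos a - cos b\<bar> \<le> \<bar>a - b\<bar>"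
    by (rule *[where f' = "\<lambda>x. - sin x"]) (auto intro!: derivative_eq_intros)
  show "\<bar>sin a - sin b\<bar> \<le> \<bar>a - b\<bar>"
    by (rule *[where f' = "cos"]) (auto intro!: derivative_eq_intros)
qed

lemma rot_lipschitz:
  fixes z :: "'a::banach_lattice complexification"
  shows "rot z a \<le> rot z b + \<bar>a - b\<bar> *\<^sub>R (\<bar>rpart z\<bar> + \<bar>ipart z\<bar>)"
proof -
  have "rot z a - rot z b = (cos a - cos b) *\<^sub>R rpart z + (sin a - sin b) *\<^sub>R ipart z"
    by (simp add: rot_def algebra_simps)
  also have "\<dots> \<le> \<bar>cos a - cos b\<bar> *\<^sub>R \<bar>rpart z\<bar> + \<bar>sin a - sin b\<bar> *\<^sub>R \<bar>ipart z\<bar>"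
    by (intro add_mono scaleR_le_abs)
  also have "\<dots> \<le> \<bar>a - b\<bar> *\<^sub>R \<bar>rpart z\<bar> + \<bar>a - b\<bar> *\<^sub>R \<bar>ipart z\<bar>"
    by (intro add_mono scaleR_right_mono cos_lipschitz sin_lipschitz abs_ge_zero)
  finally show ?thesis by (simp add: algebra_simps)
qed

lemma rot_sup_exists:
  fixes z :: "'a::banach_lattice complexification"
  shows "\<exists>m. (\<forall>\<theta>. rot z \<theta> \<le> m) \<and> (\<forall>b. (\<forall>\<theta>. rot z \<theta> \<le> b) \<longrightarrow> m \<le> b)"
proof -
  define e where "e = \<bar>rpart z\<bar> + \<bar>ipart z\<bar>"
  have e0: "0 \<le> e" by (simp add: e_def)
  define P where "P n = (\<lambda>k. rot z (2 * pi * real k / real (Suc n))) ` {..Suc n}" for n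
  define s where "s n = Sup_fin (P n)" for n
  define d where "d n = 2 * pi / real (Suc n)" for n
  have fin: "finite (P n)" "P n \<noteq> {}" for n by (auto simp: P_def)
  have s_le: "s n \<le> b" if "\<And>\<theta>. rot z \<theta> \<le> b" for n b
    unfolding s_def using fin that by (intro Sup_fin.boundedI) (auto simp: P_def)
  have le_s: "rot z \<theta> \<le> s n + d n *\<^sub>R e" for \<theta> n
  proof -
    obtain t where t: "0 \<le> t" "t < 2 * pi" "cos \<theta> = cos t" "sin \<theta> = sin t"
      using sincos_total_2pi[of "cos \<theta>" "sin \<theta>"] by auto
    define q where "q = t * real (Suc n) / (2 * pi)"
    define k where "k = nat \<lfloor>q\<rfloor>"
    have "t * real (Suc n) \<le> (2 * pi) * real (Suc n)" using t by (intro mult_right_mono) auto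
    then have q: "0 \<le> q" "q \<le> real (Suc n)"
      using t by (auto simp: q_def pos_divide_le_eq mult.commute simp del: of_nat_Suc)
    have k: "real k \<le> q" "q < real k + 1" using q by (simp_all add: k_def)
    then have "k \<le> Suc n" using q by linarith
    define p where "p = 2 * pi * real k / real (Suc n)"
    have "t = q * d n" by (simp add: q_def d_def)
    moreover have "p = real k * d n" by (simp add: p_def d_def)
    moreover have d0: "0 < d n" by (simp add: d_def)
    ultimately have "t - p = (q - real k) * d n" by (simp add: algebra_simps)
    moreover have "\<dots> \<le> 1 * d n" using k d0 by (intro mult_right_mono) auto
    moreover have "0 \<le> (q - real k) * d n" using k d0 by simp
    ultimately have tp: "\<bar>t - p\<bar> \<le> d n" by simp
    have "rot z \<theta> = rot z t" using t by (simp add: rot_def)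
    also have "\<dots> \<le> rot z p + \<bar>t - p\<bar> *\<^sub>R e" unfolding e_def by (rule rot_lipschitz)
    also have "\<dots> \<le> s n + d n *\<^sub>R e"
    proof (intro add_mono scaleR_right_mono tp e0)
      have "rot z p \<in> P n" using \<open>k \<le> Suc n\<close> by (auto simp: P_def p_def)
      then show "rot z p \<le> s n" unfolding s_def using fin by (intro Sup_fin.coboundedI) auto
    qed
    finally show ?thesis .
  qed
  have s_s: "s m - s n \<le> d n *\<^sub>R e" for m n
    using s_le[OF le_s, of m n] by (simp add: algebra_simps)
  have d0: "0 \<le> d n" for n by (simp add: d_def)
  have dist_s: "norm (s m - s n) \<le> (d m + d n) * norm e" for m n
  proof -
    have "\<bar>s m - s n\<bar> \<le> (d m + d n) *\<^sub>R e"
    proof (rule abs_leI)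
      have "s m - s n \<le> d n *\<^sub>R e" by (rule s_s)
      also have "\<dots> \<le> (d m + d n) *\<^sub>R e" using d0 e0 by (intro scaleR_right_mono) auto
      finally show "s m - s n \<le> (d m + d n) *\<^sub>R e" .
      have "- (s m - s n) \<le> d m *\<^sub>R e" using s_s[of n m] by simp
      also have "\<dots> \<le> (d m + d n) *\<^sub>R e" using d0 e0 by (intro scaleR_right_mono) auto
      finally show "- (s m - s n) \<le> (d m + d n) *\<^sub>R e" .
    qed
    then have "norm \<bar>s m - s n\<bar> \<le> norm ((d m + d n) *\<^sub>R e)"
      by (intro norm_mono_nonneg) auto
    then show ?thesis using d0[of m] d0[of n] by (simp add: norm_abs_eq)
  qed
  have d_lim: "d \<longlonglongrightarrow> 0"
    unfolding d_def using LIMSEQ_Suc[OF lim_const_over_n[of "2 * pi"]] by simp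
  have "Cauchy s"
  proof (rule CauchyI)
    fix \<epsilon> :: real assume "0 < \<epsilon>"
    define \<delta> where "\<delta> = \<epsilon> / (2 * (norm e + 1))"
    have pos: "0 < 2 * (norm e + 1)" by (smt (verit) norm_ge_zero)
    have "0 < \<delta>" unfolding \<delta>_def using \<open>0 < \<epsilon>\<close> pos by (rule divide_pos_pos)
    from order_tendstoD(2)[OF d_lim this] obtain N where N: "\<And>n. n \<ge> N \<Longrightarrow> d n < \<delta>"
      by (auto simp: eventually_sequentially)
    show "\<exists>M. \<forall>m\<ge>M. \<forall>n\<ge>M. norm (s m - s n) < \<epsilon>"
    proof (intro exI allI impI)
      fix m n assume mn: "m \<ge> N" "n \<ge> N"
      have "norm (s m - s n) \<le> (d m + d n) * norm e" by (rule dist_s)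
      also have "\<dots> \<le> (2 * \<delta>) * norm e"
        using N[OF mn(1)] N[OF mn(2)] by (intro mult_right_mono) auto
      also have "\<dots> < (2 * \<delta>) * (norm e + 1)" using \<open>0 < \<delta>\<close> by simp
      also have "\<dots> = \<epsilon>" using pos by (simp add: \<delta>_def field_simps)
      finally show "norm (s m - s n) < \<epsilon>" .
    qed
  qed
  then obtain m where m: "s \<longlonglongrightarrow> m" by (auto simp: Cauchy_convergent_iff convergent_def)
  have lim: "(\<lambda>n. s n + d n *\<^sub>R e) \<longlonglongrightarrow> m"
    using tendsto_add[OF m tendsto_scaleR[OF d_lim tendsto_const[of e]]] by simp
  show ?thesis
  proof (intro exI[of _ m] conjI allI impI)
    show "rot z \<theta> \<le> m" for \<theta> by (rule LIMSEQ_le_lattice[OF tendsto_const lim le_s])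
    show "m \<le> b" if "\<forall>\<theta>. rot z \<theta> \<le> b" for b
      using that by (intro LIMSEQ_le_lattice[OF m tendsto_const] s_le) blast
  qed
qed

lemma modulus_lub:
  shows rot_le_modulus: "rot z \<theta> \<le> modulus z"
    and modulus_least: "(\<And>\<theta>. rot z \<theta> \<le> b) \<Longrightarrow> modulus z \<le> b"
proof -
  let ?P = "\<lambda>m. (\<forall>\<theta>. rot z \<theta> \<le> m) \<and> (\<forall>b. (\<forall>\<theta>. rot z \<theta> \<le> b) \<longrightarrow> m \<le> b)"
  have "\<exists>!m. ?P m"
  proof (rule ex_ex1I)
    show "\<exists>m. ?P m" by (rule rot_sup_exists)
    show "m = m'" if "?P m" "?P m'" for m m' using that by (intro antisym) auto
  qed
  from theI'[OF this] have *: "?P (modulus z)" unfolding modulus_def .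
  show "rot z \<theta> \<le> modulus z" using * by blast
  show "modulus z \<le> b" if "\<And>\<theta>. rot z \<theta> \<le> b" using * that by blast
qed

lemma modulus_nonneg [simp]: "0 \<le> modulus z"
proof -
  have "rpart z \<le> modulus z" "- rpart z \<le> modulus z"
    using rot_le_modulus[of z 0] rot_le_modulus[of z pi] by (simp_all add: rot_def)
  then have "\<bar>rpart z\<bar> \<le> modulus z" by (intro abs_leI)
  with abs_ge_zero show ?thesis by (rule order_trans)
qed

lemma abs_rpart_le: "\<bar>rpart z\<bar> \<le> modulus z"
  using rot_le_modulus[of z 0] rot_le_modulus[of z pi] by (intro abs_leI) (simp_all add: rot_def)

lemma abs_ipart_le: "\<bar>ipart z\<bar> \<le> modulus z"
  using rot_le_modulus[of z "pi/2"] rot_le_modulus[of z "- (pi/2)"]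
  by (intro abs_leI) (simp_all add: rot_def)

lemma modulus_le: "modulus z \<le> \<bar>rpart z\<bar> + \<bar>ipart z\<bar>"
proof (rule modulus_least)
  fix \<theta>
  have "rot z \<theta> \<le> \<bar>cos \<theta>\<bar> *\<^sub>R \<bar>rpart z\<bar> + \<bar>sin \<theta>\<bar> *\<^sub>R \<bar>ipart z\<bar>"
    unfolding rot_def by (intro add_mono scaleR_le_abs)
  also have "\<dots> \<le> 1 *\<^sub>R \<bar>rpart z\<bar> + 1 *\<^sub>R \<bar>ipart z\<bar>"
    by (intro add_mono scaleR_right_mono) auto
  finally show "rot z \<theta> \<le> \<bar>rpart z\<bar> + \<bar>ipart z\<bar>" by simp
qed


subsection \<open>Vector space structure, order, and absolute value\<close>

definition scaleC :: "complex \<Rightarrow> 'a::real_vector complexification \<Rightarrow> 'a complexification"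
    (infixr \<open>*\<^sub>C\<close> 75) where
  "c *\<^sub>C z = Cpl (Re c *\<^sub>R rpart z - Im c *\<^sub>R ipart z) (Re c *\<^sub>R ipart z + Im c *\<^sub>R rpart z)"

instantiation complexification :: (real_vector) real_vector
begin
definition "0 = Cpl 0 0"
definition "z + w = Cpl (rpart z + rpart w) (ipart z + ipart w)"
definition "z - w = Cpl (rpart z - rpart w) (ipart z - ipart w)"
definition "- z = Cpl (- rpart z) (- ipart z)"
definition "r *\<^sub>R z = Cpl (r *\<^sub>R rpart z) (r *\<^sub>R ipart z)"
instance
  by standard
    (auto simp: zero_complexification_def plus_complexification_def minus_complexification_def
      uminus_complexification_def scaleR_complexification_def algebra_simps)
end

lemma rpart_ipart_simps [simp]:
  "rpart 0 = 0" "ipart 0 = 0"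
  "rpart (z + w) = rpart z + rpart w" "ipart (z + w) = ipart z + ipart w"
  "rpart (z - w) = rpart z - rpart w" "ipart (z - w) = ipart z - ipart w"
  "rpart (- z) = - rpart z" "ipart (- z) = - ipart z"
  "rpart (r *\<^sub>R z) = r *\<^sub>R rpart z" "ipart (r *\<^sub>R z) = r *\<^sub>R ipart z"
  "rpart (c *\<^sub>C z) = Re c *\<^sub>R rpart z - Im c *\<^sub>R ipart z"
  "ipart (c *\<^sub>C z) = Re c *\<^sub>R ipart z + Im c *\<^sub>R rpart z"
  by (simp_all add: zero_complexification_def plus_complexification_def minus_complexification_def
      uminus_complexification_def scaleR_complexification_def scaleC_def)

lemma complexification_eqI: "rpart z = rpart w \<Longrightarrow> ipart z = ipart w \<Longrightarrow> z = w"
  by (rule complexification.expand) simp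

lemma scaleC_laws:
  "c *\<^sub>C (z + w) = c *\<^sub>C z + c *\<^sub>C w"
  "(c + d) *\<^sub>C z = c *\<^sub>C z + d *\<^sub>C z"
  "c *\<^sub>C d *\<^sub>C z = (c * d) *\<^sub>C z"
  "1 *\<^sub>C z = z"
  "complex_of_real r *\<^sub>C z = r *\<^sub>R z"
  by (rule complexification_eqI; simp add: algebra_simps)+

text \<open>The order is the one with positive cone \<open>E\<^sub>+ = {x + i 0 | x \<ge> 0}\<close>.\<close>

instantiation complexification :: (ordered_real_vector) ordered_real_vector
begin
definition "z \<le> w \<longleftrightarrow> rpart z \<le> rpart w \<and> ipart z = ipart w"
definition "(z :: 'a complexification) < w \<longleftrightarrow> z \<le> w \<and> z \<noteq> w"
instance
  by standard
    (auto simp: less_eq_complexification_def less_complexification_def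
      intro: complexification_eqI scaleR_left_mono scaleR_right_mono)
end

instantiation complexification :: (banach_lattice) abs
begin
definition "\<bar>z\<bar> = Cpl (modulus z) 0"
instance ..
end

definition real_elements :: "'a::real_vector complexification set" where
  "real_elements = {z. ipart z = 0}"


subsection \<open>Norm\<close>

lemma modulus_0 [simp]: "modulus 0 = 0"
  by (rule antisym) (auto intro: modulus_least simp: rot_def)

lemma modulus_add: "modulus (z + w) \<le> modulus z + modulus w"
proof (rule modulus_least)
  fix \<theta>
  have "rot (z + w) \<theta> = rot z \<theta> + rot w \<theta>" by (simp add: rot_def algebra_simps)
  then show "rot (z + w) \<theta> \<le> modulus z + modulus w"
    by (simp add: add_mono rot_le_modulus)
qed

lemma modulus_scaleC_le: "modulus (c *\<^sub>C z) \<le> cmod c *\<^sub>R modulus z"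
proof (rule modulus_least)
  fix \<theta>
  have c: "Re c = cmod c * cos (Arg c)" "Im c = cmod c * sin (Arg c)"
    by (metis Arg_eq Re_rcis rcis_def rcis_cmod_Arg, metis Im_rcis rcis_cmod_Arg)
  have "rot (c *\<^sub>C z) \<theta> = cmod c *\<^sub>R rot z (\<theta> - Arg c)"
    by (simp add: rot_def c cos_diff sin_diff algebra_simps)
  also have "\<dots> \<le> cmod c *\<^sub>R modulus z"
    by (intro scaleR_left_mono rot_le_modulus) simp
  finally show "rot (c *\<^sub>C z) \<theta> \<le> cmod c *\<^sub>R modulus z" .
qed

lemma modulus_scaleC: "modulus (c *\<^sub>C z) = cmod c *\<^sub>R modulus z"
proof (cases "c = 0")
  case True
  then have "c *\<^sub>C z = 0" by (intro complexification_eqI) auto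
  with True show ?thesis by simp
next
  case False
  have "cmod c *\<^sub>R modulus z = cmod c *\<^sub>R modulus (inverse c *\<^sub>C c *\<^sub>C z)"
    using False by (simp add: scaleC_laws)
  also have "\<dots> \<le> cmod c *\<^sub>R (cmod (inverse c) *\<^sub>R modulus (c *\<^sub>C z))"
    by (intro scaleR_left_mono modulus_scaleC_le) simp
  also have "\<dots> = modulus (c *\<^sub>C z)" using False by (simp add: norm_inverse)
  finally show ?thesis using modulus_scaleC_le by (intro antisym)
qed

instantiation complexification :: (banach_lattice) real_normed_vector
begin
definition norm_complexification_def:
  "norm (z :: 'a complexification) = norm (modulus z)"
definition dist_complexification_def:
  "dist (z :: 'a complexification) w = norm (z - w)"
definition sgn_complexification_def:
  "sgn (z :: 'a complexification) = z /\<^sub>R norm z"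
definition uniformity_complexification_def:
  "(uniformity :: ('a complexification \<times> 'a complexification) filter) =
     (INF e\<in>{0<..}. principal {(x, y). dist x y < e})"
definition open_complexification_def:
  "open (U :: 'a complexification set) \<longleftrightarrow>
     (\<forall>x\<in>U. \<forall>\<^sub>F (x', y) in uniformity. x' = x \<longrightarrow> y \<in> U)"
instance
proof
  fix x y :: "'a complexification" and a :: real and U :: "'a complexification set"
  show "dist x y = norm (x - y)" by (rule dist_complexification_def)
  show "sgn x = x /\<^sub>R norm x" by (rule sgn_complexification_def)
  show "(uniformity :: ('a complexification \<times> 'a complexification) filter) =
      (INF e\<in>{0<..}. principal {(x, y). dist x y < e})"
    by (rule uniformity_complexification_def)
  show "open U \<longleftrightarrow> (\<forall>x\<in>U. \<forall>\<^sub>F (x', y) in uniformity. x' = x \<longrightarrow> y \<in> U)"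
    by (rule open_complexification_def)
  show "norm x = 0 \<longleftrightarrow> x = 0"
  proof
    assume "norm x = 0"
    then have "modulus x = 0" by (simp add: norm_complexification_def)
    then have "\<bar>rpart x\<bar> = 0" "\<bar>ipart x\<bar> = 0"
      using abs_rpart_le[of x] abs_ipart_le[of x] by (auto intro: antisym)
    then show "x = 0" by (intro complexification_eqI) auto
  qed (simp add: norm_complexification_def)
  have "norm (modulus (x + y)) \<le> norm (modulus x + modulus y)"
    by (intro norm_mono_nonneg modulus_add modulus_nonneg)
  then show "norm (x + y) \<le> norm x + norm y"
    unfolding norm_complexification_def using norm_triangle_ineq order_trans by blast
  show "norm (a *\<^sub>R x) = \<bar>a\<bar> * norm x"
    using modulus_scaleC[of "complex_of_real a" x]
    by (simp add: scaleC_laws norm_complexification_def)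
qed
end

lemma norm_scaleC [simp]: "norm (c *\<^sub>C z) = cmod c * norm (z :: 'a::banach_lattice complexification)"
  by (simp add: norm_complexification_def modulus_scaleC)

lemma norm_rpart_le: "norm (rpart z) \<le> norm (z :: 'a::banach_lattice complexification)"
  using norm_mono_nonneg[OF abs_ge_zero abs_rpart_le[of z]]
  by (simp add: norm_complexification_def norm_abs_eq)

lemma norm_ipart_le: "norm (ipart z) \<le> norm (z :: 'a::banach_lattice complexification)"
  using norm_mono_nonneg[OF abs_ge_zero abs_ipart_le[of z]]
  by (simp add: norm_complexification_def norm_abs_eq)

lemma norm_le_parts:
  "norm (z :: 'a::banach_lattice complexification) \<le> norm (rpart z) + norm (ipart z)"
proof -
  have "norm z \<le> norm (\<bar>rpart z\<bar> + \<bar>ipart z\<bar>)"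
    unfolding norm_complexification_def by (intro norm_mono_nonneg modulus_le modulus_nonneg)
  also have "\<dots> \<le> norm (rpart z) + norm (ipart z)"
    using norm_triangle_ineq[of "\<bar>rpart z\<bar>" "\<bar>ipart z\<bar>"] by (simp add: norm_abs_eq)
  finally show ?thesis .
qed

instance complexification :: (banach_lattice) banach
proof
  fix X :: "nat \<Rightarrow> 'a complexification"
  assume X: "Cauchy X"
  have part: "Cauchy (\<lambda>n. p (X n))"
    if p: "\<And>z w. p (z - w) = p z - p w" "\<And>z. norm (p z) \<le> norm z"
    for p :: "'a complexification \<Rightarrow> 'a"
  proof (rule CauchyI)
    fix e :: real assume "0 < e"
    from CauchyD[OF X this] obtain M where "\<forall>m\<ge>M. \<forall>n\<ge>M. norm (X m - X n) < e" by blast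
    then show "\<exists>M. \<forall>m\<ge>M. \<forall>n\<ge>M. norm (p (X m) - p (X n)) < e"
      by (metis p order.strict_trans1)
  qed
  obtain a where a: "(\<lambda>n. rpart (X n)) \<longlonglongrightarrow> a"
    using part[of rpart] norm_rpart_le by (auto simp: Cauchy_convergent_iff convergent_def)
  obtain b where b: "(\<lambda>n. ipart (X n)) \<longlonglongrightarrow> b"
    using part[of ipart] norm_ipart_le by (auto simp: Cauchy_convergent_iff convergent_def)
  have "(\<lambda>n. norm (rpart (X n) - a) + norm (ipart (X n) - b)) \<longlonglongrightarrow> 0"
    using tendsto_add[OF tendsto_norm[OF LIM_zero[OF a]] tendsto_norm[OF LIM_zero[OF b]]] by simp
  then have "(\<lambda>n. X n - Cpl a b) \<longlonglongrightarrow> 0"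
    by (rule Lim_null_comparison[rotated])
      (use norm_le_parts[of "X _ - Cpl a b"] in \<open>auto intro!: always_eventually\<close>)
  then show "convergent X" by (auto simp: convergent_def dest: LIM_zero_cancel)
qed


section \<open>Operators\<close>

text \<open>An operator \<open>A\<close> with domain \<open>D(A)\<close> is a partial function \<open>A\<close> with \<open>dom A = D(A)\<close>.
  As \<^typ>\<open>'a \<Rightarrow>\<^sub>L 'b\<close> consists of the bounded real-linear maps, the elements of \<open>L(E)\<close> are
  those that are in addition \<open>complex_linear\<close>; their norm is the usual operator norm.\<close>

type_synonym 'a operator = "'a complexification \<rightharpoonup> 'a complexification"
type_synonym 'a bounded_operator = "'a complexification \<Rightarrow>\<^sub>L 'a complexification"

definition complex_linear :: "'a::banach_lattice bounded_operator \<Rightarrow> bool" where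
  "complex_linear T \<longleftrightarrow> (\<forall>c z. T (c *\<^sub>C z) = c *\<^sub>C T z)"

definition positive_operator :: "'a::banach_lattice bounded_operator \<Rightarrow> bool" where
  "positive_operator T \<longleftrightarrow> (\<forall>f\<ge>0. T f \<ge> 0)"

definition compact_operator :: "'a::banach_lattice bounded_operator \<Rightarrow> bool" where
  "compact_operator T \<longleftrightarrow> compact (closure (T ` cball 0 1))"

definition real_operator :: "'a::banach_lattice operator \<Rightarrow> bool" where
  "real_operator A \<longleftrightarrow>
     dom A = {x + \<i> *\<^sub>C y | x y. x \<in> real_elements \<inter> dom A \<and> y \<in> real_elements \<inter> dom A} \<and>
     (\<forall>x \<in> real_elements \<inter> dom A. the (A x) \<in> real_elements)"

definition perturbed :: "'a::banach_lattice operator \<Rightarrow> 'a bounded_operator \<Rightarrow> 'a operator" where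
  "perturbed A B = (\<lambda>x. map_option (\<lambda>y. y + B x) (A x))"


subsection \<open>Spectrum and resolvent\<close>

definition shifted :: "'a::banach_lattice operator \<Rightarrow> complex \<Rightarrow>
    'a complexification \<Rightarrow> 'a complexification" where
  "shifted A \<mu> x = \<mu> *\<^sub>C x - the (A x)"

definition resolvent_set :: "'a::banach_lattice operator \<Rightarrow> complex set" where
  "resolvent_set A = {\<mu>. bij_betw (shifted A \<mu>) (dom A) UNIV \<and>
     bounded_linear (inv_into (dom A) (shifted A \<mu>))}"

definition spectrum :: "'a::banach_lattice operator \<Rightarrow> complex set" where
  "spectrum A = - resolvent_set A"

definition resolvent :: "'a::banach_lattice operator \<Rightarrow> complex \<Rightarrow> 'a bounded_operator" where
  "resolvent A \<mu> = Blinfun (inv_into (dom A) (shifted A \<mu>))"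

definition spectral_bound :: "'a::banach_lattice operator \<Rightarrow> ereal" where
  "spectral_bound A = (SUP \<mu>\<in>spectrum A. ereal (Re \<mu>))"

definition dominant_spectral_bound :: "'a::banach_lattice operator \<Rightarrow> real \<Rightarrow> bool" where
  "dominant_spectral_bound A s \<longleftrightarrow> spectral_bound A = ereal s \<and> complex_of_real s \<in> spectrum A \<and>
     (\<forall>\<mu> \<in> spectrum A - {complex_of_real s}. Re \<mu> < s)"

lift_definition scaleC_blinfun :: "complex \<Rightarrow> 'a::banach_lattice bounded_operator \<Rightarrow> 'a bounded_operator"
  is "\<lambda>c T z. c *\<^sub>C T z"
proof -
  fix c and T :: "'a complexification \<Rightarrow> 'a complexification"
  assume "bounded_linear T"
  moreover have "bounded_linear ((*\<^sub>C) c :: 'a complexification \<Rightarrow> _)"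
    by (rule bounded_linear_intro[where K = "cmod c"])
      (auto intro: complexification_eqI simp: algebra_simps)
  ultimately show "bounded_linear (\<lambda>z. c *\<^sub>C T z)"
    by (rule bounded_linear_compose[rotated])
qed

text \<open>A pole of order \<open>n \<ge> 1\<close>, expressed by the Laurent expansion
  \<open>\<Sum>k. (\<mu> - \<mu>\<^sub>0)\<^bsup>k-n\<^esup> Q\<^sub>k\<close> (in operator norm) on a punctured disc contained in the resolvent set.
  The predicate \<open>is_pole\<close> of HOL-Complex_Analysis would be too weak here: it only requires that the norm
  tends to infinity, which the resolvent does at every isolated spectral value.\<close>

definition resolvent_pole :: "'a::banach_lattice operator \<Rightarrow> complex \<Rightarrow> bool" where
  "resolvent_pole A \<mu>\<^sub>0 \<longleftrightarrow>
     (\<exists>n\<ge>1. \<exists>Q :: nat \<Rightarrow> 'a bounded_operator. \<exists>r>0. Q 0 \<noteq> 0 \<and>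
        (\<forall>\<mu> \<in> ball \<mu>\<^sub>0 r - {\<mu>\<^sub>0}. \<mu> \<in> resolvent_set A \<and>
          (\<lambda>k. scaleC_blinfun ((\<mu> - \<mu>\<^sub>0) powi (int k - int n)) (Q k)) sums resolvent A \<mu>))"


subsection \<open>Semigroups\<close>

text \<open>Only the values at times \<open>t \<ge> 0\<close> are relevant.\<close>

definition C0_semigroup :: "(real \<Rightarrow> 'a::banach_lattice bounded_operator) \<Rightarrow> bool" where
  "C0_semigroup T \<longleftrightarrow>
     (\<forall>t\<ge>0. complex_linear (T t)) \<and> T 0 = id_blinfun \<and>
     (\<forall>s\<ge>0. \<forall>t\<ge>0. T (s + t) = T s o\<^sub>L T t) \<and>
     (\<forall>x. continuous_on {0..} (\<lambda>t. T t x))"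

definition generator :: "(real \<Rightarrow> 'a::banach_lattice bounded_operator) \<Rightarrow> 'a operator" where
  "generator T = (\<lambda>x. let q = (\<lambda>h. (T h x - x) /\<^sub>R h) in
     if \<exists>y. (q \<longlongrightarrow> y) (at_right 0) then Some (Lim (at_right 0) q) else None)"

definition real_semigroup :: "(real \<Rightarrow> 'a::banach_lattice bounded_operator) \<Rightarrow> bool" where
  "real_semigroup T \<longleftrightarrow> (\<forall>t\<ge>0. real_operator (\<lambda>x. Some (T t x)))"

definition eventually_norm_continuous ::
    "(real \<Rightarrow> 'a::banach_lattice bounded_operator) \<Rightarrow> bool" where
  "eventually_norm_continuous T \<longleftrightarrow> (\<exists>t\<^sub>0\<ge>0. continuous_on {t\<^sub>0<..} T)"


section \<open>Strong positivity\<close>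

definition principal_ideal ::
    "'a::banach_lattice complexification \<Rightarrow> 'a complexification set" where
  "principal_ideal u = {x. \<exists>c\<ge>0. \<bar>x\<bar> \<le> c *\<^sub>R u}"

definition quasi_interior :: "'a::banach_lattice complexification \<Rightarrow> bool" where
  "quasi_interior u \<longleftrightarrow> 0 \<le> u \<and> closure (principal_ideal u) = UNIV"

definition strongly_positive ::
    "'a::banach_lattice complexification \<Rightarrow> 'a complexification \<Rightarrow> bool" where
  "strongly_positive u f \<longleftrightarrow> (\<exists>\<epsilon>>0. f \<ge> \<epsilon> *\<^sub>R u)"

definition resolvent_uniformly_eventually_strongly_positive ::
    "'a::banach_lattice operator \<Rightarrow> 'a complexification \<Rightarrow> real \<Rightarrow> bool" where
  "resolvent_uniformly_eventually_strongly_positive A u \<mu>\<^sub>0 \<longleftrightarrow>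
     (\<exists>\<mu>\<^sub>1>\<mu>\<^sub>0. complex_of_real ` {\<mu>\<^sub>0<..\<mu>\<^sub>1} \<subseteq> resolvent_set A \<and>
       (\<forall>\<mu>\<in>{\<mu>\<^sub>0<..\<mu>\<^sub>1}. \<forall>f>0. strongly_positive u (resolvent A (complex_of_real \<mu>) f)))"

definition individually_eventually_strongly_positive ::
    "(real \<Rightarrow> 'a::banach_lattice bounded_operator) \<Rightarrow> 'a complexification \<Rightarrow> bool" where
  "individually_eventually_strongly_positive T u \<longleftrightarrow>
     (\<forall>f>0. \<exists>t\<^sub>0\<ge>0. \<forall>t\<ge>t\<^sub>0. strongly_positive u (T t f))"

end

theory Submission
  imports Defs
begin

text \<open>
  Since \<open>u\<close> is an order unit, strong positivity of the resolvent forces the pole at \<open>s\<close> to be simple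
  with a rank-one residue \<open>P = \<phi> \<otimes> v\<close>, \<open>v \<ge> \<epsilon> u\<close>. Eventual norm continuity and dominance of \<open>s\<close> yield
  \<open>e\<^bsup>-s\<tau>\<^esup> T(\<tau>) (I - P) \<rightarrow> 0\<close> in operator norm. Now perturb at one resolvent value \<open>\<mu>\<close> close to \<open>s\<close> and one
  time \<open>\<tau>\<close>: the positive operator \<open>(\<mu> - s) R(\<mu>, A + B)\<close> is norm close to \<open>P\<close>, hence has an
  eigenvector \<open>v' \<ge> \<epsilon>/2 u\<close> and a dual eigenvector \<open>\<psi>\<close> that is strictly positive by strong positivity of
  \<open>R(\<mu>, A + B) \<ge> R(\<mu>, A)\<close>; both are eigenvectors of the perturbed semigroup, say with growth rate \<open>b\<close>.
  On the kernel of \<open>\<psi>\<close> the operator \<open>e\<^bsup>-b\<tau>\<^esup> S(\<tau>)\<close> is a contraction because \<open>S(\<tau>)\<close> is close to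
  \<open>T(\<tau>)\<close>. Hence \<open>e\<^bsup>-bt\<^esup> S(t) f\<close> tends to a strictly positive multiple of \<open>v'\<close>.
\<close>


section \<open>Banach lattices and bounded operators\<close>

text \<open>Obstacle: neither T(t) nor the perturbed S(t) is known to be positive for small t, so
  positivity cannot travel from T to S through the variation-of-constants formula. It enters only
  through the resolvent at the single point \<mu>, where a positive perturbation can only enlarge
  it; the semigroup contributes nothing but norm estimates. The two are joined by the order unit,
  which turns a small norm into a small multiple of u. The decay of e^(-s\<tau>) T(\<tau>) (I - P)
  rests neither on a spectral mapping theorem nor on the spectral radius formula. Instead, 1 - z
  U(p) is bounded below uniformly for z in the closed unit disc, by Laplace integrals over the
  finite interval [0, p] whose kernel is a trigonometric polynomial, and averaging over roots of
  unity turns this lower bound into small norms of the powers U(p)^(2^k). Likewise no contour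
  integral is perturbed: the eigenvalue 1/\<kappa> of (\<mu> - s) R(\<mu>, A + B) solves a scalar
  equation to which the intermediate value theorem applies, and an explicit formula gives the dual
  eigenvector.\<close>

lemma Baire_closed_cover:
  fixes F :: "nat \<Rightarrow> 'b::banach set"
  assumes closed: "\<And>n. closed (F n)" and cover: "\<And>x. \<exists>n. x \<in> F n"
  obtains n x e where "e > 0" "ball x e \<subseteq> F n"
proof -
  have "\<exists>n. interior (F n) \<noteq> {}"
  proof (rule ccontr)
    assume "\<not> ?thesis"
    then have "interior (\<Union>(range F)) = {}"
      using Baire_category_alt[of "euclidean :: 'b topology" "range F"] closed
      by (auto simp: completely_metrizable_space_euclidean)
    moreover have "\<Union>(range F) = UNIV" using cover by auto
    ultimately show False by simp
  qed
  then obtain n x where "x \<in> interior (F n)" by blast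
  then show ?thesis using that by (auto simp: mem_interior)
qed

lemma scale_into_ball:
  fixes y :: "'b::real_normed_vector"
  assumes "y \<noteq> 0" "e > 0"
  shows "norm ((e / (2 * norm y)) *\<^sub>R y) < e" using assms by (simp add: field_simps)

text \<open>Banach-Steinhaus over an index set; it supplies the bound of the semigroup on [0, 1]
  from which \<open>growth_bound\<close> starts.\<close>

lemma uniform_boundedness:
  fixes L :: "'i \<Rightarrow> 'b::banach \<Rightarrow>\<^sub>L 'c::real_normed_vector"
  assumes bdd: "\<And>x. \<exists>K. \<forall>i\<in>I. norm (L i x) \<le> K"
  obtains K where "\<And>i. i \<in> I \<Longrightarrow> norm (L i) \<le> K"
proof -
  define F where "F n = (\<Inter>i\<in>I. {x. norm (L i x) \<le> real n})" for n
  have "closed (F n)" for n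
    unfolding F_def by (intro closed_INT ballI closed_Collect_le continuous_intros)
  moreover have "\<exists>n. x \<in> F n" for x
  proof -
    obtain K where "\<forall>i\<in>I. norm (L i x) \<le> K" using bdd by blast
    moreover obtain n where "K \<le> real n" using real_arch_simple by blast
    ultimately have "x \<in> F n" by (auto simp: F_def intro: order_trans)
    then show ?thesis ..
  qed
  ultimately obtain n x e where e: "e > 0" "ball x e \<subseteq> F n" by (rule Baire_closed_cover)
  have small: "norm (L i y) \<le> 2 * real n" if "i \<in> I" "norm y < e" for i y
  proof -
    have "x \<in> F n" "x + y \<in> F n" using e that by (auto simp: subset_iff dist_norm)
    then have "norm (L i x) \<le> n" "norm (L i (x + y)) \<le> n" using that by (auto simp: F_def)
    moreover have "norm (L i y) \<le> norm (L i (x + y)) + norm (L i x)"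
      using norm_triangle_ineq4[of "L i (x + y)" "L i x"] by (simp add: blinfun.add_right)
    ultimately show ?thesis by linarith
  qed
  have "norm (L i) \<le> 4 * real n / e" if i: "i \<in> I" for i
  proof (rule norm_blinfun_bound)
    show "norm (L i y) \<le> 4 * real n / e * norm y" for y
    proof (cases "y = 0")
      case False
      have "norm (L i ((e / (2 * norm y)) *\<^sub>R y)) \<le> 2 * real n"
        by (intro small i scale_into_ball False e)
      then show ?thesis using False e by (simp add: blinfun.scaleR_right field_simps)
    qed simp
  qed (use e in auto)
  with that show ?thesis by blast
qed

lemma closed_abs_le:
  fixes w :: "'a::banach_lattice"
  shows "closed {x. \<bar>x\<bar> \<le> w}"
proof -
  have "\<bar>l\<bar> \<le> w" if "X \<longlonglongrightarrow> l" "\<And>n. \<bar>X n\<bar> \<le> w" for X l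
  proof (rule abs_leI)
    show "l \<le> w" by (rule LIMSEQ_le_lattice[OF that(1) tendsto_const])
        (use that(2) abs_ge_self order_trans in blast)
    show "- l \<le> w" by (rule LIMSEQ_le_lattice[OF tendsto_minus[OF that(1)] tendsto_const])
        (use that(2) abs_ge_minus_self order_trans in blast)
  qed
  then show ?thesis unfolding closed_sequential_limits by auto
qed

text \<open>The order intervals [-nu, nu] are closed and cover the space, so by Baire one of them
  contains a ball; taking differences centres the ball at 0 at the price of a factor 2. This
  inequality is what later converts norm estimates into lower bounds by multiples of u.\<close>

lemma order_unit_norm:
  fixes u :: "'a::banach_lattice"
  assumes "0 \<le> u" and unit: "\<And>x. \<exists>c. \<bar>x\<bar> \<le> c *\<^sub>R u"
  obtains c where "c > 0" "\<And>x. \<bar>x\<bar> \<le> (c * norm x) *\<^sub>R u"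
proof -
  define F where "F n = {x. \<bar>x\<bar> \<le> real n *\<^sub>R u}" for n
  have "closed (F n)" for n unfolding F_def by (rule closed_abs_le)
  moreover have "\<exists>n. x \<in> F n" for x
  proof -
    obtain c where "\<bar>x\<bar> \<le> c *\<^sub>R u" using unit by blast
    moreover obtain n where "c \<le> real n" using real_arch_simple by blast
    ultimately have "\<bar>x\<bar> \<le> real n *\<^sub>R u" using scaleR_right_mono[OF _ \<open>0 \<le> u\<close>] order_trans by blast
    then show ?thesis by (auto simp: F_def)
  qed
  ultimately obtain n x e where e: "e > 0" "ball x e \<subseteq> F n" by (rule Baire_closed_cover)
  have small: "\<bar>y\<bar> \<le> (2 * real n) *\<^sub>R u" if "norm y < e" for y
  proof -
    have "x \<in> F n" "x + y \<in> F n" using e that by (auto simp: subset_iff dist_norm)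
    then have "\<bar>x\<bar> \<le> n *\<^sub>R u" "\<bar>x + y\<bar> \<le> n *\<^sub>R u" by (auto simp: F_def)
    then have "\<bar>x + y\<bar> + \<bar>x\<bar> \<le> (2 * real n) *\<^sub>R u"
      using add_mono by (fastforce simp: scaleR_add_left[symmetric])
    moreover have "\<bar>y\<bar> \<le> \<bar>x + y\<bar> + \<bar>x\<bar>" using abs_triangle_ineq4[of "x + y" x] by simp
    ultimately show ?thesis by (rule order_trans[rotated])
  qed
  \<comment> \<open>The rescaling to norm e/2 gives the constant 4n/e; the added 1 keeps it positive
    when n = 0.\<close>
  have "\<bar>y\<bar> \<le> ((4 * real n + 1) / e * norm y) *\<^sub>R u" for y
  proof (cases "y = 0")
    case False
    define a where "a = e / (2 * norm y)"
    have a: "a > 0" using e False by (simp add: a_def)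
    have "\<bar>a *\<^sub>R y\<bar> \<le> (2 * real n) *\<^sub>R u" unfolding a_def by (intro small scale_into_ball False e)
    moreover have "\<bar>y\<bar> \<le> inverse a *\<^sub>R \<bar>a *\<^sub>R y\<bar>"
      using scaleR_le_abs[of "inverse a" "a *\<^sub>R y"] scaleR_le_abs[of "- inverse a" "a *\<^sub>R y"] a
      by (intro abs_leI) auto
    moreover have "inverse a *\<^sub>R \<bar>a *\<^sub>R y\<bar> \<le> inverse a *\<^sub>R ((2 * real n) *\<^sub>R u)"
      using calculation(1) a by (intro scaleR_left_mono) auto
    ultimately have "\<bar>y\<bar> \<le> (inverse a * (2 * real n)) *\<^sub>R u" by (metis order_trans scaleR_scaleR)
    also have "\<dots> \<le> ((4 * real n + 1) / e * norm y) *\<^sub>R u"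
      using e False by (intro scaleR_right_mono \<open>0 \<le> u\<close>) (simp add: a_def field_simps)
    finally show ?thesis .
  qed simp
  moreover have "(4 * real n + 1) / e > 0" using e by (simp add: add_pos_nonneg)
  ultimately show ?thesis by (rule that[rotated])
qed

text \<open>The clause with \<open>sums\<close> is kept next to the two inverse relations because
  the order properties of the inverse are read off from the partial sums.\<close>

lemma Neumann_series:
  fixes L :: "'b::banach \<Rightarrow>\<^sub>L 'b"
  assumes L: "norm L < 1"
  obtains N :: "'b \<Rightarrow>\<^sub>L 'b" where "\<And>x. N (x - L x) = x" "\<And>x. N x - L (N x) = x"
    "\<And>x. (\<lambda>n. (blinfun_apply L ^^ n) x) sums N x" "norm N \<le> 1 / (1 - norm L)"
proof -
  define f where "f n x = (blinfun_apply L ^^ n) x" for n x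
  have f_Suc: "f (Suc n) x = L (f n x)" "f (Suc n) x = f n (L x)" for n x
    by (simp_all add: f_def funpow_swap1)
  have bound: "norm (f n x) \<le> norm L ^ n * norm x" for n x
  proof (induction n)
    case (Suc n)
    have "norm (f (Suc n) x) \<le> norm L * norm (f n x)" unfolding f_Suc(1) by (rule norm_blinfun)
    also have "\<dots> \<le> norm L * (norm L ^ n * norm x)" by (intro mult_left_mono Suc) simp
    finally show ?case by simp
  qed (simp add: f_def)
  have gs: "(\<lambda>n. norm L ^ n * norm x) sums (1 / (1 - norm L) * norm x)" for x
    using L by (intro sums_mult2 geometric_sums) simp
  have sm: "summable (\<lambda>n. f n x)" for x
    by (rule summable_comparison_test'[OF sums_summable[OF gs[of x]] bound])
  define g where "g x = (\<Sum>n. f n x)" for x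
  have gs': "(\<lambda>n. f n x) sums g x" for x unfolding g_def using sm by (rule summable_sums)
  have lin: "f n (x + y) = f n x + f n y" "f n (a *\<^sub>R x) = a *\<^sub>R f n x" for n x y a
    by (induction n) (simp_all add: f_def blinfun.add_right blinfun.scaleR_right)
  have gb: "norm (g x) \<le> 1 / (1 - norm L) * norm x" for x
  proof -
    have sn: "summable (\<lambda>n. norm (f n x))"
      by (rule summable_comparison_test'[OF sums_summable[OF gs[of x]]]) (use bound in simp)
    have "norm (g x) \<le> (\<Sum>n. norm (f n x))" unfolding g_def by (rule summable_norm[OF sn])
    also have "\<dots> \<le> (\<Sum>n. norm L ^ n * norm x)" by (rule suminf_le[OF bound sn sums_summable[OF gs]])
    also have "\<dots> = 1 / (1 - norm L) * norm x" by (rule sums_unique[OF gs, symmetric])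
    finally show ?thesis .
  qed
  have "bounded_linear g"
  proof (rule bounded_linear_intro)
    show "g (x + y) = g x + g y" for x y
      using sums_unique2[OF gs'[of "x + y"]] sums_add[OF gs'[of x] gs'[of y]] by (simp add: lin)
    show "g (a *\<^sub>R x) = a *\<^sub>R g x" for a x
      using sums_unique2[OF gs'[of "a *\<^sub>R x"]] sums_scaleR_right[OF gs'[of x], of a]
      by (simp add: lin)
    show "norm (g x) \<le> norm x * (1 / (1 - norm L))" for x using gb[of x] by (simp add: mult.commute)
  qed
  then have N: "blinfun_apply (Blinfun g) = g" by (rule bounded_linear_Blinfun_apply)
  have g_split: "g x = x + (\<Sum>n. f (Suc n) x)" for x
    unfolding g_def using suminf_split_head[OF sm[of x]] by (simp add: f_def)
  have 1: "g x - L (g x) = x" for x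
  proof -
    have "L (g x) = (\<Sum>n. f (Suc n) x)"
      unfolding g_def f_Suc(1) by (rule bounded_linear.suminf[OF blinfun.bounded_linear_right sm])
    with g_split[of x] show ?thesis by (simp add: algebra_simps)
  qed
  have 2: "g (x - L x) = x" for x
  proof -
    have "g (L x) = (\<Sum>n. f (Suc n) x)" unfolding g_def f_Suc(2) ..
    with g_split[of x] have "g x - g (L x) = x" by (simp add: algebra_simps)
    then show ?thesis using \<open>bounded_linear g\<close> by (simp add: linear_diff bounded_linear.linear)
  qed
  show ?thesis
  proof (rule that[of "Blinfun g"])
    show "norm (Blinfun g) \<le> 1 / (1 - norm L)"
      by (rule norm_blinfun_bound) (use L gb in \<open>auto simp: N\<close>)
  qed (use 1 2 gs' in \<open>simp_all add: N f_def\<close>)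
qed

section \<open>Complex scalars and the real lattice inside its complexification\<close>

interpretation scaleC: bounded_bilinear
  "scaleC :: complex \<Rightarrow> 'a::banach_lattice complexification \<Rightarrow> 'a complexification"
proof (rule bounded_bilinear.intro)
  show "\<exists>K. \<forall>c (z :: 'a complexification). norm (c *\<^sub>C z) \<le> norm c * norm z * K"
    by (rule exI[of _ 1]) simp
qed (auto intro: complexification_eqI simp: algebra_simps)

lemma scaleC_scaleC: "c *\<^sub>C d *\<^sub>C z = (c * d) *\<^sub>C z"
  and scaleC_one [simp]: "1 *\<^sub>C z = z"
  and scaleC_of_real: "complex_of_real r *\<^sub>C z = r *\<^sub>R z" by (simp_all add: scaleC_laws)

definition emb :: "'a::real_vector \<Rightarrow> 'a complexification" where
  "emb x = Cpl x 0"

lemma emb_parts [simp]: "rpart (emb x) = x" "ipart (emb x) = 0" by (simp_all add: emb_def)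

lemma emb_rpart: "ipart z = 0 \<Longrightarrow> emb (rpart z) = z" by (rule complexification_eqI) simp_all

lemma complexification_split: "z = emb (rpart z) + \<i> *\<^sub>C emb (ipart z)"
  by (rule complexification_eqI) simp_all

lemma modulus_emb: "modulus (emb x) = \<bar>x\<bar>"
proof (rule antisym)
  show "modulus (emb x) \<le> \<bar>x\<bar>" using modulus_le[of "emb x"] by simp
  show "\<bar>x\<bar> \<le> modulus (emb x)" using abs_rpart_le[of "emb x"] by simp
qed

lemma norm_emb [simp]: "norm (emb x) = norm (x :: 'a::banach_lattice)"
  by (simp add: norm_complexification_def modulus_emb norm_abs_eq)

lemma bounded_linear_emb: "bounded_linear (emb :: 'a::banach_lattice \<Rightarrow> _)"
  by (rule bounded_linear_intro[where K = 1]) (auto intro: complexification_eqI)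

lemma bounded_linear_rpart: "bounded_linear (rpart :: 'a::banach_lattice complexification \<Rightarrow> 'a)"
  by (rule bounded_linear_intro[where K = 1]) (auto simp: norm_rpart_le)

lemma bounded_linear_ipart: "bounded_linear (ipart :: 'a::banach_lattice complexification \<Rightarrow> 'a)"
  by (rule bounded_linear_intro[where K = 1]) (auto simp: norm_ipart_le)

lemma emb_linear:
  "emb (x + y) = emb x + emb y" "emb (x - y) = emb x - emb y" "emb (r *\<^sub>R x) = r *\<^sub>R emb x"
  "emb 0 = 0" by (auto intro: complexification_eqI)

lemma emb_le_iff [simp]: "emb x \<le> emb y \<longleftrightarrow> x \<le> y" by (simp add: less_eq_complexification_def)

lemma emb_inject [simp]: "emb x = emb y \<longleftrightarrow> x = y" by (metis emb_parts(1))

lemma nonneg_eq_emb: "0 \<le> z \<Longrightarrow> z = emb (rpart z)"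
  by (simp add: less_eq_complexification_def emb_rpart)


section \<open>Strongly continuous semigroups\<close>

text \<open>Derivatives of orbits arise as limits in which the operator varies together with the
  vector, and such limits are handled as limits of quotients.\<close>

lemma has_vector_derivative_iff_quotient:
  "(f has_vector_derivative d) (at t within S) \<longleftrightarrow>
    ((\<lambda>r. (f r - f t) /\<^sub>R (r - t)) \<longlongrightarrow> d) (at t within S)"
proof -
  have eq: "norm ((f r - f t) - (r - t) *\<^sub>R d) / norm (r - t) = norm ((f r - f t) /\<^sub>R (r - t) - d)"
    if "r \<noteq> t" for r
  proof -
    have "(f r - f t) /\<^sub>R (r - t) - d = ((f r - f t) - (r - t) *\<^sub>R d) /\<^sub>R (r - t)"
      using that by (simp add: scaleR_diff_right)
    then show ?thesis by (simp add: divide_inverse mult.commute abs_inverse)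
  qed
  have "(f has_vector_derivative d) (at t within S) \<longleftrightarrow>
      ((\<lambda>r. norm ((f r - f t) - (r - t) *\<^sub>R d) / norm (r - t)) \<longlongrightarrow> 0) (at t within S)"
    unfolding has_vector_derivative_def has_derivative_iff_norm
    by (simp add: bounded_linear_scaleR_left)
  also have "\<dots> \<longleftrightarrow> ((\<lambda>r. norm ((f r - f t) /\<^sub>R (r - t) - d)) \<longlongrightarrow> 0) (at t within S)"
    by (rule Lim_cong_within) (use eq in auto)
  also have "\<dots> \<longleftrightarrow> ((\<lambda>r. (f r - f t) /\<^sub>R (r - t)) \<longlongrightarrow> d) (at t within S)"
    by (simp add: tendsto_norm_zero_iff LIM_zero_iff)
  finally show ?thesis .
qed

lemma generator_iff:
  "generator T x = Some y \<longleftrightarrow> ((\<lambda>h. (T h x - x) /\<^sub>R h) \<longlongrightarrow> y) (at_right 0)"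
proof -
  have "Lim (at_right 0) (\<lambda>h. (T h x - x) /\<^sub>R h) = y"
    if "((\<lambda>h. (T h x - x) /\<^sub>R h) \<longlongrightarrow> y) (at_right 0)" for y using that by (intro tendsto_Lim) auto
  then show ?thesis unfolding generator_def Let_def by auto
qed

lemma resolvent_solves:
  assumes "\<mu> \<in> resolvent_set A"
  shows "A (resolvent A \<mu> x) = Some (\<mu> *\<^sub>C resolvent A \<mu> x - x)"
proof -
  let ?g = "inv_into (dom A) (shifted A \<mu>)"
  have bij: "bij_betw (shifted A \<mu>) (dom A) UNIV" and bl: "bounded_linear ?g"
    using assms by (auto simp: resolvent_set_def)
  have R: "resolvent A \<mu> x = ?g x"
    unfolding resolvent_def using bl by (simp add: bounded_linear_Blinfun_apply)
  have im: "x \<in> shifted A \<mu> ` dom A" using bij by (simp add: bij_betw_def)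
  have "?g x \<in> dom A" "shifted A \<mu> (?g x) = x"
    using inv_into_into[OF im] f_inv_into_f[OF im] by auto
  then obtain y where "A (?g x) = Some y" "\<mu> *\<^sub>C ?g x - y = x" by (auto simp: shifted_def)
  moreover from this(2) have "y = \<mu> *\<^sub>C ?g x - x" by (metis add_diff_cancel_left' diff_add_cancel)
  ultimately show ?thesis unfolding R by simp
qed

text \<open>Injectivity of \<mu> - A on its domain. Every resolvent identity below is obtained by
  exhibiting a solution and applying this rule.\<close>

lemma resolvent_eqI:
  assumes "\<mu> \<in> resolvent_set A" "A y = Some z" "\<mu> *\<^sub>C y - z = x"
  shows "resolvent A \<mu> x = y"
proof -
  have bij: "bij_betw (shifted A \<mu>) (dom A) UNIV"
    and bl: "bounded_linear (inv_into (dom A) (shifted A \<mu>))"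
    using assms by (auto simp: resolvent_set_def)
  have "y \<in> dom A" "shifted A \<mu> y = x" using assms by (auto simp: shifted_def)
  then have "inv_into (dom A) (shifted A \<mu>) x = y" using bij by (metis bij_betw_def inv_into_f_f)
  then show ?thesis unfolding resolvent_def using bl by (simp add: bounded_linear_Blinfun_apply)
qed

locale semigroup =
  fixes T :: "real \<Rightarrow> 'a::banach_lattice bounded_operator"
  assumes C0: "C0_semigroup T"
begin

abbreviation "A \<equiv> generator T"

lemma T_0 [simp]: "T 0 x = x"
  and T_add: "s \<ge> 0 \<Longrightarrow> t \<ge> 0 \<Longrightarrow> T (s + t) x = T s (T t x)"
  and T_scaleC: "t \<ge> 0 \<Longrightarrow> T t (c *\<^sub>C x) = c *\<^sub>C T t x"
  and T_cont: "continuous_on {0..} (\<lambda>t. T t x)"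
  using C0 by (auto simp: C0_semigroup_def complex_linear_def)

lemma T_commute: "s \<ge> 0 \<Longrightarrow> t \<ge> 0 \<Longrightarrow> T s (T t x) = T t (T s x)" by (metis T_add add.commute)

text \<open>A bound M on [0, 1] propagates by the semigroup law to M^(n+1) on [n, n+1]; taking M at
  least 1 makes \<omega> = ln M nonnegative.\<close>

lemma growth_bound:
  obtains M \<omega> where "M \<ge> 1" "\<omega> \<ge> 0" "\<And>t. t \<ge> 0 \<Longrightarrow> norm (T t) \<le> M * exp (\<omega> * t)"
proof -
  have "\<exists>K. \<forall>t\<in>{0..1}. norm (T t x) \<le> K" for x
  proof -
    have "compact ((\<lambda>t. T t x) ` {0..1})"
      by (intro compact_continuous_image continuous_on_subset[OF T_cont]) auto
    from compact_imp_bounded[OF this] show ?thesis by (auto simp: bounded_iff)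
  qed
  from uniform_boundedness[of "{0..1}" T, OF this]
  obtain K where K: "\<And>t. t \<in> {0..1} \<Longrightarrow> norm (T t) \<le> K" by blast
  define M where "M = max 1 K"
  have M: "M \<ge> 1" "\<And>t. t \<in> {0..1} \<Longrightarrow> norm (T t) \<le> M" by (simp_all add: M_def K max.coboundedI2)
  have step: "norm (T t) \<le> M * M ^ n" if "real n \<le> t" "t \<le> real n + 1" for n t using that
  proof (induction n arbitrary: t)
    case (Suc n)
    have "norm (T t) \<le> M * (M * M ^ n)"
    proof (rule norm_blinfun_bound)
      fix x
      have "T t x = T 1 (T (t - 1) x)" using T_add[of 1 "t - 1" x] Suc.prems by simp
      then have "norm (T t x) \<le> norm (T 1) * (norm (T (t - 1)) * norm x)"
        using order_trans[OF norm_blinfun mult_left_mono[OF norm_blinfun norm_ge_zero]] by simp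
      also have "\<dots> \<le> M * ((M * M ^ n) * norm x)" using Suc M by (intro mult_mono Suc.IH) auto
      finally show "norm (T t x) \<le> M * (M * M ^ n) * norm x" by (simp add: mult_ac)
    qed (use M in simp)
    then show ?case by simp
  qed (use M in simp)
  show ?thesis
  proof (rule that[of M "ln M"])
    show "norm (T t) \<le> M * exp (ln M * t)" if "t \<ge> 0" for t
    proof -
      define n where "n = nat \<lfloor>t\<rfloor>"
      have n: "real n \<le> t" "t \<le> real n + 1" using that unfolding n_def by linarith+
      have "norm (T t) \<le> M * M ^ n" by (rule step[OF n])
      also have "M ^ n = exp (ln M * real n)"
        using M(1) by (simp add: exp_of_nat_mult mult.commute[of "ln M"])
      also have "\<dots> \<le> exp (ln M * t)" using n M(1) by (simp add: mult_left_mono)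
      finally show ?thesis using M(1) by (simp add: mult_left_mono)
    qed
  qed (use M in auto)
qed

text \<open>Joint continuity of (t, x) -> T(t) x: split T(f) g = T(f)(g - x) + T(f) x; the growth
  bound controls the first term and strong continuity the second.\<close>

lemma tendsto_T:
  assumes f: "(f \<longlongrightarrow> t) F" and g: "(g \<longlongrightarrow> x) F" and nn: "eventually (\<lambda>w. f w \<ge> 0) F" "t \<ge> 0"
  shows "((\<lambda>w. T (f w) (g w)) \<longlongrightarrow> T t x) F"
proof -
  obtain M \<omega> where M: "M \<ge> 1" "\<omega> \<ge> 0" "\<And>t. t \<ge> 0 \<Longrightarrow> norm (T t) \<le> M * exp (\<omega> * t)"
    by (rule growth_bound) blast
  have "((\<lambda>w. T (f w) (g w - x)) \<longlongrightarrow> 0) F"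
  proof (rule Lim_null_comparison)
    show "eventually (\<lambda>w. norm (T (f w) (g w - x)) \<le> M * exp (\<omega> * f w) * norm (g w - x)) F"
      using nn(1)
    proof eventually_elim
      case (elim w)
      then show ?case using M(3)[of "f w"]
        by (meson norm_blinfun mult_right_mono norm_ge_zero order_trans)
    qed
    have "((\<lambda>w. M * exp (\<omega> * f w) * norm (g w - x)) \<longlongrightarrow> M * exp (\<omega> * t) * norm (x - x)) F"
      by (intro tendsto_intros f g)
    then show "((\<lambda>w. M * exp (\<omega> * f w) * norm (g w - x)) \<longlongrightarrow> 0) F" by simp
  qed
  moreover have "((\<lambda>w. T (f w) x) \<longlongrightarrow> T t x) F"
    using continuous_on_tendsto_compose[OF T_cont f] nn by simp
  ultimately have "((\<lambda>w. T (f w) (g w - x) + T (f w) x) \<longlongrightarrow> 0 + T t x) F" by (rule tendsto_add)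
  then show ?thesis by (simp add: blinfun.diff_right)
qed

lemma continuous_on_T:
  assumes "continuous_on S f" "continuous_on S g" "\<And>w. w \<in> S \<Longrightarrow> f w \<ge> 0"
  shows "continuous_on S (\<lambda>w. T (f w) (g w))" unfolding continuous_on_def
proof
  fix w assume w: "w \<in> S"
  have "eventually (\<lambda>v. v \<in> S) (at w within S)" by (simp add: eventually_at_filter)
  then have "eventually (\<lambda>v. f v \<ge> 0) (at w within S)" by eventually_elim (rule assms(3))
  with assms w show "((\<lambda>v. T (f v) (g v)) \<longlongrightarrow> T (f w) (g w)) (at w within S)"
    by (intro tendsto_T) (auto simp: continuous_on_def)
qed

lemma generator_scaleC:
  assumes "A x = Some y" shows "A (c *\<^sub>C x) = Some (c *\<^sub>C y)"
proof -
  have "((\<lambda>h. c *\<^sub>C ((T h x - x) /\<^sub>R h)) \<longlongrightarrow> c *\<^sub>C y) (at_right 0)"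
    using assms unfolding generator_iff by (intro scaleC.tendsto tendsto_const)
  moreover have "eventually (\<lambda>h. c *\<^sub>C ((T h x - x) /\<^sub>R h) = (T h (c *\<^sub>C x) - c *\<^sub>C x) /\<^sub>R h)
      (at_right 0)" using eventually_at_right_less
    by eventually_elim (simp add: T_scaleC scaleC.scaleR_right scaleC.diff_right)
  ultimately show ?thesis unfolding generator_iff by (rule Lim_transform_eventually)
qed

lemma generator_T:
  assumes "A x = Some y" "t \<ge> 0" shows "A (T t x) = Some (T t y)"
proof -
  have "((\<lambda>h. T t ((T h x - x) /\<^sub>R h)) \<longlongrightarrow> T t y) (at_right 0)"
    using assms unfolding generator_iff by (intro blinfun.tendsto tendsto_const)
  moreover have "eventually (\<lambda>h. T t ((T h x - x) /\<^sub>R h) = (T h (T t x) - T t x) /\<^sub>R h) (at_right 0)"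
    using eventually_at_right_less by eventually_elim
      (use assms(2) in \<open>simp add: blinfun.scaleR_right blinfun.diff_right T_commute[of _ t]\<close>)
  ultimately show ?thesis unfolding generator_iff by (rule Lim_transform_eventually)
qed

text \<open>The generator is a right-hand limit at 0. Both one-sided quotients at t equal T(min r t)
  applied to the quotient at 0 with step |r - t|, so joint continuity yields the left and the right
  derivative together.\<close>

lemma orbit_derivative:
  assumes "A x = Some y" "t \<ge> 0"
  shows "((\<lambda>r. T r x) has_vector_derivative T t y) (at t within {0..})"
  unfolding has_vector_derivative_iff_quotient
proof -
  define q where "q h = (T h x - x) /\<^sub>R h" for h
  have "filterlim (\<lambda>r. \<bar>r - t\<bar>) (at_right 0) (at t within {0..})" unfolding filterlim_at
    by (auto simp: eventually_at_filter intro!: tendsto_eq_intros)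
  then have "((\<lambda>r. q \<bar>r - t\<bar>) \<longlongrightarrow> y) (at t within {0..})"
    using assms(1) unfolding generator_iff q_def by (rule filterlim_compose[rotated])
  moreover have "((\<lambda>r. min r t) \<longlongrightarrow> min t t) (at t within {0..})" by (intro tendsto_intros)
  ultimately have "((\<lambda>r. T (min r t) (q \<bar>r - t\<bar>)) \<longlongrightarrow> T t y) (at t within {0..})"
    using assms(2) by (intro tendsto_T) (auto simp: eventually_at_filter)
  moreover have "eventually (\<lambda>r. T (min r t) (q \<bar>r - t\<bar>) = (T r x - T t x) /\<^sub>R (r - t)) (at t within {0..})"
    unfolding eventually_at_filter
  proof (intro always_eventually allI impI)
    fix r assume r: "r \<noteq> t" "r \<in> {0..}"
    show "T (min r t) (q \<bar>r - t\<bar>) = (T r x - T t x) /\<^sub>R (r - t)"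
    proof (cases "r < t")
      case True
      then have "T t x = T r (T (t - r) x)" using r T_add[of r "t - r" x] by simp
      with True have "T (min r t) (q \<bar>r - t\<bar>) = (T t x - T r x) /\<^sub>R (t - r)"
        by (simp add: q_def blinfun.scaleR_right blinfun.diff_right)
      also have "\<dots> = (T r x - T t x) /\<^sub>R (r - t)"
        by (metis inverse_minus_eq minus_diff_eq scaleR_minus_left scaleR_minus_right)
      finally show ?thesis .
    next
      case False
      then have "T r x = T t (T (r - t) x)" using r assms(2) T_add[of t "r - t" x] by simp
      with False show ?thesis by (simp add: q_def blinfun.scaleR_right blinfun.diff_right min_def)
    qed
  qed
  ultimately show "((\<lambda>r. (T r x - T t x) /\<^sub>R (r - t)) \<longlongrightarrow> T t y) (at t within {0..})"
    by (rule Lim_transform_eventually)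
qed

lemma resolvent_T:
  assumes "\<mu> \<in> resolvent_set A" "t \<ge> 0"
  shows "resolvent A \<mu> (T t x) = T t (resolvent A \<mu> x)"
  using generator_T[OF resolvent_solves[OF assms(1)] assms(2), of x] assms(2)
  by (intro resolvent_eqI[OF assms(1)]) (auto simp: blinfun.diff_right T_scaleC)

lemma resolvent_scaleC:
  assumes "\<mu> \<in> resolvent_set A"
  shows "resolvent A \<mu> (c *\<^sub>C x) = c *\<^sub>C resolvent A \<mu> x"
  using generator_scaleC[OF resolvent_solves[OF assms], of c x]
  by (intro resolvent_eqI[OF assms]) (auto simp: scaleC.diff_right scaleC_scaleC mult.commute)

text \<open>An antiderivative is -e^(-\<mu>r) T(r) R(\<mu>) x. Stopping at a finite t makes the
  formula valid at every point of the resolvent set, also where the full Laplace integral may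
  diverge.\<close>

lemma laplace_truncated:
  assumes \<mu>: "\<mu> \<in> resolvent_set A" and "t \<ge> 0"
  shows "((\<lambda>r. exp (- \<mu> * of_real r) *\<^sub>C T r x) has_integral
    resolvent A \<mu> (x - exp (- \<mu> * of_real t) *\<^sub>C T t x)) {0..t}"
proof -
  define y where "y = resolvent A \<mu> x"
  have y: "A y = Some (\<mu> *\<^sub>C y - x)" unfolding y_def by (rule resolvent_solves[OF \<mu>])
  define F where "F r = - (exp (- \<mu> * of_real r) *\<^sub>C T r y)" for r
  have "(F has_vector_derivative exp (- \<mu> * of_real r) *\<^sub>C T r x) (at r within {0..t})"
    if r: "r \<in> {0..t}" for r
  proof -
    have "((\<lambda>z. exp (- \<mu> * z)) has_field_derivative - \<mu> * exp (- \<mu> * of_real r)) (at (of_real r))"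
      by (auto intro!: derivative_eq_intros)
    then have 1: "((\<lambda>r. exp (- \<mu> * of_real r)) has_vector_derivative - \<mu> * exp (- \<mu> * of_real r))
        (at r within {0..t})" by (intro has_vector_derivative_real_field)
    have 2: "((\<lambda>r. T r y) has_vector_derivative T r (\<mu> *\<^sub>C y - x)) (at r within {0..t})"
      using r by (intro has_vector_derivative_within_subset[OF orbit_derivative[OF y]]) auto
    show ?thesis unfolding F_def
      using has_vector_derivative_minus[OF scaleC.has_vector_derivative[OF 1 2]] r
      by (simp add: blinfun.diff_right T_scaleC scaleC.diff_right scaleC_scaleC
          scaleC.minus_left mult.commute)
  qed
  from fundamental_theorem_of_calculus[OF \<open>t \<ge> 0\<close> this]
  have "((\<lambda>r. exp (- \<mu> * of_real r) *\<^sub>C T r x) has_integral F t - F 0) {0..t}" by simp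
  moreover have "F t - F 0 = resolvent A \<mu> (x - exp (- \<mu> * of_real t) *\<^sub>C T t x)"
    using assms by (simp add: F_def y_def blinfun.diff_right resolvent_scaleC resolvent_T)
  ultimately show ?thesis by simp
qed

text \<open>The averages F(k)/k of an orbit lie in the domain, since T(k) F(h) = F(h + k) - F(k),
  and they tend to x as k tends to 0.\<close>

lemma domain_dense:
  assumes "e > 0"
  obtains y z where "A y = Some z" "norm (y - x) < e"
proof -
  define F where "F t = integral {0..t} (\<lambda>r. T r x)" for t
  have F: "((\<lambda>k. (F (h + k) - F h) /\<^sub>R k) \<longlongrightarrow> T h x) (at_right 0)" if "h \<ge> 0" for h
  proof -
    have "(F has_vector_derivative T h x) (at h within {0..h + 1})" unfolding F_def using that
      by (intro integral_has_vector_derivative continuous_on_subset[OF T_cont]) auto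
    then have 1: "((\<lambda>r. (F r - F h) /\<^sub>R (r - h)) \<longlongrightarrow> T h x) (at h within {0..h + 1})"
      by (simp add: has_vector_derivative_iff_quotient)
    have "filterlim (\<lambda>k. h + k) (at h within {0..h + 1}) (at_right 0)" unfolding filterlim_at
    proof
      have "((\<lambda>k. h + k) \<longlongrightarrow> h + 0) (at_right 0)" by (intro tendsto_intros)
      then show "((\<lambda>k. h + k) \<longlongrightarrow> h) (at_right 0)" by simp
      have "eventually (\<lambda>k::real. k \<in> {0<..<1}) (at_right 0)"
        by (rule eventually_at_right_real) simp
      then show "eventually (\<lambda>k. h + k \<in> {0..h + 1} \<and> h + k \<noteq> h) (at_right 0)"
        by eventually_elim (use that in auto)
    qed
    from filterlim_compose[OF 1 this] show ?thesis by simp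
  qed
  have int: "(\<lambda>r. T r x) integrable_on {a..b}" if "a \<ge> 0" for a b
    using that by (intro integrable_continuous_real continuous_on_subset[OF T_cont]) auto
  have dom: "A (F h) = Some (T h x - x)" if h: "h \<ge> 0" for h
  proof -
    have "((\<lambda>k. (F (h + k) - F h) /\<^sub>R k - (F (0 + k) - F 0) /\<^sub>R k) \<longlongrightarrow> T h x - T 0 x) (at_right 0)"
      using h by (intro tendsto_diff F) auto
    moreover have "eventually (\<lambda>k. (F (h + k) - F h) /\<^sub>R k - (F (0 + k) - F 0) /\<^sub>R k
        = (T k (F h) - F h) /\<^sub>R k) (at_right 0)" using eventually_at_right_less
    proof eventually_elim
      case (elim k)
      have "T k (F h) = integral {0..h} (\<lambda>r. T k (T r x))"
        unfolding F_def using integral_linear[OF int blinfun.bounded_linear_right, of 0 h "T k"]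
        by (simp add: o_def)
      also have "\<dots> = integral {0..h} ((\<lambda>r. T r x) \<circ> (+) k)"
        using elim by (intro integral_cong) (auto simp: T_add)
      also have "\<dots> = integral {k..h + k} (\<lambda>r. T r x)" by (simp add: integral_shift_Icc_real)
      also have "\<dots> = F (h + k) - F k"
      proof -
        have "F k + integral {k..h + k} (\<lambda>r. T r x) = F (h + k)"
          unfolding F_def using elim h by (intro Henstock_Kurzweil_Integration.integral_combine int) auto
        then show ?thesis by (simp add: eq_diff_eq add.commute)
      qed
      finally have "T k (F h) = F (h + k) - F k" .
      moreover have "F 0 = 0" by (simp add: F_def)
      ultimately show ?case by (simp add: scaleR_diff_right)
    qed
    ultimately show ?thesis unfolding generator_iff by (simp add: Lim_transform_eventually)
  qed
  have "((\<lambda>k. (F (0 + k) - F 0) /\<^sub>R k) \<longlongrightarrow> T 0 x) (at_right 0)" by (rule F) simp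
  from tendstoD[OF this \<open>e > 0\<close>]
  have "eventually (\<lambda>k. norm (F k /\<^sub>R k - x) < e) (at_right 0)" by (simp add: F_def dist_norm)
  then have "eventually (\<lambda>k. norm (F k /\<^sub>R k - x) < e \<and> k > 0) (at_right 0)"
    using eventually_at_right_less by (rule eventually_conj)
  then obtain k where k: "norm (F k /\<^sub>R k - x) < e" "k > 0"
    using eventually_happens[of _ "at_right (0::real)"] by auto
  have "A (F k /\<^sub>R k) = Some ((T k x - x) /\<^sub>R k)"
    using generator_scaleC[OF dom, of k "of_real (inverse k)"] k(2) unfolding scaleC_of_real by simp
  then show ?thesis using k(1) by (rule that)
qed

end

text \<open>The curve r -> T(t - r) y(r) has derivative 0: its quotient is T(t - r') applied to the
  quotient of y, plus the quotient of the orbit of y(r), and the two limits cancel.\<close>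

lemma semigroup_eq_on_solution:
  assumes T: "C0_semigroup T"
    and y: "\<And>r. r \<in> {0..t} \<Longrightarrow> (y has_vector_derivative z r) (at r within {0..t})"
    and z: "\<And>r. r \<in> {0..t} \<Longrightarrow> generator T (y r) = Some (z r)" and t: "t \<ge> 0"
  shows "y t = T t (y 0)"
proof -
  interpret semigroup T by standard (rule T)
  have "((\<lambda>r. T (t - r) (y r)) has_vector_derivative 0) (at r within {0..t})" if r: "r \<in> {0..t}" for r
  proof -
    let ?F = "at r within {0..t}"
    have "((\<lambda>r'. T (t - r') ((y r' - y r) /\<^sub>R (r' - r))) \<longlongrightarrow> T (t - r) (z r)) ?F"
    proof (rule tendsto_T)
      show "((\<lambda>r'. t - r') \<longlongrightarrow> t - r) ?F" by (intro tendsto_intros)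
      show "((\<lambda>r'. (y r' - y r) /\<^sub>R (r' - r)) \<longlongrightarrow> z r) ?F"
        using y[OF r] by (simp add: has_vector_derivative_iff_quotient)
    qed (use r in \<open>auto simp: eventually_at_filter\<close>)
    moreover have "((\<lambda>r'. T (t - r') (y r)) has_vector_derivative (-1) *\<^sub>R T (t - r) (z r)) ?F"
    proof -
      have "((\<lambda>r'. T r' (y r)) has_vector_derivative T (t - r) (z r)) (at (t - r) within (\<lambda>r. t - r) ` {0..t})"
        using r by (intro has_vector_derivative_within_subset[OF orbit_derivative[OF z]]) auto
      moreover have "((\<lambda>r'. t - r') has_vector_derivative -1) ?F"
        by (auto intro!: derivative_eq_intros)
      ultimately show ?thesis using vector_diff_chain_within[of "\<lambda>r. t - r" "-1" r "{0..t}" "\<lambda>r'. T r' (y r)"]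
        by (simp add: o_def)
    qed
    ultimately have "((\<lambda>r'. T (t - r') ((y r' - y r) /\<^sub>R (r' - r)) +
        (T (t - r') (y r) - T (t - r) (y r)) /\<^sub>R (r' - r)) \<longlongrightarrow> T (t - r) (z r) + (-1) *\<^sub>R T (t - r) (z r)) ?F"
      unfolding has_vector_derivative_iff_quotient by (rule tendsto_add)
    then show ?thesis unfolding has_vector_derivative_iff_quotient
      by (simp add: blinfun.scaleR_right blinfun.diff_right scaleR_add_right[symmetric])
  qed
  from fundamental_theorem_of_calculus[OF t this]
  have "((\<lambda>_. 0) has_integral T (t - t) (y t) - T (t - 0) (y 0)) {0..t}" by simp
  then show ?thesis by (simp add: has_integral_0_eq)
qed

lemma generator_determines_semigroup:
  assumes T: "C0_semigroup T" and S: "C0_semigroup S" and gen: "generator S = generator T" and t: "t \<ge> 0"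
  shows "S t = T t"
proof (rule blinfun_eqI)
  interpret T: semigroup T by standard (rule T)
  interpret S: semigroup S by standard (rule S)
  have eq: "S t y = T t y" if y: "generator T y = Some z" for y z
  proof -
    have "S t y = T t (S 0 y)"
    proof (rule semigroup_eq_on_solution[OF T])
      show "((\<lambda>r. S r y) has_vector_derivative S r z) (at r within {0..t})" if "r \<in> {0..t}" for r
        using that y gen by (intro has_vector_derivative_within_subset[OF S.orbit_derivative]) auto
      show "generator T (S r y) = Some (S r z)" if "r \<in> {0..t}" for r
        using S.generator_T[of y z r] that y gen by simp
    qed (rule t)
    then show ?thesis by simp
  qed
  fix x
  let ?K = "norm (S t) + norm (T t) + 1"
  have K: "?K > 0" by (simp add: add_nonneg_pos)
  have "norm (S t x - T t x) \<le> 0 + e" if "e > 0" for e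
  proof -
    obtain y z where yz: "generator T y = Some z" "norm (y - x) < e / ?K"
      using T.domain_dense[of "e / ?K" x] \<open>e > 0\<close> K by auto
    have "S t x - T t x = T t (y - x) - S t (y - x)"
      using eq[OF yz(1)] by (simp add: blinfun.diff_right)
    then have "norm (S t x - T t x) \<le> norm (T t (y - x)) + norm (S t (y - x))"
      by (simp only: norm_triangle_ineq4)
    also have "\<dots> \<le> norm (T t) * norm (y - x) + norm (S t) * norm (y - x)"
      by (intro add_mono norm_blinfun)
    also have "\<dots> \<le> ?K * norm (y - x)" by (simp add: algebra_simps)
    also have "\<dots> \<le> e" using yz(2) K by (simp add: pos_less_divide_eq mult.commute)
    finally show ?thesis by simp
  qed
  then have "norm (S t x - T t x) \<le> 0" by (rule field_le_epsilon)
  then show "S t x = T t x" by simp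
qed


section \<open>Bounded perturbations\<close>

text \<open>Reality of an everywhere defined operator, tested on the embedded real vectors only;
  \<open>real_operator\<close> speaks of partial maps and their domains.\<close>

definition preserves_real :: "'a::banach_lattice bounded_operator \<Rightarrow> bool" where
  "preserves_real L \<longleftrightarrow> (\<forall>x. ipart (L (emb x)) = 0)"

text \<open>Such an L commutes with the real-linear projection z -> \<open>emb (rpart z)\<close>. In
  this form reality passes to mild solutions by uniqueness.\<close>

lemma rpart_preserves_real:
  assumes "complex_linear L" "preserves_real L"
  shows "emb (rpart (L z)) = L (emb (rpart z))"
proof -
  have "L z = L (emb (rpart z)) + L (\<i> *\<^sub>C emb (ipart z))"
    by (metis complexification_split blinfun.add_right)
  also have "L (\<i> *\<^sub>C emb (ipart z)) = \<i> *\<^sub>C L (emb (ipart z))"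
    using assms(1) by (simp add: complex_linear_def)
  finally have "rpart (L z) = rpart (L (emb (rpart z)))"
    using assms(2) by (simp add: preserves_real_def)
  then show ?thesis using assms(2) by (simp add: preserves_real_def emb_rpart)
qed

section \<open>Convolution of the semigroup with a continuous function\<close>

context semigroup
begin

definition conv :: "(real \<Rightarrow> 'a complexification) \<Rightarrow> real \<Rightarrow> 'a complexification" where
  "conv h t = integral {0..t} (\<lambda>r. T (t - r) (h r))"

text \<open>The integral of \<open>conv\<close>, divided by t and transported to the fixed interval
  [0, 1]. It makes sense at t = 0, and its continuity there is the derivative of \<open>conv\<close>
  at 0.\<close>

definition conv_avg :: "(real \<Rightarrow> 'a complexification) \<Rightarrow> real \<Rightarrow> 'a complexification" where
  "conv_avg h t = integral {0..1} (\<lambda>q. T (t * (1 - q)) (h (t * q)))"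

lemma conv_integrable:
  assumes "continuous_on {0..} h"
  shows "(\<lambda>r. T (t - r) (h r)) integrable_on {0..t}"
  by (intro integrable_continuous_real continuous_on_T continuous_intros
      continuous_on_subset[OF assms]) auto

lemma conv_eq_avg:
  assumes h: "continuous_on {0..} h" and "t \<ge> 0"
  shows "conv h t = t *\<^sub>R conv_avg h t"
proof (cases "t = 0")
  case False
  then have t: "t > 0" using assms by simp
  have "((\<lambda>r. T (t - r) (h r)) has_integral conv h t) (cbox 0 t)"
    using conv_integrable[OF h, of t] by (simp add: conv_def integrable_integral)
  from has_integral_affinity'[OF this t, of 0]
  have "((\<lambda>q. T (t - t * q) (h (t * q))) has_integral conv h t /\<^sub>R t) {0..1}" using t by simp
  then have "conv_avg h t = conv h t /\<^sub>R t"
    unfolding conv_avg_def by (simp add: right_diff_distrib integral_unique)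
  then show ?thesis using t by simp
qed (simp add: conv_def)

lemma conv_avg_continuous:
  assumes h: "continuous_on {0..} h"
  shows "continuous_on {0..} (conv_avg h)"
proof -
  have "continuous_on ({0..} \<times> cbox 0 1) (\<lambda>p. T (fst p * (1 - snd p)) (h (fst p * snd p)))"
    by (intro continuous_on_T continuous_intros continuous_on_compose2[OF h]) auto
  then have "continuous_on ({0..} \<times> cbox 0 1) (\<lambda>(t, q). T (t * (1 - q)) (h (t * q)))"
    by (simp add: case_prod_beta)
  from integral_continuous_on_param[OF this] show ?thesis by (simp add: conv_avg_def[abs_def])
qed

lemma conv_continuous:
  assumes h: "continuous_on {0..} h"
  shows "continuous_on {0..} (conv h)"
proof -
  have "continuous_on {0..} (\<lambda>t. t *\<^sub>R conv_avg h t)"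
    by (intro continuous_intros conv_avg_continuous h)
  then show ?thesis by (rule continuous_on_eq) (simp add: conv_eq_avg[OF h])
qed

lemma conv_derivative_0:
  assumes h: "continuous_on {0..} h"
  shows "((\<lambda>k. conv h k /\<^sub>R k) \<longlongrightarrow> h 0) (at_right 0)"
proof -
  have "conv_avg h 0 = h 0" by (simp add: conv_avg_def)
  moreover have "(conv_avg h \<longlongrightarrow> conv_avg h 0) (at_right 0)"
    using conv_avg_continuous[OF h] unfolding continuous_on_def
    by (auto intro: tendsto_within_subset)
  moreover have "eventually (\<lambda>k. conv_avg h k = conv h k /\<^sub>R k) (at_right 0)"
    using eventually_at_right_less by eventually_elim (simp add: conv_eq_avg[OF h])
  ultimately show ?thesis by (metis Lim_transform_eventually)
qed

lemma conv_add:
  assumes "continuous_on {0..} h" "continuous_on {0..} h'"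
  shows "conv (\<lambda>r. h r + h' r) t = conv h t + conv h' t"
  using integral_add[OF conv_integrable[OF assms(1)] conv_integrable[OF assms(2)]]
  by (simp add: conv_def blinfun.add_right)

lemma conv_diff:
  assumes "continuous_on {0..} h" "continuous_on {0..} h'"
  shows "conv (\<lambda>r. h r - h' r) t = conv h t - conv h' t"
  using integral_diff[OF conv_integrable[OF assms(1)] conv_integrable[OF assms(2)]]
  by (simp add: conv_def blinfun.diff_right)

lemma conv_linear:
  assumes h: "continuous_on {0..} h" and L: "bounded_linear L"
    and comm: "\<And>s r. s \<ge> 0 \<Longrightarrow> T s (L (h r)) = L (T s (h r))"
  shows "conv (\<lambda>r. L (h r)) t = L (conv h t)"
proof -
  have "integral {0..t} (\<lambda>r. T (t - r) (L (h r))) = integral {0..t} (L \<circ> (\<lambda>r. T (t - r) (h r)))"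
    by (intro integral_cong) (auto simp: comm)
  then show ?thesis unfolding conv_def using integral_linear[OF conv_integrable[OF h] L] by simp
qed

text \<open>Splitting the integral at s separates the past, moved on by T(t), from the future. This
  is the source of the semigroup law for S.\<close>

lemma conv_shift:
  assumes h: "continuous_on {0..} h" and "s \<ge> 0" "t \<ge> 0"
  shows "conv h (t + s) = T t (conv h s) + conv (\<lambda>r. h (r + s)) t"
proof -
  let ?f = "\<lambda>r. T (t + s - r) (h r)"
  have "integral {0..s} ?f = integral {0..s} (blinfun_apply (T t) \<circ> (\<lambda>r. T (s - r) (h r)))"
    using assms T_add[of t "s - _"] by (intro integral_cong) (auto simp: add_diff_eq)
  also have "\<dots> = T t (conv h s)"
    unfolding conv_def by (intro integral_linear conv_integrable h blinfun.bounded_linear_right)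
  finally have 1: "integral {0..s} ?f = T t (conv h s)" .
  have "integral {s..t + s} ?f = integral {0..t} (?f \<circ> (+) s)"
    using integral_shift_Icc_real[of 0 t ?f s] by (simp add: add.commute)
  also have "\<dots> = conv (\<lambda>r. h (r + s)) t"
    unfolding conv_def by (intro integral_cong) (auto simp: algebra_simps)
  finally have 2: "integral {s..t + s} ?f = conv (\<lambda>r. h (r + s)) t" .
  have "integral {0..s} ?f + integral {s..t + s} ?f = integral {0..t + s} ?f"
    using assms conv_integrable[OF h, of "t + s"]
    by (intro Henstock_Kurzweil_Integration.integral_combine) auto
  then show ?thesis by (simp add: 1 2 conv_def)
qed

text \<open>The weight grows by one exponential unit faster than T: the integral of
  e^(\<omega>(t-r)) e^((\<omega>+1)r) over [0, t] is at most e^((\<omega>+1)t), without a factor t.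
  Hence one estimate serves the whole half-line.\<close>

lemma conv_bound:
  assumes h: "continuous_on {0..} h"
    and T: "\<And>t. t \<ge> 0 \<Longrightarrow> norm (T t) \<le> M * exp (\<omega> * t)" and M: "M \<ge> 0"
    and K: "\<And>r. r \<ge> 0 \<Longrightarrow> norm (h r) \<le> K * exp ((\<omega> + 1) * r)" and t: "t \<ge> 0"
  shows "norm (conv h t) \<le> M * K * exp ((\<omega> + 1) * t)"
proof -
  have K0: "K \<ge> 0" using order_trans[OF norm_ge_zero K[of 0]] by simp
  define c where "c = M * K * exp (\<omega> * t)"
  have c: "c \<ge> 0" using M K0 by (simp add: c_def)
  have "norm (conv h t) \<le> integral {0..t} (\<lambda>r. c * exp r)" unfolding conv_def
  proof (rule Henstock_Kurzweil_Integration.integral_norm_bound_integral)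
    show "(\<lambda>r. T (t - r) (h r)) integrable_on {0..t}" by (rule conv_integrable[OF h])
    show "(\<lambda>r. c * exp r) integrable_on {0..t}"
      by (intro integrable_continuous_real continuous_intros)
    fix r assume r: "r \<in> {0..t}"
    have "norm (T (t - r) (h r)) \<le> norm (T (t - r)) * norm (h r)" by (rule norm_blinfun)
    also have "\<dots> \<le> (M * exp (\<omega> * (t - r))) * (K * exp ((\<omega> + 1) * r))"
      using r M by (intro mult_mono T K) auto
    also have "exp (\<omega> * (t - r)) * exp ((\<omega> + 1) * r) = exp (\<omega> * t) * exp r"
      unfolding mult_exp_exp by (simp add: algebra_simps)
    then have "(M * exp (\<omega> * (t - r))) * (K * exp ((\<omega> + 1) * r)) = c * exp r"
      by (simp add: c_def mult_ac)
    finally show "norm (T (t - r) (h r)) \<le> c * exp r" .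
  qed
  also have "integral {0..t} (\<lambda>r. c * exp r) = c * exp t - c * exp 0"
    by (intro integral_unique fundamental_theorem_of_calculus[OF t])
      (auto intro!: derivative_eq_intros simp: has_real_derivative_iff_has_vector_derivative[symmetric])
  also have "\<dots> \<le> c * exp t" using c by simp
  also have "\<dots> = M * K * exp ((\<omega> + 1) * t)"
    by (simp add: c_def mult.assoc mult_exp_exp) (simp add: algebra_simps)
  finally show ?thesis .
qed

end

section \<open>Mild solutions and the semigroup generated by A + B\<close>

locale perturbed_semigroup = semigroup T for T :: "real \<Rightarrow> 'a::banach_lattice bounded_operator" +
  fixes B :: "'a bounded_operator" and M \<omega> :: real
  assumes B_linear: "complex_linear B"
    and M: "M \<ge> 1" and \<omega>: "\<omega> \<ge> 0" and T_bound: "\<And>t. t \<ge> 0 \<Longrightarrow> norm (T t) \<le> M * exp (\<omega> * t)"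
    and B_small: "M * norm B \<le> 1 / 2"
begin

definition weight :: "real \<Rightarrow> real" where "weight t = exp ((\<omega> + 1) * t)"

lemma weight_pos [simp]: "weight t > 0" by (simp add: weight_def)

lemma weight_cont [continuous_intros]: "continuous_on S f \<Longrightarrow> continuous_on S (\<lambda>x. weight (f x))"
  unfolding weight_def by (intro continuous_intros)

lemma T_le_weight: assumes "t \<ge> 0" shows "norm (T t x) \<le> M * norm x * weight t"
proof -
  have "norm (T t x) \<le> norm (T t) * norm x" by (rule norm_blinfun)
  also have "\<dots> \<le> (M * exp (\<omega> * t)) * norm x" by (intro mult_right_mono T_bound assms) simp
  also have "\<dots> \<le> (M * weight t) * norm x"
    using assms M by (intro mult_right_mono mult_left_mono) (auto simp: weight_def algebra_simps)
  finally show ?thesis by (simp add: mult_ac)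
qed

lemma conv_B_bound:
  assumes h: "continuous_on {0..} h" and K: "\<And>r. r \<ge> 0 \<Longrightarrow> norm (h r) \<le> K * weight r" and t: "t \<ge> 0"
  shows "norm (conv (\<lambda>r. B (h r)) t) \<le> M * norm B * K * weight t"
    and "norm (conv (\<lambda>r. B (h r)) t) \<le> K / 2 * weight t"
proof -
  have "norm (B (h r)) \<le> (norm B * K) * exp ((\<omega> + 1) * r)" if "r \<ge> 0" for r
    using order_trans[OF norm_blinfun mult_left_mono[OF K[OF that] norm_ge_zero]]
    by (simp add: weight_def mult_ac)
  from conv_bound[OF _ T_bound _ this t]
  show 1: "norm (conv (\<lambda>r. B (h r)) t) \<le> M * norm B * K * weight t"
    using M by (simp add: weight_def mult_ac blinfun.continuous_on h)
  have "K * weight 0 \<ge> 0" using K[of 0] norm_ge_zero[of "h 0"] by linarith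
  then have "K \<ge> 0" by (simp add: weight_def)
  then have "M * norm B * K * weight t \<le> 1 / 2 * K * weight t"
    by (intro mult_right_mono B_small) (auto simp: less_imp_le)
  with 1 show "norm (conv (\<lambda>r. B (h r)) t) \<le> K / 2 * weight t" by simp
qed

text \<open>The integral form of y' = (A + B) y, y(0) = x. The growth clause makes the weighted
  supremum finite, so that it can be absorbed in \<open>mild_bound\<close>.\<close>

definition mild :: "(real \<Rightarrow> 'a complexification) \<Rightarrow> 'a complexification \<Rightarrow> bool" where
  "mild y x \<longleftrightarrow> continuous_on {0..} y \<and> (\<exists>K. \<forall>t\<ge>0. norm (y t) \<le> K * weight t) \<and>
    (\<forall>t\<ge>0. y t = T t x + conv (\<lambda>r. B (y r)) t)"

text \<open>The supremum K of norm (y t) / weight t satisfies K \<le> M norm x + K/2, as the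
  convolution halves weighted bounds. For x = 0 this is uniqueness.\<close>

lemma mild_bound:
  assumes y: "mild y x" and "t \<ge> 0"
  shows "norm (y t) \<le> 2 * M * norm x * weight t"
proof -
  obtain K0 where K0: "\<And>t. t \<ge> 0 \<Longrightarrow> norm (y t) \<le> K0 * weight t" and cont: "continuous_on {0..} y"
    and eq: "\<And>t. t \<ge> 0 \<Longrightarrow> y t = T t x + conv (\<lambda>r. B (y r)) t" using y unfolding mild_def by blast
  define Q where "Q = (\<lambda>t. norm (y t) / weight t) ` {0..}"
  define K where "K = Sup Q"
  have bdd: "bdd_above Q"
    by (rule bdd_aboveI[of _ K0]) (use K0 in \<open>auto simp: Q_def pos_divide_le_eq\<close>)
  have K: "norm (y t) \<le> K * weight t" if "t \<ge> 0" for t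
  proof -
    have "norm (y t) / weight t \<in> Q" using that by (auto simp: Q_def)
    then have "norm (y t) / weight t \<le> K" unfolding K_def using bdd by (rule cSup_upper)
    then show ?thesis by (simp add: pos_divide_le_eq)
  qed
  have "K \<le> M * norm x + K / 2" unfolding K_def
  proof (rule cSup_least)
    show "q \<le> M * norm x + Sup Q / 2" if "q \<in> Q" for q
    proof -
      obtain t where t: "q = norm (y t) / weight t" "t \<ge> 0" using \<open>q \<in> Q\<close> by (auto simp: Q_def)
      have "norm (y t) \<le> norm (T t x) + norm (conv (\<lambda>r. B (y r)) t)"
        unfolding eq[OF t(2)] by (rule norm_triangle_ineq)
      also have "\<dots> \<le> M * norm x * weight t + K / 2 * weight t"
        by (intro add_mono T_le_weight conv_B_bound(2) cont K t)
      finally show ?thesis by (simp add: t(1) pos_divide_le_eq distrib_right K_def)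
    qed
  qed (auto simp: Q_def)
  then have "K * weight t \<le> 2 * M * norm x * weight t" by (intro mult_right_mono) (auto simp: less_imp_le)
  with K[OF \<open>t \<ge> 0\<close>] show ?thesis by linarith
qed

lemma mild_combine:
  assumes y: "mild y x" and y': "mild y' x'"
  shows "mild (\<lambda>t. y t + y' t) (x + x')" "mild (\<lambda>t. y t - y' t) (x - x')"
proof -
  have c: "continuous_on {0..} y" "continuous_on {0..} y'" using assms by (auto simp: mild_def)
  note cB = blinfun.continuous_on[OF continuous_on_const c(1), of B]
    blinfun.continuous_on[OF continuous_on_const c(2), of B]
  obtain K K' where K: "\<And>t. t \<ge> 0 \<Longrightarrow> norm (y t) \<le> K * weight t" "\<And>t. t \<ge> 0 \<Longrightarrow> norm (y' t) \<le> K' * weight t"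
    using assms unfolding mild_def by blast
  have "norm (y t + y' t) \<le> (K + K') * weight t" "norm (y t - y' t) \<le> (K + K') * weight t"
    if "t \<ge> 0" for t
    using K[OF that] norm_triangle_ineq[of "y t" "y' t"] norm_triangle_ineq4[of "y t" "y' t"]
    by (auto simp: distrib_right)
  then show "mild (\<lambda>t. y t + y' t) (x + x')" "mild (\<lambda>t. y t - y' t) (x - x')"
    using assms conv_add[OF cB] conv_diff[OF cB] c
    by (auto simp: mild_def blinfun.add_right blinfun.diff_right intro!: continuous_intros)
qed

text \<open>L is only real-linear here, so the lemma serves real scalars, complex scalars and the
  projection onto the real part alike.\<close>

lemma mild_map:
  assumes y: "mild y x" and L: "bounded_linear L"
    and comm: "\<And>s z. s \<ge> 0 \<Longrightarrow> T s (L z) = L (T s z)" "\<And>z. B (L z) = L (B z)"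
  shows "mild (\<lambda>t. L (y t)) (L x)"
proof -
  have c: "continuous_on {0..} y" using assms by (auto simp: mild_def)
  obtain K where K: "\<And>t. t \<ge> 0 \<Longrightarrow> norm (y t) \<le> K * weight t" using y unfolding mild_def by blast
  obtain N where N: "\<And>x. norm (L x) \<le> norm x * N" "N \<ge> 0"
    using bounded_linear.nonneg_bounded[OF L] by blast
  have "norm (L (y t)) \<le> (K * N) * weight t" if "t \<ge> 0" for t
    using order_trans[OF N(1) mult_right_mono[OF K[OF that] N(2)]] by (simp add: mult_ac)
  moreover have "conv (\<lambda>r. B (L (y r))) t = L (conv (\<lambda>r. B (y r)) t)" for t
    unfolding comm(2) by (intro conv_linear L comm(1) blinfun.continuous_on continuous_on_const c)
  ultimately show ?thesis using y
    by (auto simp: mild_def linear_add[OF bounded_linear.linear[OF L]] comm(1) intro!: bounded_linear.continuous_on[OF L])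
qed

lemma mild_unique:
  assumes "mild y x" "mild y' x" "t \<ge> 0"
  shows "y t = y' t" using mild_bound[OF mild_combine(2)[OF assms(1,2)] assms(3)] by simp

lemma mild_shift:
  assumes y: "mild y x" and s: "s \<ge> 0"
  shows "mild (\<lambda>t. y (t + s)) (y s)"
proof -
  have c: "continuous_on {0..} y" and eq: "\<And>t. t \<ge> 0 \<Longrightarrow> y t = T t x + conv (\<lambda>r. B (y r)) t"
    using y by (auto simp: mild_def)
  obtain K where K: "\<And>t. t \<ge> 0 \<Longrightarrow> norm (y t) \<le> K * weight t" using y unfolding mild_def by blast
  have "norm (y (t + s)) \<le> (K * weight s) * weight t" if "t \<ge> 0" for t
    using K[of "t + s"] that s by (simp add: weight_def algebra_simps exp_add)
  moreover have "continuous_on {0..} (\<lambda>t. y (t + s))"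
    by (rule continuous_on_compose2[OF c]) (use s in \<open>auto intro!: continuous_intros\<close>)
  moreover have "y (t + s) = T t (y s) + conv (\<lambda>r. B (y (r + s))) t" if "t \<ge> 0" for t
    using eq[of "t + s"] eq[OF s] that s T_add[of t s x]
      conv_shift[of "\<lambda>r. B (y r)" s t, OF blinfun.continuous_on[OF continuous_on_const c]]
    by (simp add: blinfun.add_right)
  ultimately show ?thesis unfolding mild_def by blast
qed

text \<open>Banach's fixed point theorem for y / \<open>weight\<close> in the bounded continuous
  functions: \<open>B_small\<close> makes the integral equation a contraction with ratio 1/2 on all
  of [0, \<infinity>) at once.\<close>

lemma mild_exists: "\<exists>y. mild y x"
proof -
  define lift where "lift g r = weight r *\<^sub>R apply_bcontfun g r" for g :: "real \<Rightarrow>\<^sub>C 'a complexification" and r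
  have lc: "continuous_on {0..} (lift g)" for g
    unfolding lift_def by (intro continuous_intros continuous_on_apply_bcontfun)
  note lcB = blinfun.continuous_on[OF continuous_on_const lc, of B]
  define F where "F g t = (T t x + conv (\<lambda>r. B (lift g r)) t) /\<^sub>R weight t" for g t
  \<comment> \<open>Bounded continuous functions live on the whole real line; at negative times the
    value at 0 is repeated.\<close>
  define \<Phi> where "\<Phi> g = Bcontfun (\<lambda>t. F g (max 0 t))" for g
  have lb: "norm (lift g r) \<le> norm g * weight r" for g r
    using norm_bounded[of g r] by (simp add: lift_def less_imp_le mult.commute)
  have mem: "(\<lambda>t. F g (max 0 t)) \<in> bcontfun" for g unfolding bcontfun_def
  proof (intro CollectI conjI)
    have "continuous_on {0..} (F g)"
      unfolding F_def by (intro continuous_intros continuous_on_T conv_continuous lcB)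
        (auto simp: less_imp_neq[OF weight_pos, symmetric])
    then show "continuous_on UNIV (\<lambda>t. F g (max 0 t))"
      by (rule continuous_on_compose2) (auto intro!: continuous_intros)
    have "norm (F g t) \<le> M * norm x + norm g / 2" if "t \<ge> 0" for t
    proof -
      have "norm (T t x + conv (\<lambda>r. B (lift g r)) t) \<le> M * norm x * weight t + norm g / 2 * weight t"
        by (intro norm_triangle_le add_mono T_le_weight conv_B_bound(2) lc lb that)
      then have "norm (T t x + conv (\<lambda>r. B (lift g r)) t) / weight t \<le> M * norm x + norm g / 2"
        by (simp add: pos_divide_le_eq distrib_right)
      moreover have "norm (F g t) = norm (T t x + conv (\<lambda>r. B (lift g r)) t) / weight t"
        by (simp add: F_def divide_inverse less_imp_le mult.commute)
      ultimately show ?thesis by simp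
    qed
    then show "bounded (range (\<lambda>t. F g (max 0 t)))"
      unfolding bounded_iff by (intro exI[of _ "M * norm x + norm g / 2"]) auto
  qed
  then have app: "apply_bcontfun (\<Phi> g) t = F g (max 0 t)" for g t
    unfolding \<Phi>_def by (simp add: Bcontfun_inverse)
  have "dist (\<Phi> g) (\<Phi> g') \<le> 1 / 2 * dist g g'" for g g'
  proof (rule dist_bound)
    fix t0 :: real
    define t where "t = max 0 t0"
    have t: "t \<ge> 0" by (simp add: t_def)
    have "norm (lift g r - lift g' r) \<le> dist g g' * weight r" for r using dist_bounded[of g r g']
      by (simp add: lift_def less_imp_le mult.commute dist_norm scaleR_diff_right[symmetric])
    then have "norm (conv (\<lambda>r. B (lift g r - lift g' r)) t) \<le> dist g g' / 2 * weight t"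
      by (intro conv_B_bound(2) continuous_intros lc t)
    then have le: "norm (conv (\<lambda>r. B (lift g r)) t - conv (\<lambda>r. B (lift g' r)) t) / weight t \<le> dist g g' / 2"
      by (simp add: blinfun.diff_right conv_diff[OF lcB lcB] pos_divide_le_eq)
    have "F g t - F g' t = (conv (\<lambda>r. B (lift g r)) t - conv (\<lambda>r. B (lift g' r)) t) /\<^sub>R weight t"
      by (simp add: F_def scaleR_diff_right scaleR_add_right)
    then have "norm (F g t - F g' t) = norm (conv (\<lambda>r. B (lift g r)) t - conv (\<lambda>r. B (lift g' r)) t) / weight t"
      by (simp add: less_imp_le divide_inverse_commute)
    with le have "norm (F g t - F g' t) \<le> 1 / 2 * dist g g'" by simp
    then show "dist (\<Phi> g t0) (\<Phi> g' t0) \<le> 1 / 2 * dist g g'"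
      by (simp only: app t_def[symmetric] dist_norm)
  qed
  then obtain g where g: "\<Phi> g = g" using banach_fix_type[of "1/2" \<Phi>] by auto
  have "lift g t = T t x + conv (\<lambda>r. B (lift g r)) t" if "t \<ge> 0" for t
  proof -
    have "apply_bcontfun g t = F g t" using app[of g t] g that by (simp add: max_def)
    then show ?thesis by (simp add: lift_def F_def less_imp_neq[OF weight_pos, symmetric])
  qed
  then have "mild (lift g) x" using lc lb unfolding mild_def by blast
  then show ?thesis by blast
qed

definition sol :: "'a complexification \<Rightarrow> real \<Rightarrow> 'a complexification" where
  "sol x = (SOME y. mild y x)"

definition S :: "real \<Rightarrow> 'a bounded_operator" where
  "S t = Blinfun (\<lambda>x. sol x t)"

lemma sol: "mild (sol x) x" unfolding sol_def using mild_exists by (rule someI_ex)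

lemma S_apply: assumes "t \<ge> 0" shows "S t x = sol x t"
proof -
  have "bounded_linear (\<lambda>x. sol x t)"
  proof (rule bounded_linear_intro)
    show "sol (x + y) t = sol x t + sol y t" for x y
      using mild_unique[OF sol mild_combine(1)[OF sol sol] assms] by simp
    show "sol (r *\<^sub>R x) t = r *\<^sub>R sol x t" for r x
      using mild_unique[OF sol mild_map[OF sol bounded_linear_scaleR_right] assms]
      by (simp add: blinfun.scaleR_right)
    show "norm (sol x t) \<le> norm x * (2 * M * weight t)" for x
      using mild_bound[OF sol assms] by (simp add: mult_ac)
  qed
  then show ?thesis by (simp add: S_def bounded_linear_Blinfun_apply)
qed

lemma duhamel: "t \<ge> 0 \<Longrightarrow> S t x = T t x + conv (\<lambda>r. B (sol x r)) t"
  using sol[of x] S_apply[of t x] unfolding mild_def by metis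

lemma C0_S: "C0_semigroup S" unfolding C0_semigroup_def complex_linear_def
proof (intro conjI allI impI)
  show "S t (c *\<^sub>C z) = c *\<^sub>C S t z" if "t \<ge> 0" for t c z
    using mild_unique[OF sol mild_map[OF sol scaleC.bounded_linear_right] that] B_linear
    by (simp add: S_apply that T_scaleC complex_linear_def)
  show "S 0 = id_blinfun" by (rule blinfun_eqI) (simp add: duhamel conv_def)
  show "S (s + t) = S s o\<^sub>L S t" if "s \<ge> 0" "t \<ge> 0" for s t
  proof (rule blinfun_eqI)
    show "S (s + t) x = (S s o\<^sub>L S t) x" for x
      using mild_unique[OF mild_shift[OF sol \<open>t \<ge> 0\<close>] sol \<open>s \<ge> 0\<close>, of x] that by (simp add: S_apply)
  qed
  have "continuous_on {0..} (sol x)" for x using sol by (auto simp: mild_def)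
  then show "continuous_on {0..} (\<lambda>t. S t x)" for x by (rule continuous_on_eq) (simp add: S_apply)
qed

text \<open>The quotients of S and T at x differ by \<open>conv\<close> / h, which tends to B x for
  every x. So they converge for the same x, and the domains coincide.\<close>

lemma generator_S: "generator S = perturbed A B"
proof
  fix x
  have "generator S x = Some z \<longleftrightarrow> A x = Some (z - B x)" for z
  proof -
    have c: "continuous_on {0..} (\<lambda>r. B (sol x r))"
      using sol[of x] by (auto simp: mild_def intro!: continuous_intros blinfun.continuous_on)
    have "sol x 0 = x" using duhamel[of 0 x] by (simp add: S_apply conv_def)
    then have lim: "((\<lambda>k. conv (\<lambda>r. B (sol x r)) k /\<^sub>R k) \<longlongrightarrow> B x) (at_right 0)"
      using conv_derivative_0[OF c] by simp
    have eq: "eventually (\<lambda>h. (S h x - x) /\<^sub>R h - conv (\<lambda>r. B (sol x r)) h /\<^sub>R h = (T h x - x) /\<^sub>R h) (at_right 0)"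
      using eventually_at_right_less
      by eventually_elim (simp add: duhamel scaleR_diff_right[symmetric])
    show ?thesis unfolding generator_iff
    proof
      assume "((\<lambda>h. (S h x - x) /\<^sub>R h) \<longlongrightarrow> z) (at_right 0)"
      from Lim_transform_eventually[OF tendsto_diff[OF this lim] eq]
      show "((\<lambda>h. (T h x - x) /\<^sub>R h) \<longlongrightarrow> z - B x) (at_right 0)" .
    next
      assume "((\<lambda>h. (T h x - x) /\<^sub>R h) \<longlongrightarrow> z - B x) (at_right 0)"
      from tendsto_add[OF this lim]
      have "((\<lambda>h. (T h x - x) /\<^sub>R h + conv (\<lambda>r. B (sol x r)) h /\<^sub>R h) \<longlongrightarrow> z) (at_right 0)" by simp
      moreover have "eventually (\<lambda>h. (T h x - x) /\<^sub>R h + conv (\<lambda>r. B (sol x r)) h /\<^sub>R h = (S h x - x) /\<^sub>R h) (at_right 0)"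
        using eq by eventually_elim (simp add: algebra_simps)
      ultimately show "((\<lambda>h. (S h x - x) /\<^sub>R h) \<longlongrightarrow> z) (at_right 0)"
        by (rule Lim_transform_eventually)
    qed
  qed
  moreover have "perturbed A B x = Some z \<longleftrightarrow> A x = Some (z - B x)" for z
    by (auto simp: perturbed_def eq_diff_eq)
  ultimately show "generator S x = perturbed A B x" by (metis not_Some_eq)
qed

lemma S_close: assumes "t \<ge> 0" shows "norm (S t - T t) \<le> 2 * M\<^sup>2 * norm B * weight t"
proof (rule norm_blinfun_bound)
  fix x
  have "norm (conv (\<lambda>r. B (sol x r)) t) \<le> M * norm B * (2 * M * norm x) * weight t"
    using sol[of x] by (intro conv_B_bound(1) mild_bound[OF sol] assms) (auto simp: mild_def)
  then show "norm ((S t - T t) x) \<le> 2 * M\<^sup>2 * norm B * weight t * norm x"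
    by (simp add: blinfun.diff_left duhamel[OF assms] power2_eq_square mult_ac)
qed (simp add: less_imp_le)

text \<open>The real part of the solution that starts at a real vector is again a mild solution with
  the same initial value, hence equal to it.\<close>

lemma S_preserves_real:
  assumes "\<And>t. t \<ge> 0 \<Longrightarrow> preserves_real (T t)" "preserves_real B" "t \<ge> 0"
  shows "preserves_real (S t)" unfolding preserves_real_def
proof
  fix x
  have T: "complex_linear (T t)" if "t \<ge> 0" for t using that by (simp add: complex_linear_def T_scaleC)
  have "mild (\<lambda>t. emb (rpart (sol (emb x) t))) (emb (rpart (emb x)))"
    by (rule mild_map[OF sol, where L = "\<lambda>z. emb (rpart z)"])
      (use assms T B_linear in \<open>auto simp: rpart_preserves_real
        intro: bounded_linear_compose[OF bounded_linear_emb bounded_linear_rpart]\<close>)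
  from mild_unique[OF this _ \<open>t \<ge> 0\<close>, of "sol (emb x)"]
  have "emb (rpart (sol (emb x) t)) = sol (emb x) t" by (simp add: sol)
  then show "ipart (S t (emb x)) = 0" by (metis S_apply assms(3) emb_parts(2))
qed

end


section \<open>Norm decay from a uniform lower bound\<close>

lemma scaleC_blinfun_apply [simp]: "scaleC_blinfun c L x = c *\<^sub>C L x" by transfer simp

text \<open>The power of X with exponent 2^k. Only these exponents occur, because the induction
  below passes from z to its two square roots.\<close>

primrec squared :: "'b::real_normed_vector \<Rightarrow>\<^sub>L 'b \<Rightarrow> nat \<Rightarrow> 'b \<Rightarrow>\<^sub>L 'b" where
  "squared X 0 = X"
| "squared X (Suc k) = squared X k o\<^sub>L squared X k"

lemma complex_linear_squared: "complex_linear X \<Longrightarrow> complex_linear (squared X k)"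
  by (induction k) (auto simp: complex_linear_def)

text \<open>
  With \<open>n = 2\<^sup>k\<close>, the mean of \<open>(1 - \<omega>Z)\<^sup>-\<^sup>2\<close> over the \<open>n\<close>-th roots of unity \<open>\<omega>\<close> is
  \<open>(1 + (n-1)Z\<^sup>n)(1 - Z\<^sup>n)\<^sup>-\<^sup>2\<close>. The induction step is
  \<open>(1 + (n-1)Z)(1 + Z)\<^sup>2 + (1 - (n-1)Z)(1 - Z)\<^sup>2 = 2(1 + (2n-1)Z\<^sup>2)\<close>.
\<close>

lemma squared_estimate:
  fixes X :: "'a::banach_lattice bounded_operator"
  assumes X: "complex_linear X"
    and C: "\<And>z x. cmod z \<le> 1 \<Longrightarrow> norm x \<le> C * norm (x - z *\<^sub>C X x)"
    and z: "cmod z \<le> 1"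
  shows "norm (x + (2 ^ k - 1) *\<^sub>R z *\<^sub>C squared X k x) \<le>
    C\<^sup>2 * norm (x - 2 *\<^sub>R z *\<^sub>C squared X k x + z *\<^sub>C squared X k (z *\<^sub>C squared X k x))" using z
proof (induction k arbitrary: x z)
  case 0
  \<comment> \<open>The assumption at z = 0 forces C \<ge> 0 unless the space is trivial; this is
    needed to apply it twice.\<close>
  have "C \<ge> 0 \<or> (\<forall>x::'a complexification. x = 0)"
  proof (cases "\<forall>x::'a complexification. x = 0")
    case False
    then obtain v :: "'a complexification" where "v \<noteq> 0" by blast
    then show ?thesis using C[of 0 v] by (simp add: zero_less_mult_iff) (smt (verit) norm_le_zero_iff mult_nonpos_nonneg norm_ge_zero)
  qed simp
  moreover have "norm x \<le> C * norm (x - z *\<^sub>C X x)" by (rule C[OF 0])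
  moreover have "norm (x - z *\<^sub>C X x) \<le> C * norm ((x - z *\<^sub>C X x) - z *\<^sub>C X (x - z *\<^sub>C X x))"
    by (rule C[OF 0])
  ultimately have "norm x \<le> C * (C * norm ((x - z *\<^sub>C X x) - z *\<^sub>C X (x - z *\<^sub>C X x)))"
    by (metis mult_left_mono norm_zero order_trans mult_zero_right order_refl)
  moreover have "(x - z *\<^sub>C X x) - z *\<^sub>C X (x - z *\<^sub>C X x) =
      x - 2 *\<^sub>R z *\<^sub>C X x + z *\<^sub>C X (z *\<^sub>C X x)"
    by (simp add: blinfun.diff_right scaleC.diff_right algebra_simps scaleR_2)
  ultimately show ?case by (simp add: power2_eq_square mult.assoc)
next
  case (Suc k)
  define n :: real where "n = 2 ^ k"
  \<comment> \<open>Both square roots w and -w of z stay in the closed unit disc, so the induction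
    hypothesis applies to each.\<close>
  define w where "w = csqrt z"
  have w: "w * w = z" "cmod w \<le> 1" "cmod (- w) \<le> 1"
    using Suc.prems by (simp_all add: w_def flip: power2_eq_square)
  define Z where "Z = scaleC_blinfun w (squared X k)"
  have ZZ: "Z (Z y) = z *\<^sub>C squared X (Suc k) y" for y using complex_linear_squared[OF X, of k]
    by (simp add: Z_def complex_linear_def scaleC_scaleC w)
  have Zm: "(- w) *\<^sub>C squared X k y = - Z y" for y by (simp add: Z_def scaleC.minus_left)
  have Zp: "w *\<^sub>C squared X k y = Z y" for y by (simp add: Z_def)
  \<comment> \<open>p = (1 + Z)^2 x and q = (1 - Z)^2 x, so (1 - Z)^2 p and (1 + Z)^2 q are the same
    vector v = (1 - Z^2)^2 x.\<close>
  define p where "p = x + 2 *\<^sub>R Z x + Z (Z x)"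
  define q where "q = x - 2 *\<^sub>R Z x + Z (Z x)"
  define v where "v = x - 2 *\<^sub>R Z (Z x) + Z (Z (Z (Z x)))"
  note lin = blinfun.add_right blinfun.diff_right blinfun.minus_right blinfun.scaleR_right
  have "norm (p + (n - 1) *\<^sub>R Z p) \<le> C\<^sup>2 * norm v"
  proof -
    have "p - 2 *\<^sub>R Z p + Z (Z p) = v" by (simp add: p_def v_def lin algebra_simps scaleR_2)
    then show ?thesis using Suc.IH[OF w(2), of p] unfolding Zp n_def by simp
  qed
  moreover have "norm (q - (n - 1) *\<^sub>R Z q) \<le> C\<^sup>2 * norm v"
  proof -
    have "q - 2 *\<^sub>R (- Z q) + (- Z (- Z q)) = v"
      by (simp add: q_def v_def lin algebra_simps scaleR_2)
    then show ?thesis using Suc.IH[OF w(3), of q] unfolding Zm n_def by (simp add: lin)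
  qed
  ultimately have "norm ((p + (n - 1) *\<^sub>R Z p) + (q - (n - 1) *\<^sub>R Z q)) \<le> 2 * (C\<^sup>2 * norm v)"
    by (intro norm_triangle_le) simp
  moreover have "(p + (n - 1) *\<^sub>R Z p) + (q - (n - 1) *\<^sub>R Z q) = 2 *\<^sub>R (x + (2 * n - 1) *\<^sub>R Z (Z x))"
  proof -
    have "p + q = 2 *\<^sub>R x + 2 *\<^sub>R Z (Z x)" by (simp add: p_def q_def scaleR_2)
    moreover have "Z p - Z q = 4 *\<^sub>R Z (Z x)"
      by (simp add: p_def q_def lin) (simp add: scaleR_left_distrib[symmetric])
    moreover have "(p + (n - 1) *\<^sub>R Z p) + (q - (n - 1) *\<^sub>R Z q) = (p + q) + (n - 1) *\<^sub>R (Z p - Z q)"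
      by (simp add: scaleR_diff_right)
    moreover have "2 *\<^sub>R y + (n - 1) *\<^sub>R 4 *\<^sub>R y = 2 *\<^sub>R (2 * n - 1) *\<^sub>R y" for y :: "'a complexification"
    proof -
      have "2 + (n - 1) * 4 = 2 * (2 * n - 1)" by simp
      then show ?thesis by (metis scaleR_add_left scaleR_scaleR)
    qed
    ultimately show ?thesis by (simp only: scaleR_add_right add.assoc)
  qed
  ultimately have "norm (x + (2 * n - 1) *\<^sub>R Z (Z x)) \<le> C\<^sup>2 * norm v" by simp
  moreover have "v = x - 2 *\<^sub>R z *\<^sub>C squared X (Suc k) x +
      z *\<^sub>C squared X (Suc k) (z *\<^sub>C squared X (Suc k) x)" unfolding v_def ZZ ..
  ultimately show ?case unfolding ZZ n_def by simp
qed

text \<open>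
  If \<open>\<parallel>X\<^sup>n\<parallel> \<ge> \<eta>\<close>, then \<open>X\<^sup>n\<close> may be rescaled to norm exactly \<open>\<eta>\<close>, and the previous estimate bounds
  \<open>(n-1)\<eta>\<close> independently of \<open>n\<close>.
\<close>

lemma squared_small:
  fixes X :: "'a::banach_lattice bounded_operator"
  assumes X: "complex_linear X"
    and C: "\<And>z x. cmod z \<le> 1 \<Longrightarrow> norm x \<le> C * norm (x - z *\<^sub>C X x)" and "\<eta> > 0"
  shows "\<exists>k. norm (squared X k) < \<eta>"
proof -
  \<comment> \<open>1 + \<eta> dominates the norm of 1 - Z, and the leading 1 pays for removing x
    from x + (2^k - 1) Z x.\<close>
  define b where "b = 1 + C\<^sup>2 * (1 + \<eta>)\<^sup>2"
  obtain k where k: "1 + b / \<eta> < 2 ^ k" using real_arch_pow[of 2 "1 + b / \<eta>"] by auto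
  have b: "b > 0" by (simp add: b_def add_pos_nonneg)
  then have "b / \<eta> > 0" using \<open>\<eta> > 0\<close> by simp
  with k have k1: "(2::real) ^ k - 1 > 0" by linarith
  have "norm (squared X k) < \<eta>"
  proof (rule ccontr)
    assume "\<not> ?thesis"
    then have ge: "norm (squared X k) \<ge> \<eta>" by simp
    define r where "r = \<eta> / norm (squared X k)"
    have r: "0 \<le> r" "r \<le> 1" using ge \<open>\<eta> > 0\<close> by (auto simp: r_def divide_le_eq)
    define Z where "Z = r *\<^sub>R squared X k"
    have "norm (squared X k) \<noteq> 0" using ge \<open>\<eta> > 0\<close> by linarith
    then have nZ: "norm Z = \<eta>" using \<open>\<eta> > 0\<close> by (simp add: Z_def r_def)
    have Z: "complex_of_real r *\<^sub>C squared X k y = Z y" for y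
      by (simp add: Z_def scaleC_of_real blinfun.scaleR_left)
    have "norm Z \<le> b / (2 ^ k - 1)"
    proof (rule norm_blinfun_bound)
      fix x
      have Zn: "norm (Z y) \<le> \<eta> * norm y" for y using norm_blinfun[of Z y] by (simp add: nZ)
      have "norm (Z (Z x)) \<le> \<eta> * (\<eta> * norm x)"
        using order_trans[OF Zn mult_left_mono[OF Zn]] \<open>\<eta> > 0\<close> by simp
      then have "norm (x - 2 *\<^sub>R Z x + Z (Z x)) \<le> norm x + 2 * (\<eta> * norm x) + \<eta> * (\<eta> * norm x)"
        using Zn[of x] by (intro norm_triangle_le add_mono norm_triangle_le_diff) auto
      also have "\<dots> = (1 + \<eta>)\<^sup>2 * norm x" by (simp add: power2_eq_square algebra_simps)
      finally have 1: "C\<^sup>2 * norm (x - 2 *\<^sub>R Z x + Z (Z x)) \<le> C\<^sup>2 * ((1 + \<eta>)\<^sup>2 * norm x)"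
        by (intro mult_left_mono) auto
      have "norm (x + (2 ^ k - 1) *\<^sub>R Z x) \<le> C\<^sup>2 * norm (x - 2 *\<^sub>R Z x + Z (Z x))"
        using squared_estimate[OF X C, of "complex_of_real r" x k] r unfolding Z by simp
      then have "norm ((2 ^ k - 1) *\<^sub>R Z x) \<le> norm x + C\<^sup>2 * ((1 + \<eta>)\<^sup>2 * norm x)"
        using 1 norm_triangle_ineq4[of "x + (2 ^ k - 1) *\<^sub>R Z x" x] by simp
      also have "\<dots> = b * norm x" by (simp add: b_def algebra_simps)
      finally have "(2 ^ k - 1) * norm (Z x) \<le> b * norm x" unfolding norm_scaleR using k1 by simp
      then show "norm (Z x) \<le> b / (2 ^ k - 1) * norm x"
        using k1 by (simp add: pos_le_divide_eq mult.commute)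
    qed (use b k1 in simp)
    also have "\<dots> < \<eta>" using k k1 \<open>\<eta> > 0\<close> by (simp add: field_simps)
    finally show False using nZ by simp
  qed
  then show ?thesis ..
qed

text \<open>Binomial expansion of ((e^(i\<theta>) - e^(-i\<theta>)) / 2i)^(2N). The exponent is
  even, so only even frequencies occur and r -> sin(\<pi>r/p)^(2N) has period p.\<close>

lemma sin_power_expansion:
  obtains c :: "nat \<Rightarrow> complex" where
    "\<And>\<theta>. complex_of_real (sin \<theta> ^ (2 * N)) =
      (\<Sum>j\<le>2 * N. c j * exp (2 * \<i> * (of_nat j - of_nat N) * of_real \<theta>))"
proof
  fix \<theta>
  define e where "e x = exp (x * (\<i> * complex_of_real \<theta>))" for x
  have pow: "e x ^ n = e (of_nat n * x)" for x n
    by (simp add: e_def exp_of_nat_mult[symmetric] mult.assoc)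
  have mul: "e x * e y = e (x + y)" for x y by (simp add: e_def exp_add distrib_right)
  have "complex_of_real (sin \<theta>) = (e 1 + - e (-1)) / (2 * \<i>)"
    by (simp add: sin_of_real[symmetric] sin_exp_eq e_def)
  then have "complex_of_real (sin \<theta> ^ (2 * N)) = (e 1 + - e (-1)) ^ (2 * N) / (2 * \<i>) ^ (2 * N)"
    by (simp only: of_real_power power_divide)
  also have "(e 1 + - e (-1)) ^ (2 * N) =
      (\<Sum>j\<le>2 * N. of_nat (2 * N choose j) * e 1 ^ j * (- e (-1)) ^ (2 * N - j))"
    by (rule binomial_ring)
  also have "\<dots> = (\<Sum>j\<le>2 * N. of_nat (2 * N choose j) * (-1) ^ (2 * N - j) * e (2 * (of_nat j - of_nat N)))"
  proof (rule sum.cong)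
    fix j assume "j \<in> {..2 * N}"
    then have "e 1 ^ j * e (-1) ^ (2 * N - j) = e (2 * (of_nat j - of_nat N))"
      by (simp add: pow mul of_nat_diff algebra_simps)
    then show "of_nat (2 * N choose j) * e 1 ^ j * (- e (-1)) ^ (2 * N - j) =
        of_nat (2 * N choose j) * (-1) ^ (2 * N - j) * e (2 * (of_nat j - of_nat N))"
      by (simp add: power_minus[of "e (-1)"] mult_ac)
  qed simp
  finally show "complex_of_real (sin \<theta> ^ (2 * N)) =
      (\<Sum>j\<le>2 * N. (of_nat (2 * N choose j) * (-1) ^ (2 * N - j) / (2 * \<i>) ^ (2 * N)) *
        exp (2 * \<i> * (of_nat j - of_nat N) * of_real \<theta>))"
    by (simp add: sum_divide_distrib e_def mult_ac)
qed

text \<open>Within distance \<delta>/2 of p/2 the kernel is at least b^(2N), so its integral is at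
  least b^(2N) \<delta>; beyond distance \<delta> it is at most a^(2N). As 0 \<le> a < b, the ratio
  (a/b)^(2N) becomes as small as desired.\<close>

lemma sin_power_concentration:
  fixes p \<delta> K \<eta> :: real
  assumes "p > 0" "0 < \<delta>" "\<delta> \<le> p / 2" "\<eta> > 0"
  obtains N where "integral {0..p} (\<lambda>r. sin (pi * r / p) ^ (2 * N)) > 0"
    "\<And>r. r \<in> {0..p} \<Longrightarrow> \<bar>r - p / 2\<bar> \<ge> \<delta> \<Longrightarrow>
      K * sin (pi * r / p) ^ (2 * N) \<le> \<eta> * integral {0..p} (\<lambda>r. sin (pi * r / p) ^ (2 * N))"
proof -
  define a where "a = cos (pi * \<delta> / p)"
  define b where "b = cos (pi * (\<delta> / 2) / p)"
  have sin_cos: "sin (pi * r / p) = cos (pi * \<bar>r - p / 2\<bar> / p)" for r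
  proof -
    have "pi * (r - p / 2) / p = pi * r / p - pi / 2" using \<open>p > 0\<close> by (simp add: field_simps)
    then have "cos (pi * (r - p / 2) / p) = sin (pi * r / p)" by (simp add: cos_diff)
    moreover have "cos (pi * - (r - p / 2) / p) = cos (pi * (r - p / 2) / p)"
      by (metis cos_minus minus_divide_left mult_minus_right)
    ultimately show ?thesis by (simp only: abs_if split: if_split) simp
  qed
  have ang: "0 \<le> pi * x / p" "pi * x / p \<le> pi / 2" if "0 \<le> x" "x \<le> p / 2" for x
    using that \<open>p > 0\<close> by (auto simp: field_simps)
  have mono: "cos (pi * y / p) \<le> cos (pi * x / p)" if "0 \<le> x" "x \<le> y" "y \<le> p / 2" for x y
  proof (rule cos_monotone_0_pi_le)
    show "pi * x / p \<le> pi * y / p" using that \<open>p > 0\<close> by (intro divide_right_mono mult_left_mono) auto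
    show "pi * y / p \<le> pi" using ang(2)[of y] that pi_ge_zero by linarith
  qed (use ang that in auto)
  have a0: "0 \<le> a" unfolding a_def
  proof (rule cos_ge_zero)
    show "- (pi / 2) \<le> pi * \<delta> / p" using ang(1)[of \<delta>] assms pi_gt_zero by linarith
    show "pi * \<delta> / p \<le> pi / 2" using ang(2)[of \<delta>] assms by linarith
  qed
  have ab: "a < b" unfolding a_def b_def
  proof (rule cos_monotone_0_pi)
    show "pi * (\<delta> / 2) / p < pi * \<delta> / p" using assms by (simp add: field_simps)
    show "pi * \<delta> / p \<le> pi" using ang(2)[of \<delta>] assms pi_ge_zero by linarith
  qed (use assms in auto)
  have "(a\<^sup>2 / b\<^sup>2) < 1" using a0 ab by (simp add: divide_less_eq power_strict_mono)
  then have "(\<lambda>N. \<bar>K\<bar> * (a\<^sup>2 / b\<^sup>2) ^ N) \<longlonglongrightarrow> \<bar>K\<bar> * 0"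
    by (intro tendsto_intros LIMSEQ_realpow_zero) auto
  then have "eventually (\<lambda>N. \<bar>K\<bar> * (a\<^sup>2 / b\<^sup>2) ^ N < \<eta> * \<delta>) sequentially"
    using assms by (intro order_tendstoD) auto
  then obtain N where N: "\<bar>K\<bar> * (a\<^sup>2 / b\<^sup>2) ^ N < \<eta> * \<delta>" by (auto simp: eventually_sequentially)
  define f where "f r = sin (pi * r / p) ^ (2 * N)" for r
  have f0: "f r \<ge> 0" for r unfolding f_def by (simp add: power_mult)
  have int: "f integrable_on {x..y}" for x y
    unfolding f_def using \<open>p > 0\<close> by (intro integrable_continuous_real continuous_intros) auto
  have "b ^ (2 * N) * \<delta> = integral {p / 2 - \<delta> / 2..p / 2 + \<delta> / 2} (\<lambda>_. b ^ (2 * N))"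
    using assms by simp
  also have "\<dots> \<le> integral {p / 2 - \<delta> / 2..p / 2 + \<delta> / 2} f"
  proof (rule integral_le[OF _ int])
    fix r assume "r \<in> {p / 2 - \<delta> / 2..p / 2 + \<delta> / 2}"
    then have r: "\<bar>r - p / 2\<bar> \<le> \<delta> / 2" unfolding abs_le_iff by auto
    show "b ^ (2 * N) \<le> f r" unfolding f_def sin_cos b_def
      using r a0 ab assms by (intro power_mono mono) (auto simp: b_def)
  qed auto
  also have "\<dots> \<le> integral {0..p} f" by (rule integral_subset_le) (use assms f0 int in auto)
  finally have I: "b ^ (2 * N) * \<delta> \<le> integral {0..p} f" .
  have bN: "b ^ (2 * N) > 0" using a0 ab by simp
  show ?thesis
  proof (rule that[of N])
    have "0 < b ^ (2 * N) * \<delta>" using bN assms by simp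
    with I show "integral {0..p} (\<lambda>r. sin (pi * r / p) ^ (2 * N)) > 0" by (simp add: f_def[abs_def])
    fix r assume r: "r \<in> {0..p}" "\<bar>r - p / 2\<bar> \<ge> \<delta>"
    have rp: "\<bar>r - p / 2\<bar> \<le> p / 2" using r(1) by (auto simp: abs_if)
    have "- (pi / 2) \<le> pi * \<bar>r - p / 2\<bar> / p"
      using ang(1)[of "\<bar>r - p / 2\<bar>"] rp pi_gt_zero by linarith
    note ang' = this ang(2)[OF abs_ge_zero rp]
    have "K * f r \<le> \<bar>K\<bar> * f r" by (intro mult_right_mono f0) simp
    also have "\<dots> \<le> \<bar>K\<bar> * a ^ (2 * N)" unfolding f_def sin_cos a_def using r rp assms ang'
      by (intro mult_left_mono power_mono mono cos_ge_zero) auto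
    also have "\<dots> = (\<bar>K\<bar> * (a\<^sup>2 / b\<^sup>2) ^ N) * b ^ (2 * N)"
      using a0 ab by (simp add: power_mult power_divide)
    also have "\<dots> \<le> (\<eta> * \<delta>) * b ^ (2 * N)" using N bN by (intro mult_right_mono) auto
    also have "\<dots> \<le> \<eta> * integral {0..p} f" using I assms by (simp add: mult.assoc mult.commute[of \<delta>])
    finally show "K * sin (pi * r / p) ^ (2 * N) \<le> \<eta> * integral {0..p} (\<lambda>r. sin (pi * r / p) ^ (2 * N))"
      by (simp add: f_def[abs_def])
  qed
qed

lemma exp_lipschitz_left_half_plane:
  assumes "Re w \<le> 0" "Re z \<le> 0"
  shows "cmod (exp w - exp z) \<le> cmod (w - z)"
proof -
  have "cmod (exp w - exp z) \<le> 1 * cmod (w - z)"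
  proof (rule field_differentiable_bound[of "{v. Re v \<le> 0}" exp exp])
    show "convex {v. Re v \<le> 0}" by (rule convex_halfspace_Re_le)
  qed (use assms in \<open>auto intro!: derivative_eq_intros\<close>)
  then show ?thesis by simp
qed


section \<open>Decay on the complement of the pole\<close>

text \<open>\<open>resolvent_bdd\<close> is local: it bounds the resolvent on the complement of P
  over bounded parts of the closed right half-plane, up to the pole, with a constant that may grow
  with b. Norm continuity supplies the control at high frequencies.\<close>

locale spectral_gap = semigroup T for T :: "real \<Rightarrow> 'a::banach_lattice bounded_operator" +
  fixes P :: "'a bounded_operator" and s t0 :: real
  assumes P_linear: "complex_linear P" and P_idem: "P (P x) = P x"
    and P_T: "t \<ge> 0 \<Longrightarrow> P (T t x) = T t (P x)"
    and resolvent_set: "\<lbrakk>Re \<mu> \<ge> 0; \<mu> \<noteq> 0\<rbrakk> \<Longrightarrow> of_real s + \<mu> \<in> resolvent_set A"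
    and resolvent_bdd: "\<exists>C. \<forall>\<mu>. Re \<mu> \<ge> 0 \<and> \<mu> \<noteq> 0 \<and> cmod \<mu> \<le> b \<longrightarrow>
      (\<forall>x. norm (resolvent A (of_real s + \<mu>) (x - P x)) \<le> C * norm x)"
    and t0: "t0 \<ge> 0" and norm_cont: "continuous_on {t0<..} T"
begin

definition U :: "real \<Rightarrow> 'a bounded_operator" where
  "U t = exp (- s * t) *\<^sub>R (T t o\<^sub>L (id_blinfun - P))"

lemma U_apply: "U t x = exp (- s * t) *\<^sub>R T t (x - P x)"
  by (simp add: U_def blinfun.scaleR_left blinfun.diff_left)

lemma U_scaleC: "t \<ge> 0 \<Longrightarrow> U t (c *\<^sub>C x) = c *\<^sub>C U t x" using P_linear
  by (simp add: U_apply complex_linear_def T_scaleC scaleC.scaleR_right flip: scaleC.diff_right)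

lemma U_proj: "t \<ge> 0 \<Longrightarrow> U t x - P (U t x) = U t x"
  by (simp add: U_apply blinfun.scaleR_right P_T blinfun.diff_right P_idem)

lemma U_add: "t \<ge> 0 \<Longrightarrow> r \<ge> 0 \<Longrightarrow> U (t + r) x = U t (U r x)"
proof -
  assume tr: "t \<ge> 0" "r \<ge> 0"
  have "exp (- s * (t + r)) = exp (- s * t) * exp (- s * r)"
    by (simp add: exp_add[symmetric] algebra_simps)
  then have "U (t + r) x = exp (- s * t) *\<^sub>R T t (U r x)"
    using tr by (simp add: U_apply T_add blinfun.scaleR_right)
  also have "\<dots> = U t (U r x)" using U_proj[OF tr(2), of x] by (simp add: U_apply[of t])
  finally show ?thesis .
qed

lemma U_cont: "continuous_on {t0<..} U" unfolding U_def by (intro continuous_intros norm_cont)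

abbreviation (input) sinpow :: "real \<Rightarrow> nat \<Rightarrow> real \<Rightarrow> real" where
  "sinpow p N r \<equiv> sin (pi * r / p) ^ (2 * N)"

abbreviation (input) damp :: "complex \<Rightarrow> real \<Rightarrow> complex" where
  "damp \<mu> r \<equiv> exp (- \<mu> * of_real r)"

text \<open>The boundary term at p combines with y to y - e^(-\<mu>p) U(p) y, the very vector from
  which norm x is to be bounded.\<close>

lemma U_laplace:
  assumes "Re \<mu> \<ge> 0" "\<mu> \<noteq> 0" and p: "p \<ge> 0"
  shows "((\<lambda>r. damp \<mu> r *\<^sub>C U r y) has_integral
    resolvent A (of_real s + \<mu>) ((y - damp \<mu> p *\<^sub>C U p y) -
      P (y - damp \<mu> p *\<^sub>C U p y))) {0..p}"
proof -
  have e: "damp \<mu> r *\<^sub>C U r y = exp (- (of_real s + \<mu>) * of_real r) *\<^sub>C T r (y - P y)" for r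
  proof -
    have "exp (- (of_real s + \<mu>) * of_real r) = damp \<mu> r * of_real (exp (- s * r))"
      by (simp add: exp_of_real[symmetric] exp_add[symmetric] algebra_simps)
    then show ?thesis by (simp add: U_apply scaleC_scaleC[symmetric] scaleC_of_real)
  qed
  have "P (damp \<mu> p *\<^sub>C U p y) = damp \<mu> p *\<^sub>C P (U p y)"
    using P_linear by (simp add: complex_linear_def)
  moreover have "P (U p y) = 0" using U_proj[OF p, of y] by simp
  ultimately have eq: "(y - damp \<mu> p *\<^sub>C U p y) - P (y - damp \<mu> p *\<^sub>C U p y) =
      (y - P y) - damp \<mu> p *\<^sub>C U p y" by (simp add: blinfun.diff_right scaleC.zero_right)
  show ?thesis
    unfolding eq unfolding e by (rule laplace_truncated[OF resolvent_set[OF assms(1,2)] p])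
qed

text \<open>Multiplication by the kernel replaces \<mu> by the 2N + 1 values \<mu> - 2\<pi>i(j -
  N)/p, all with the same e^(-\<mu>p). So every truncated Laplace integral produces a resolvent
  applied to the same vector g.\<close>

lemma smoothed_orbit:
  assumes \<mu>: "Re \<mu> \<ge> 0" "damp \<mu> p \<noteq> 1" "cmod \<mu> \<le> \<beta>" and p: "p > 0"
    and c: "\<And>\<theta>. complex_of_real (sin \<theta> ^ (2 * N)) =
      (\<Sum>j\<le>2 * N. c j * exp (2 * \<i> * (of_nat j - of_nat N) * of_real \<theta>))"
    and C: "\<And>\<mu> x. Re \<mu> \<ge> 0 \<Longrightarrow> \<mu> \<noteq> 0 \<Longrightarrow> cmod \<mu> \<le> \<beta> + 2 * pi * N / p \<Longrightarrow>
      norm (resolvent A (of_real s + \<mu>) (x - P x)) \<le> C * norm x"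
  shows "norm (integral {0..p} (\<lambda>r. sinpow p N r *\<^sub>R damp \<mu> r *\<^sub>C U r y))
    \<le> (\<Sum>j\<le>2 * N. cmod (c j)) * C * norm (y - damp \<mu> p *\<^sub>C U p y)"
proof -
  define m where "m j = \<mu> - 2 * pi * \<i> * (of_nat j - of_nat N) / of_real p" for j
  define g where "g = y - damp \<mu> p *\<^sub>C U p y"
  have period: "exp (- m j * of_real p) = damp \<mu> p" for j
  proof -
    have "- m j * of_real p = - \<mu> * of_real p + (2 * of_int (int j - int N) * pi) * \<i>"
      using p by (simp add: m_def field_simps)
    then show ?thesis
      unfolding exp_eq by (intro exI[of _ "int j - int N"]) (simp add: algebra_simps)
  qed
  \<comment> \<open>Nonvanishing is where e^(-\<mu>p) \<noteq> 1 enters: it keeps every shifted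
    frequency off the pole.\<close>
  have m: "Re (m j) \<ge> 0" "m j \<noteq> 0" for j
  proof -
    show "m j \<noteq> 0" using period[of j] \<mu>(2) by auto
    show "Re (m j) \<ge> 0" using \<mu>(1) p by (simp add: m_def)
  qed
  have m_le: "cmod (m j) \<le> \<beta> + 2 * pi * N / p" if "j \<le> 2 * N" for j
  proof -
    have "cmod (m j) \<le> cmod \<mu> + cmod (2 * pi * \<i> * (of_nat j - of_nat N) / of_real p)"
      unfolding m_def by (rule norm_triangle_ineq4)
    also have "cmod (2 * pi * \<i> * (of_nat j - of_nat N) / of_real p) = 2 * pi * \<bar>real j - real N\<bar> / p"
    proof -
      have "complex_of_nat j - of_nat N = of_real (real j - real N)" by simp
      then show ?thesis using p by (simp only: norm_mult norm_divide norm_of_real norm_ii) simp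
    qed
    also have "\<dots> \<le> 2 * pi * real N / p"
      using that p by (intro divide_right_mono mult_left_mono) (auto simp: abs_le_iff)
    finally show ?thesis using \<mu>(3) by simp
  qed
  have eq: "sinpow p N r *\<^sub>R damp \<mu> r *\<^sub>C U r y =
      (\<Sum>j\<le>2 * N. c j *\<^sub>C exp (- m j * of_real r) *\<^sub>C U r y)" for r
  proof -
    have "exp (2 * \<i> * (of_nat j - of_nat N) * of_real (pi * r / p)) * damp \<mu> r =
        exp (- m j * of_real r)" for j
    proof -
      have "2 * \<i> * (of_nat j - of_nat N) * of_real (pi * r / p) + - \<mu> * of_real r = - m j * of_real r"
        using p by (simp add: m_def field_simps)
      then show ?thesis by (simp only: exp_add[symmetric])
    qed
    then have "complex_of_real (sinpow p N r) * damp \<mu> r =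
        (\<Sum>j\<le>2 * N. c j * exp (- m j * of_real r))"
      unfolding c sum_distrib_right by (simp add: mult.assoc)
    moreover have "sinpow p N r *\<^sub>R damp \<mu> r *\<^sub>C U r y =
        (complex_of_real (sinpow p N r) * damp \<mu> r) *\<^sub>C U r y"
      by (simp only: scaleC_scaleC[symmetric] scaleC_of_real)
    ultimately show ?thesis by (simp add: scaleC_scaleC scaleC.sum_left)
  qed
  have "((\<lambda>r. sinpow p N r *\<^sub>R damp \<mu> r *\<^sub>C U r y) has_integral
      (\<Sum>j\<le>2 * N. c j *\<^sub>C resolvent A (of_real s + m j) (g - P g))) {0..p}" unfolding eq
  proof (rule has_integral_sum)
    fix j
    show "((\<lambda>r. c j *\<^sub>C exp (- m j * of_real r) *\<^sub>C U r y) has_integral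
        c j *\<^sub>C resolvent A (of_real s + m j) (g - P g)) {0..p}"
      using has_integral_linear[OF U_laplace[OF m(1,2), of p j y] scaleC.bounded_linear_right[of "c j"]] p
      unfolding period g_def o_def by simp
  qed simp
  then have "integral {0..p} (\<lambda>r. sinpow p N r *\<^sub>R damp \<mu> r *\<^sub>C U r y) =
      (\<Sum>j\<le>2 * N. c j *\<^sub>C resolvent A (of_real s + m j) (g - P g))" by (rule integral_unique)
  also have "norm \<dots> \<le> (\<Sum>j\<le>2 * N. cmod (c j) * (C * norm g))"
  proof (rule order_trans[OF norm_sum sum_mono])
    fix j assume "j \<in> {..2 * N}"
    then show "norm (c j *\<^sub>C resolvent A (of_real s + m j) (g - P g)) \<le> cmod (c j) * (C * norm g)"
      unfolding norm_scaleC using m m_le[of j] by (intro mult_left_mono C) auto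
  qed
  also have "\<dots> = (\<Sum>j\<le>2 * N. cmod (c j)) * C * norm g" by (simp add: sum_distrib_right mult.assoc)
  finally show ?thesis unfolding g_def .
qed

text \<open>
  The kernel \<open>sin(\<pi>r/p)\<^sup>2\<^sup>N\<close> is a trigonometric polynomial of period \<open>p\<close>, so \<open>smoothed_orbit\<close> controls the
  smoothed orbit by finitely many resolvents. As it concentrates at \<open>p/2\<close>, norm continuity recovers from
  it \<open>U(p)\<^sup>2x\<close>, uniformly in \<open>x\<close>.
\<close>

lemma U_bounded_below_aux:
  assumes p: "p > t0" and "\<beta> \<ge> 0"
  obtains C where "\<And>\<mu> x. Re \<mu> \<ge> 0 \<Longrightarrow> cmod \<mu> \<le> \<beta> \<Longrightarrow> damp \<mu> p \<noteq> 1 \<Longrightarrow>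
    norm x \<le> C * norm (x - damp \<mu> p *\<^sub>C U p x)"
proof -
  have p0: "p > 0" using p t0 by simp
  \<comment> \<open>Then p/2 + \<tau> = 2p, so the centre of the kernel sees U(p)^2, and r + \<tau>
    stays above t0, in the range of norm continuity.\<close>
  define \<tau> where "\<tau> = 3 * p / 2"
  define D where "D = (SUP r\<in>{0..p}. norm (U (r + \<tau>)))"
  have cont: "continuous_on {0..p} (\<lambda>r. U (r + \<tau>))" by (rule continuous_on_compose2[OF U_cont])
      (use p t0 in \<open>auto simp: \<tau>_def intro!: continuous_intros\<close>)
  have "compact ((\<lambda>r. norm (U (r + \<tau>))) ` {0..p})"
    by (intro compact_continuous_image continuous_on_norm cont) auto
  then have bdd: "bdd_above ((\<lambda>r. norm (U (r + \<tau>))) ` {0..p})"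
    by (intro bounded_imp_bdd_above compact_imp_bounded)
  have D: "norm (U (r + \<tau>)) \<le> D" if "r \<in> {0..p}" for r
    unfolding D_def by (rule cSUP_upper[OF that bdd])
  have D0: "D \<ge> 0" using order_trans[OF norm_ge_zero D[of 0]] p0 by simp
  have uc: "uniformly_continuous_on {0..p} (\<lambda>r. U (r + \<tau>))"
    by (intro compact_uniformly_continuous cont) auto
  obtain \<delta>1 where \<delta>1: "\<delta>1 > 0"
    "\<And>r r'. r \<in> {0..p} \<Longrightarrow> r' \<in> {0..p} \<Longrightarrow> dist r' r < \<delta>1 \<Longrightarrow> dist (U (r' + \<tau>)) (U (r + \<tau>)) < 1 / 8"
    by (rule uniformly_continuous_onE[OF uc, of "1 / 8"]) auto
  \<comment> \<open>Within \<delta> of p/2 the exponential factor contributes at most \<beta> D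
    \<delta> \<le> 1/8 and the operator at most 1/8.\<close>
  define \<delta> where "\<delta> = min (p / 2) (min \<delta>1 (1 / (8 * (\<beta> * D + 1))))"
  have bD: "\<beta> * D \<ge> 0" using \<open>\<beta> \<ge> 0\<close> D0 by simp
  have \<delta>: "0 < \<delta>" "\<delta> \<le> p / 2" "\<delta> \<le> \<delta>1" using p0 \<delta>1(1) bD by (auto simp: \<delta>_def add_nonneg_pos)
  have \<delta>D: "\<beta> * D * \<delta> \<le> 1 / 8"
  proof -
    have "\<beta> * D * \<delta> \<le> \<beta> * D * (1 / (8 * (\<beta> * D + 1)))"
      using bD by (intro mult_left_mono) (auto simp: \<delta>_def)
    also have "\<dots> \<le> 1 / 8" using bD by (simp add: field_simps)
    finally show ?thesis .
  qed
  \<comment> \<open>Outside the window the crude bound 2D is multiplied by the kernel; 1/(4p) makes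
    the tail contribute at most I/4 over an interval of length p.\<close>
  obtain N where N: "integral {0..p} (\<lambda>r. sinpow p N r) > 0"
    "\<And>r. r \<in> {0..p} \<Longrightarrow> \<bar>r - p / 2\<bar> \<ge> \<delta> \<Longrightarrow>
      2 * D * sinpow p N r \<le> 1 / (4 * p) * integral {0..p} (\<lambda>r. sinpow p N r)"
    using sin_power_concentration[of p \<delta> "1 / (4 * p)" "2 * D"] p0 \<delta> by auto
  define k where "k r = sinpow p N r" for r
  define I where "I = integral {0..p} k"
  have I: "I > 0" using N(1) by (simp add: I_def k_def[abs_def])
  have k0: "k r \<ge> 0" for r unfolding k_def by (simp add: power_mult)
  have k_cont: "continuous_on {0..p} k" unfolding k_def using p0 by (intro continuous_intros) auto
  obtain c where c: "\<And>\<theta>. complex_of_real (sin \<theta> ^ (2 * N)) =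
      (\<Sum>j\<le>2 * N. c j * exp (2 * \<i> * (of_nat j - of_nat N) * of_real \<theta>))"
    by (rule sin_power_expansion[of N]) blast
  obtain C where C: "\<And>\<mu> x. Re \<mu> \<ge> 0 \<Longrightarrow> \<mu> \<noteq> 0 \<Longrightarrow> cmod \<mu> \<le> \<beta> + 2 * pi * N / p \<Longrightarrow>
      norm (resolvent A (of_real s + \<mu>) (x - P x)) \<le> C * norm x"
    using resolvent_bdd[of "\<beta> + 2 * pi * N / p"] by blast
  define C1 where "C1 = \<bar>(\<Sum>j\<le>2 * N. cmod (c j)) * C\<bar> * norm (U \<tau>)"
  have "norm x \<le> (2 * (1 + norm (U p) + C1 / I)) * norm (x - damp \<mu> p *\<^sub>C U p x)"
    if \<mu>: "Re \<mu> \<ge> 0" "cmod \<mu> \<le> \<beta>" "damp \<mu> p \<noteq> 1" for \<mu> x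
  proof -
    define g where "g = x - damp \<mu> p *\<^sub>C U p x"
    define f where "f r = damp \<mu> r *\<^sub>C U (r + \<tau>) x" for r
    have exp_le: "cmod (damp \<mu> r) \<le> 1" if "r \<ge> 0" for r using \<mu>(1) that by simp
    have \<tau>0: "\<tau> \<ge> 0" using p0 by (simp add: \<tau>_def)
    define J where "J = integral {0..p} (\<lambda>r. k r *\<^sub>R f r)"
    have J: "norm J \<le> C1 * norm g"
    proof -
      have "J = integral {0..p} (\<lambda>r. sinpow p N r *\<^sub>R damp \<mu> r *\<^sub>C U r (U \<tau> x))"
        unfolding J_def by (intro integral_cong) (use \<tau>0 in \<open>simp add: f_def k_def U_add\<close>)
      then have "norm J \<le> (\<Sum>j\<le>2 * N. cmod (c j)) * C * norm (U \<tau> x - damp \<mu> p *\<^sub>C U p (U \<tau> x))"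
        using smoothed_orbit[OF \<mu>(1,3,2) p0 c C] by simp
      also have "U \<tau> x - damp \<mu> p *\<^sub>C U p (U \<tau> x) = U \<tau> g"
        using U_add[of p \<tau> x] U_add[of \<tau> p x] \<tau>0 p0
        by (simp add: g_def blinfun.diff_right U_scaleC add.commute)
      also have "(\<Sum>j\<le>2 * N. cmod (c j)) * C * norm (U \<tau> g) \<le>
          \<bar>(\<Sum>j\<le>2 * N. cmod (c j)) * C\<bar> * (norm (U \<tau>) * norm g)"
        by (intro mult_mono norm_blinfun) auto
      finally show ?thesis by (simp add: C1_def mult.assoc)
    qed
    \<comment> \<open>One bound covers both cases: the first summand pays inside the window, the
      second outside. Its integral is I/2 times norm x, half of what can be absorbed.\<close>
    have near: "k r * norm (f r - f (p / 2)) \<le> (k r / 4 + I / (4 * p)) * norm x" if r: "r \<in> {0..p}" for r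
    proof (cases "\<bar>r - p / 2\<bar> < \<delta>")
      case True
      have "f r - f (p / 2) = (damp \<mu> r - damp \<mu> (p / 2)) *\<^sub>C U (r + \<tau>) x +
          damp \<mu> (p / 2) *\<^sub>C (U (r + \<tau>) - U (p / 2 + \<tau>)) x"
        by (simp add: f_def scaleC.diff_left blinfun.diff_left scaleC.diff_right)
      then have "norm (f r - f (p / 2)) \<le>
          cmod (damp \<mu> r - damp \<mu> (p / 2)) * norm (U (r + \<tau>) x) +
          cmod (damp \<mu> (p / 2)) * norm ((U (r + \<tau>) - U (p / 2 + \<tau>)) x)"
        by (metis norm_triangle_ineq norm_scaleC)
      also have "\<dots> \<le> (\<beta> * \<delta>) * (D * norm x) + 1 * (1 / 8 * norm x)"
      proof (intro add_mono mult_mono)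
        have "cmod (damp \<mu> r - damp \<mu> (p / 2)) \<le>
            cmod (- \<mu> * of_real r - - \<mu> * of_real (p / 2))"
          using \<mu>(1) r p0 by (intro exp_lipschitz_left_half_plane) auto
        also have "\<dots> = cmod (\<mu> * of_real (p / 2 - r))" by (simp add: algebra_simps)
        also have "\<dots> = cmod \<mu> * \<bar>p / 2 - r\<bar>" by (simp only: norm_mult norm_of_real)
        also have "\<dots> \<le> \<beta> * \<delta>" using \<mu>(2) True \<open>\<beta> \<ge> 0\<close> by (intro mult_mono) auto
        finally show "cmod (damp \<mu> r - damp \<mu> (p / 2)) \<le> \<beta> * \<delta>" .
        show "norm (U (r + \<tau>) x) \<le> D * norm x"
          by (rule order_trans[OF norm_blinfun mult_right_mono[OF D[OF r] norm_ge_zero]])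
        show "cmod (damp \<mu> (p / 2)) \<le> 1" using p0 by (intro exp_le) simp
        have "norm (U (r + \<tau>) - U (p / 2 + \<tau>)) \<le> 1 / 8"
          using \<delta>1(2)[of "p / 2" r] r p0 True \<delta>(3) by (auto simp: dist_norm)
        then show "norm ((U (r + \<tau>) - U (p / 2 + \<tau>)) x) \<le> 1 / 8 * norm x"
          by (rule order_trans[OF norm_blinfun mult_right_mono]) simp
      qed (use \<open>\<beta> \<ge> 0\<close> \<delta> in auto)
      also have "\<dots> = (\<beta> * D * \<delta> + 1 / 8) * norm x" by (simp add: algebra_simps)
      also have "\<dots> \<le> 1 / 4 * norm x" using \<delta>D by (intro mult_right_mono) auto
      finally have "k r * norm (f r - f (p / 2)) \<le> k r * (1 / 4 * norm x)" using k0 by (intro mult_left_mono)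
      also have "\<dots> \<le> (k r / 4 + I / (4 * p)) * norm x" using I p0 by (simp add: distrib_right)
      finally show ?thesis .
    next
      case False
      have f_le: "norm (f q) \<le> D * norm x" if "q \<in> {0..p}" for q
      proof -
        have "norm (f q) \<le> 1 * norm (U (q + \<tau>) x)"
          unfolding f_def norm_scaleC using that by (intro mult_right_mono exp_le) auto
        also have "norm (U (q + \<tau>) x) \<le> D * norm x"
          by (rule order_trans[OF norm_blinfun mult_right_mono[OF D[OF that] norm_ge_zero]])
        finally show ?thesis by simp
      qed
      have "norm (f r - f (p / 2)) \<le> 2 * D * norm x"
        using norm_triangle_ineq4[of "f r" "f (p / 2)"] f_le[OF r] f_le[of "p / 2"] p0 by simp
      then have "k r * norm (f r - f (p / 2)) \<le> k r * (2 * D * norm x)" using k0 by (intro mult_left_mono)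
      also have "\<dots> = (2 * D * k r) * norm x" by simp
      also have "\<dots> \<le> (I / (4 * p)) * norm x"
        using N(2)[OF r] False by (intro mult_right_mono) (auto simp: k_def I_def[unfolded k_def[abs_def]])
      also have "\<dots> \<le> (k r / 4 + I / (4 * p)) * norm x" using k0 by (intro mult_right_mono) auto
      finally show ?thesis .
    qed
    have f_cont: "continuous_on {0..p} f" unfolding f_def
      by (intro scaleC.continuous_on blinfun.continuous_on[OF cont continuous_on_const])
        (intro continuous_intros)
    have "norm (integral {0..p} (\<lambda>r. k r *\<^sub>R (f r - f (p / 2)))) \<le>
        integral {0..p} (\<lambda>r. (k r / 4 + I / (4 * p)) * norm x)"
      by (intro Henstock_Kurzweil_Integration.integral_norm_bound_integral integrable_continuous_real
          continuous_intros k_cont f_cont) (use near k0 p0 in \<open>auto simp: abs_of_nonneg\<close>)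
    also have "\<dots> = (I / 4 + I / 4) * norm x"
    proof -
      have 1: "(k has_integral I) {0..p}"
        unfolding I_def by (intro integrable_integral integrable_continuous_real k_cont)
      have 2: "((\<lambda>_. I / (4 * p)) has_integral I / 4) {0..p}"
        using has_integral_const_real[of "I / (4 * p)" 0 p] p0 by simp
      show ?thesis
        using has_integral_mult_left[OF has_integral_add[OF has_integral_divide[OF 1, of 4] 2], of "norm x"]
        by (rule integral_unique)
    qed
    also have "integral {0..p} (\<lambda>r. k r *\<^sub>R (f r - f (p / 2))) = J - I *\<^sub>R f (p / 2)"
    proof -
      have "integral {0..p} (\<lambda>r. k r *\<^sub>R f r - k r *\<^sub>R f (p / 2)) =
          J - integral {0..p} (\<lambda>r. k r *\<^sub>R f (p / 2))" unfolding J_def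
        by (intro integral_diff integrable_continuous_real continuous_intros k_cont f_cont)
      also have "integral {0..p} (\<lambda>r. k r *\<^sub>R f (p / 2)) = I *\<^sub>R f (p / 2)"
        using integral_linear[OF integrable_continuous_real[OF k_cont] bounded_linear_scaleR_left[of "f (p / 2)"]]
        by (simp add: I_def o_def)
      finally show ?thesis by (simp add: scaleR_diff_right)
    qed
    finally have "norm (I *\<^sub>R f (p / 2)) \<le> norm J + I / 2 * norm x"
      using norm_triangle_ineq4[of J "J - I *\<^sub>R f (p / 2)"] by simp
    then have "I * norm (f (p / 2)) \<le> C1 * norm g + I / 2 * norm x" using J I by simp
    then have "norm (f (p / 2)) \<le> C1 / I * norm g + norm x / 2" using I by (simp add: field_simps)
    moreover define h where "h = damp \<mu> p *\<^sub>C U p (damp \<mu> p *\<^sub>C U p x)"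
    have "norm h \<le> norm (f (p / 2))"
    proof -
      have "U (p / 2 + \<tau>) x = U p (U p x)" using U_add[of p p x] p0 by (simp add: \<tau>_def)
      then have "h = damp \<mu> \<tau> *\<^sub>C f (p / 2)"
        using p0 by (simp add: h_def f_def U_scaleC scaleC_scaleC exp_add[symmetric] \<tau>_def algebra_simps)
      then show ?thesis using mult_right_mono[OF exp_le[OF \<tau>0] norm_ge_zero[of "f (p / 2)"]] by simp
    qed
    \<comment> \<open>With X = e^(-\<mu>p) U(p), x = (1 + X)(1 - X) x + X^2 x, so control of the
      orbit at time 2p suffices.\<close>
    moreover have "norm x \<le> norm g + norm (U p) * norm g + norm h"
    proof -
      have "x = g + damp \<mu> p *\<^sub>C U p g + h"
        by (simp add: g_def h_def blinfun.diff_right scaleC.diff_right)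
      then have "norm x \<le> norm g + norm (damp \<mu> p *\<^sub>C U p g) + norm h"
        by (metis norm_triangle_ineq norm_triangle_le add_right_mono order_trans)
      also have "norm (damp \<mu> p *\<^sub>C U p g) \<le> 1 * (norm (U p) * norm g)"
        unfolding norm_scaleC using p0 by (intro mult_mono exp_le norm_blinfun) auto
      finally show ?thesis by simp
    qed
    moreover have "a \<le> 2 * (b + b' + e)" if "d \<le> e + a / 2" "h' \<le> d" "a \<le> b + b' + h'"
      for a b b' d e h' :: real using that by simp
    ultimately have "norm x \<le> 2 * (norm g + norm (U p) * norm g + C1 / I * norm g)" by blast
    then show ?thesis unfolding g_def[symmetric] by (simp add: algebra_simps)
  qed
  then show ?thesis by (rule that)
qed

text \<open>Every z in the disc that is neither close to 0 nor equal to 1 is e^(-\<mu>p) for a \<mu>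
  from a bounded set, because the imaginary part of the logarithm can be chosen in
  [-\<pi>, \<pi>].\<close>

lemma U_bounded_below:
  assumes p: "p > t0"
  obtains C where "\<And>z x. cmod z \<le> 1 \<Longrightarrow> norm x \<le> C * norm (x - z *\<^sub>C U p x)"
proof -
  have p0: "p > 0" using p t0 by simp
  \<comment> \<open>If cmod z * L \<le> 1, then z U(p) has norm at most 1/2 and the bound with
    constant 2 is immediate; otherwise the logarithm of cmod z lies between -ln L and 0.\<close>
  define L where "L = 2 * norm (U p) + 1"
  have L: "L \<ge> 1" by (simp add: L_def)
  obtain C where C: "\<And>\<mu> x. Re \<mu> \<ge> 0 \<Longrightarrow> cmod \<mu> \<le> (ln L + pi) / p \<Longrightarrow> damp \<mu> p \<noteq> 1 \<Longrightarrow>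
    norm x \<le> C * norm (x - damp \<mu> p *\<^sub>C U p x)"
    using U_bounded_below_aux[OF p, of "(ln L + pi) / p"] L p0 by auto
  have C2: "norm x \<le> max C 2 * norm (x - z *\<^sub>C U p x)" if z: "cmod z \<le> 1" "z \<noteq> 1" for z x
  proof (cases "cmod z * L \<le> 1")
    case True
    have "2 * norm (z *\<^sub>C U p x) \<le> cmod z * (2 * norm (U p)) * norm x"
      using mult_left_mono[OF norm_blinfun[of "U p" x] norm_ge_zero[of z]] by simp
    also have "\<dots> \<le> 1 * norm x"
    proof (rule mult_right_mono)
      have "cmod z * (2 * norm (U p)) \<le> cmod z * L" by (intro mult_left_mono) (auto simp: L_def)
      with True show "cmod z * (2 * norm (U p)) \<le> 1" by simp
    qed simp
    finally have "norm x \<le> 2 * norm (x - z *\<^sub>C U p x)"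
      using norm_triangle_ineq2[of x "z *\<^sub>C U p x"] by simp
    also have "\<dots> \<le> max C 2 * norm (x - z *\<^sub>C U p x)" by (intro mult_right_mono) auto
    finally show ?thesis .
  next
    case False
    then have z0: "z \<noteq> 0" using L by auto
    define \<mu> where "\<mu> = - Ln z / of_real p"
    have e: "damp \<mu> p = z" using p0 z0 by (simp add: \<mu>_def)
    have "ln (cmod z) \<le> 0" using z z0 by (simp add: ln_le_zero_iff)
    then have re: "Re \<mu> \<ge> 0" using p0 z0 by (simp add: \<mu>_def divide_nonpos_pos)
    have "inverse L \<le> cmod z" using False L by (simp add: field_simps)
    then have "ln (inverse L) \<le> ln (cmod z)" using L z0 by (subst ln_le_cancel_iff) auto
    then have "\<bar>ln (cmod z)\<bar> \<le> ln L" using L \<open>ln (cmod z) \<le> 0\<close> by (simp add: ln_inverse)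
    moreover have "\<bar>Im (Ln z)\<bar> \<le> pi" using z0 Im_Ln_le_pi mpi_less_Im_Ln by (simp add: abs_le_iff) (smt (verit))
    ultimately have "cmod (Ln z) \<le> ln L + pi" using cmod_le[of "Ln z"] z0 by simp
    then have "cmod \<mu> \<le> (ln L + pi) / p" using p0 by (simp add: \<mu>_def norm_divide divide_right_mono)
    then have "norm x \<le> C * norm (x - z *\<^sub>C U p x)" using C[OF re _, of x] e z by simp
    also have "\<dots> \<le> max C 2 * norm (x - z *\<^sub>C U p x)" by (intro mult_right_mono) auto
    finally show ?thesis .
  qed
  \<comment> \<open>Since the constant does not depend on z, the excluded value z = 1 is reached by
    letting 1 - 1/(n+1) tend to 1.\<close>
  have "norm x \<le> max C 2 * norm (x - z *\<^sub>C U p x)" if z: "cmod z \<le> 1" for z x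
  proof (cases "z = 1")
    case True
    have "(\<lambda>n. max C 2 * norm (x - complex_of_real (1 - inverse (real (Suc n))) *\<^sub>C U p x)) \<longlonglongrightarrow>
        max C 2 * norm (x - complex_of_real (1 - 0) *\<^sub>C U p x)"
      by (intro tendsto_intros scaleC.tendsto LIMSEQ_inverse_real_of_nat)
    moreover have "norm x \<le> max C 2 * norm (x - complex_of_real (1 - inverse (real (Suc n))) *\<^sub>C U p x)" for n
    proof (rule C2)
      have "0 \<le> 1 - inverse (real (Suc n))" "1 - inverse (real (Suc n)) \<le> 1" by (auto simp: field_simps)
      then show "cmod (complex_of_real (1 - inverse (real (Suc n)))) \<le> 1" unfolding norm_of_real by simp
      have "1 - inverse (real (Suc n)) \<noteq> 1" by simp
      then show "complex_of_real (1 - inverse (real (Suc n))) \<noteq> 1" unfolding of_real_eq_1_iff .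
    qed
    ultimately have "norm x \<le> max C 2 * norm (x - complex_of_real (1 - 0) *\<^sub>C U p x)"
      by (intro LIMSEQ_le_const) blast+
    then show ?thesis using True by simp
  qed (use C2 z in blast)
  then show ?thesis by (rule that)
qed

text \<open>The small powers of U(p) found by \<open>squared_small\<close> are values of U itself,
  at the times 2^k p.\<close>

lemma U_decay:
  assumes "\<eta> > 0"
  obtains t where "t > 0" "norm (U t) < \<eta>"
proof -
  define p where "p = t0 + 1"
  have p: "p > t0" "p > 0" using t0 by (auto simp: p_def)
  obtain C where C: "\<And>z x. cmod z \<le> 1 \<Longrightarrow> norm x \<le> C * norm (x - z *\<^sub>C U p x)"
    using U_bounded_below[OF p(1)] by blast
  have "complex_linear (U p)" using p by (simp add: complex_linear_def U_scaleC)
  from squared_small[OF this C assms] obtain k where k: "norm (squared (U p) k) < \<eta>" by blast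
  have "squared (U p) k = U (2 ^ k * p)" for k
  proof (induction k)
    case (Suc k)
    show ?case
    proof (rule blinfun_eqI)
      show "squared (U p) (Suc k) x = U (2 ^ Suc k * p) x" for x
        using U_add[of "2 ^ k * p" "2 ^ k * p" x] p by (simp add: Suc algebra_simps)
    qed
  qed simp
  then show ?thesis using k p by (intro that[of "2 ^ k * p"]) auto
qed

end


section \<open>The structure of the pole\<close>

lemma resolvent_local_bound:
  assumes \<mu>: "\<mu> \<in> resolvent_set A" "\<nu> \<in> resolvent_set A"
    and near: "cmod (\<nu> - \<mu>) * norm (resolvent A \<mu>) \<le> 1 / 2"
  shows "norm (resolvent A \<nu>) \<le> 2 * norm (resolvent A \<mu>)"
proof (rule norm_blinfun_bound)
  fix x
  define y where "y = resolvent A \<nu> x"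
  have "resolvent A \<mu> (x + (\<mu> - \<nu>) *\<^sub>C y) = y" using resolvent_solves[OF \<mu>(2), of x]
    by (intro resolvent_eqI[OF \<mu>(1)]) (auto simp: y_def scaleC.diff_left)
  then have "norm y \<le> norm (resolvent A \<mu>) * norm (x + (\<mu> - \<nu>) *\<^sub>C y)" by (metis norm_blinfun)
  also have "\<dots> \<le> norm (resolvent A \<mu>) * (norm x + cmod (\<nu> - \<mu>) * norm y)"
    by (intro mult_left_mono norm_triangle_le) (auto simp: norm_minus_commute)
  also have "\<dots> = norm (resolvent A \<mu>) * norm x + (cmod (\<nu> - \<mu>) * norm (resolvent A \<mu>)) * norm y"
    by (simp add: algebra_simps)
  also have "\<dots> \<le> norm (resolvent A \<mu>) * norm x + 1 / 2 * norm y"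
    by (intro add_left_mono mult_right_mono near) simp
  finally show "norm (resolvent A \<nu> x) \<le> 2 * norm (resolvent A \<mu>) * norm x" by (simp add: y_def)
qed simp

text \<open>Each resolvent bounds its neighbours by twice its own norm through the resolvent
  identity; a finite subcover then yields the sum of these bounds.\<close>

lemma resolvent_bounded_on_compact:
  assumes "compact S" and S: "S \<subseteq> resolvent_set A"
  obtains C where "\<And>\<mu>. \<mu> \<in> S \<Longrightarrow> norm (resolvent A \<mu>) \<le> C"
proof -
  define r where "r \<mu> = 1 / (2 * norm (resolvent A \<mu>) + 1)" for \<mu>
  have r: "r \<mu> > 0" "r \<mu> * norm (resolvent A \<mu>) \<le> 1 / 2" for \<mu>
  proof -
    have "2 * norm (resolvent A \<mu>) + 1 > 0" by (simp add: add_nonneg_pos)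
    then show "r \<mu> > 0" "r \<mu> * norm (resolvent A \<mu>) \<le> 1 / 2" by (simp_all add: r_def divide_le_eq)
  qed
  obtain F where F: "F \<subseteq> S" "finite F" "S \<subseteq> (\<Union>\<mu>\<in>F. ball \<mu> (r \<mu>))"
    by (rule compactE_image[OF \<open>compact S\<close>, of S "\<lambda>\<mu>. ball \<mu> (r \<mu>)"]) (use r in auto)
  have "norm (resolvent A \<nu>) \<le> (\<Sum>\<mu>\<in>F. 2 * norm (resolvent A \<mu>))" if "\<nu> \<in> S" for \<nu>
  proof -
    from F(3) that obtain \<mu> where \<mu>: "\<mu> \<in> F" "\<nu> \<in> ball \<mu> (r \<mu>)" by blast
    have "cmod (\<nu> - \<mu>) * norm (resolvent A \<mu>) \<le> r \<mu> * norm (resolvent A \<mu>)"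
      using \<mu>(2) by (intro mult_right_mono) (auto simp: dist_norm norm_minus_commute)
    also have "\<dots> \<le> 1 / 2" by (rule r)
    finally have "norm (resolvent A \<nu>) \<le> 2 * norm (resolvent A \<mu>)"
      using \<mu> F S that by (intro resolvent_local_bound) auto
    also have "\<dots> \<le> (\<Sum>\<mu>\<in>F. 2 * norm (resolvent A \<mu>))" using \<mu> F by (intro member_le_sum) auto
    finally show ?thesis .
  qed
  then show ?thesis by (rule that)
qed

text \<open>Convergence at one point with distance \<rho> = r/2 bounds the coefficients
  geometrically, as in Cauchy's estimates. For cmod \<xi> < \<rho>/2 the terms after
  \<open>Q 0\<close> are dominated by a geometric series of ratio below 1/2.\<close>

lemma laurent_leading_term:
  assumes "r > 0" and sums: "\<And>\<mu>. \<mu> \<in> ball \<mu>\<^sub>0 r - {\<mu>\<^sub>0} \<Longrightarrow>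
    (\<lambda>k. scaleC_blinfun ((\<mu> - \<mu>\<^sub>0) powi (int k - int n)) (Q k)) sums R \<mu>"
  obtains K \<delta> where "0 < \<delta>" "\<delta> \<le> r" "\<And>\<xi> x. \<xi> \<noteq> 0 \<Longrightarrow> cmod \<xi> < \<delta> \<Longrightarrow>
    norm (\<xi> ^ n *\<^sub>C blinfun_apply (R (\<mu>\<^sub>0 + \<xi>)) x - Q 0 x) \<le> K * cmod \<xi> * norm x"
proof -
  have S: "(\<lambda>k. \<xi> ^ k *\<^sub>C blinfun_apply (Q k) x) sums (\<xi> ^ n *\<^sub>C blinfun_apply (R (\<mu>\<^sub>0 + \<xi>)) x)"
    if "\<xi> \<noteq> 0" "cmod \<xi> < r" for \<xi> x
  proof -
    have "\<mu>\<^sub>0 + \<xi> \<in> ball \<mu>\<^sub>0 r - {\<mu>\<^sub>0}" using that by (simp add: dist_norm)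
    from sums[OF this]
    have "(\<lambda>k. scaleC_blinfun (\<xi> powi (int k - int n)) (Q k)) sums R (\<mu>\<^sub>0 + \<xi>)" by simp
    from bounded_linear.sums[OF bounded_linear_compose[OF scaleC.bounded_linear_right[of "\<xi> ^ n"]
          blinfun.bounded_linear_left[of x]] this]
    have "(\<lambda>k. (\<xi> ^ n * \<xi> powi (int k - int n)) *\<^sub>C blinfun_apply (Q k) x) sums
        (\<xi> ^ n *\<^sub>C blinfun_apply (R (\<mu>\<^sub>0 + \<xi>)) x)" by (simp add: scaleC_scaleC)
    moreover have "\<xi> ^ n * \<xi> powi (int k - int n) = \<xi> ^ k" for k
      using that by (simp add: power_int_diff)
    ultimately show ?thesis by simp
  qed
  define \<rho> where "\<rho> = r / 2"
  have \<rho>: "0 < \<rho>" "\<rho> < r" using \<open>r > 0\<close> by (auto simp: \<rho>_def)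
  have "\<mu>\<^sub>0 + of_real \<rho> \<in> ball \<mu>\<^sub>0 r - {\<mu>\<^sub>0}" using \<rho> by (simp add: dist_norm)
  from sums_summable[OF sums[OF this]]
  have "(\<lambda>k. scaleC_blinfun (of_real \<rho> powi (int k - int n)) (Q k)) \<longlonglongrightarrow> 0"
    by (simp add: summable_LIMSEQ_zero)
  then have "Bseq (\<lambda>k. scaleC_blinfun (of_real \<rho> powi (int k - int n)) (Q k))"
    by (intro convergent_imp_Bseq convergentI)
  then obtain c where c: "c > 0" "\<And>k. norm (scaleC_blinfun (of_real \<rho> powi (int k - int n)) (Q k)) \<le> c"
    by (auto simp: Bseq_def)
  have Q: "norm (Q k x) \<le> c * \<rho> ^ n / \<rho> ^ k * norm x" for k x
  proof -
    have "norm (complex_of_real \<rho> powi (int k - int n) *\<^sub>C Q k x) \<le> c * norm x"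
      using order_trans[OF norm_blinfun mult_right_mono[OF c(2)[of k] norm_ge_zero], of x] by simp
    moreover have "cmod (complex_of_real \<rho> powi (int k - int n)) = \<rho> ^ k / \<rho> ^ n"
      using \<rho> by (simp add: power_int_diff norm_divide norm_power)
    ultimately have "\<rho> ^ k / \<rho> ^ n * norm (Q k x) \<le> c * norm x" by simp
    then show ?thesis using \<rho> by (simp add: field_simps)
  qed
  define C where "C = c * \<rho> ^ n"
  have C0: "C \<ge> 0" using c \<rho> by (simp add: C_def)
  have "norm (\<xi> ^ n *\<^sub>C blinfun_apply (R (\<mu>\<^sub>0 + \<xi>)) x - Q 0 x) \<le> (2 * C / \<rho>) * cmod \<xi> * norm x"
    if \<xi>: "\<xi> \<noteq> 0" "cmod \<xi> < \<rho> / 2" for \<xi> x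
  proof -
    define t where "t = cmod \<xi> / \<rho>"
    have t: "0 \<le> t" "t < 1 / 2" using \<xi> \<rho> by (auto simp: t_def field_simps)
    have a: "norm (\<xi> ^ k *\<^sub>C Q k x) \<le> C * norm x * t ^ k" for k
      using mult_left_mono[OF Q[of k x], of "cmod \<xi> ^ k"]
      by (simp add: norm_power t_def power_divide C_def mult_ac)
    have S': "(\<lambda>k. \<xi> ^ k *\<^sub>C Q k x) sums (\<xi> ^ n *\<^sub>C blinfun_apply (R (\<mu>\<^sub>0 + \<xi>)) x)"
      using S \<xi> \<rho> by auto
    have "\<xi> ^ n *\<^sub>C blinfun_apply (R (\<mu>\<^sub>0 + \<xi>)) x - Q 0 x = (\<Sum>k. \<xi> ^ Suc k *\<^sub>C Q (Suc k) x)"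
      using suminf_split_head[OF sums_summable[OF S']] sums_unique[OF S'] by simp
    also have "norm \<dots> \<le> (\<Sum>k. C * norm x * t ^ Suc k)"
      using t by (intro norm_suminf_le a) (auto intro!: summable_mult summable_geometric)
    also have "\<dots> = C * norm x * t * (1 / (1 - t))"
      using t by (simp add: suminf_mult suminf_geometric summable_geometric mult.assoc[symmetric])
    also have "\<dots> \<le> C * norm x * t * 2" using t C0 by (intro mult_left_mono) (auto simp: field_simps)
    finally show ?thesis by (simp add: t_def mult_ac)
  qed
  then show ?thesis using \<rho> by (intro that[of "\<rho> / 2" "2 * C / \<rho>"]) auto
qed

lemma emb_nonneg_iff [simp]: "0 \<le> emb x \<longleftrightarrow> 0 \<le> (x :: 'a::banach_lattice)"
  by (simp add: less_eq_complexification_def)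

lemma emb_pos_iff [simp]: "0 < emb x \<longleftrightarrow> 0 < (x :: 'a::banach_lattice)"
  by (metis emb_inject emb_linear(4) emb_nonneg_iff less_complexification_def order_less_le)

lemma nonneg_difference:
  fixes x :: "'a::banach_lattice"
  obtains a b where "0 \<le> a" "0 \<le> b" "x = a - b"
  using that[of "pprt x" "- nprt x"] by (simp add: prts[symmetric])

lemma positive_operator_preserves_real:
  fixes L :: "'a::banach_lattice bounded_operator"
  assumes "positive_operator L"
  shows "preserves_real L" unfolding preserves_real_def
proof
  fix x :: 'a
  obtain a b where ab: "0 \<le> a" "0 \<le> b" "x = a - b" by (rule nonneg_difference[of x])
  then have "0 \<le> L (emb a)" "0 \<le> L (emb b)" using assms by (simp_all add: positive_operator_def)
  then show "ipart (L (emb x)) = 0"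
    by (simp add: ab emb_linear blinfun.diff_right less_eq_complexification_def)
qed

lemma preserves_real_emb: "preserves_real L \<Longrightarrow> L (emb x) = emb (rpart (L (emb x)))"
  by (simp add: preserves_real_def emb_rpart)

lemma strongly_positive_imp_positive_operator:
  fixes L :: "'a::banach_lattice bounded_operator"
  assumes "0 \<le> u" and L: "\<And>f. f > 0 \<Longrightarrow> strongly_positive (emb u) (L f)"
  shows "positive_operator L" unfolding positive_operator_def
proof (intro allI impI)
  fix f :: "'a complexification" assume "0 \<le> f"
  show "0 \<le> L f"
  proof (cases "f = 0")
    case False
    with \<open>0 \<le> f\<close> obtain \<epsilon> where \<epsilon>: "\<epsilon> > 0" "\<epsilon> *\<^sub>R emb u \<le> L f"
      using L[of f] by (auto simp: strongly_positive_def less_complexification_def)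
    then have "0 \<le> \<epsilon> *\<^sub>R emb u" using assms(1) by (intro scaleR_nonneg_nonneg) auto
    with \<epsilon> show ?thesis by (metis order_trans)
  qed simp
qed

locale strong_pole = semigroup T for T :: "real \<Rightarrow> 'a::banach_lattice bounded_operator" +
  fixes u :: 'a and s \<mu>\<^sub>1 c :: real
  assumes pole: "resolvent_pole A (of_real s)"
    and u: "u \<ge> 0" and c: "c > 0" and unit: "\<bar>x\<bar> \<le> (c * norm x) *\<^sub>R u"
    and \<mu>\<^sub>1: "\<mu>\<^sub>1 > s" and resolvent_set: "\<mu> \<in> {s<..\<mu>\<^sub>1} \<Longrightarrow> of_real \<mu> \<in> resolvent_set A"
    and strong: "\<lbrakk>\<mu> \<in> {s<..\<mu>\<^sub>1}; f > 0\<rbrakk> \<Longrightarrow>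
      strongly_positive (emb u) (resolvent A (of_real \<mu>) f)"
begin

lemma resolvent_nonneg:
  assumes "\<mu> \<in> {s<..\<mu>\<^sub>1}" "0 \<le> f" shows "0 \<le> resolvent A (of_real \<mu>) f"
  using strongly_positive_imp_positive_operator[OF u strong[OF assms(1)]] assms(2)
  by (simp add: positive_operator_def)

lemma le_unit: "x \<le> (c * norm x) *\<^sub>R u" using unit abs_ge_self order_trans by blast

text \<open>P is the leading Laurent coefficient, the limit of h^n R(s + h) for h decreasing to 0;
  it is therefore positive and commutes with T. Its range consists of eigenvectors at s, and strong
  positivity makes every nonzero positive one dominate a multiple of u, which excludes both a higher
  order of the pole and a second dimension.\<close>

lemma pole_projection:
  obtains P :: "'a bounded_operator" and \<phi> :: "'a \<Rightarrow>\<^sub>L real" and v K \<delta> where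
    "complex_linear P" "\<And>x. P (P x) = P x" "\<And>t x. t \<ge> 0 \<Longrightarrow> P (T t x) = T t (P x)"
    "\<And>x. P (emb x) = emb (\<phi> x *\<^sub>R v)" "\<phi> v = 1" "\<exists>\<epsilon>>0. \<epsilon> *\<^sub>R u \<le> v" "\<delta> > 0"
    "\<And>\<mu> x. \<mu> \<in> resolvent_set A \<Longrightarrow> (\<mu> - of_real s) *\<^sub>C resolvent A \<mu> (P x) = P x"
    "\<And>\<xi> x. \<xi> \<noteq> 0 \<Longrightarrow> cmod \<xi> < \<delta> \<Longrightarrow>
      norm (\<xi> *\<^sub>C resolvent A (of_real s + \<xi>) x - P x) \<le> K * cmod \<xi> * norm x"
proof -
  let ?R = "resolvent A"
  obtain n Q r where n: "n \<ge> 1" and r: "r > 0" and Q0: "Q 0 \<noteq> 0"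
    and ball: "\<And>\<mu>. \<mu> \<in> ball (of_real s) r - {of_real s} \<Longrightarrow> \<mu> \<in> resolvent_set A"
    and sums: "\<And>\<mu>. \<mu> \<in> ball (of_real s) r - {of_real s} \<Longrightarrow>
      (\<lambda>k. scaleC_blinfun ((\<mu> - of_real s) powi (int k - int n)) (Q k)) sums ?R \<mu>"
    using pole unfolding resolvent_pole_def by blast
  obtain K \<delta> where \<delta>: "0 < \<delta>" "\<delta> \<le> r" and K: "\<And>\<xi> x. \<xi> \<noteq> 0 \<Longrightarrow> cmod \<xi> < \<delta> \<Longrightarrow>
      norm (\<xi> ^ n *\<^sub>C ?R (of_real s + \<xi>) x - Q 0 x) \<le> K * cmod \<xi> * norm x"
    by (rule laurent_leading_term[OF r sums]) blast+
  define P where "P = Q 0"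
  \<comment> \<open>The points s + h m must lie both in the disc of the Laurent expansion and in the
    interval where the resolvent is strongly positive.\<close>
  define d where "d = min \<delta> (\<mu>\<^sub>1 - s) / 2"
  have d: "0 < d" "d < \<delta>" "d < \<mu>\<^sub>1 - s" using \<delta> \<mu>\<^sub>1 by (auto simp: d_def min_def)
  define h where "h m = d * inverse (real (Suc m))" for m
  have h: "0 < h m" "h m \<le> d" for m using d by (auto simp: h_def field_simps)
  have h_lim: "h \<longlonglongrightarrow> 0"
    unfolding h_def using tendsto_mult[OF tendsto_const[of d] LIMSEQ_inverse_real_of_nat] by simp
  have h_in: "s + h m \<in> {s<..\<mu>\<^sub>1}" for m using h[of m] d by auto
  have h_set: "of_real (s + h m) \<in> resolvent_set A" for m by (rule resolvent_set[OF h_in])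
  define y where "y m x = h m ^ n *\<^sub>R ?R (of_real (s + h m)) x" for m x
  have y_lim: "(\<lambda>m. y m x) \<longlonglongrightarrow> P x" for x
  proof (rule LIM_zero_cancel, rule Lim_null_comparison)
    show "eventually (\<lambda>m. norm (y m x - P x) \<le> K * h m * norm x) sequentially"
    proof (rule always_eventually, rule allI)
      fix m
      show "norm (y m x - P x) \<le> K * h m * norm x" using K[of "of_real (h m)" x] h[of m] d
        by (simp add: y_def P_def scaleC_of_real flip: of_real_power)
    qed
    have "(\<lambda>m. K * h m * norm x) \<longlonglongrightarrow> K * 0 * norm x" by (intro tendsto_intros h_lim)
    then show "(\<lambda>m. K * h m * norm x) \<longlonglongrightarrow> 0" by simp
  qed
  have P_linear: "complex_linear P" unfolding complex_linear_def
  proof (intro allI)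
    fix a z
    have "(\<lambda>m. y m (a *\<^sub>C z)) = (\<lambda>m. a *\<^sub>C y m z)"
      by (simp add: y_def resolvent_scaleC[OF h_set[unfolded of_real_add]] scaleC.scaleR_right)
    then show "P (a *\<^sub>C z) = a *\<^sub>C P z"
      using y_lim[of "a *\<^sub>C z"] scaleC.tendsto[OF tendsto_const y_lim, of a z]
      by (auto intro: LIMSEQ_unique)
  qed
  have P_T: "P (T t x) = T t (P x)" if "t \<ge> 0" for t x
  proof -
    have "(\<lambda>m. y m (T t x)) = (\<lambda>m. T t (y m x))"
      using that by (simp add: y_def resolvent_T[OF h_set[unfolded of_real_add]] blinfun.scaleR_right)
    then show ?thesis using y_lim[of "T t x"] blinfun.tendsto[OF tendsto_const y_lim, of "T t" x]
      by (auto intro: LIMSEQ_unique)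
  qed
  \<comment> \<open>Resolvent identity between \<mu> and s + h m, multiplied by (h m)^n; the
    isolated term (h m)^n x vanishes in the limit because n \<ge> 1.\<close>
  have RP: "(\<mu> - of_real s) *\<^sub>C ?R \<mu> (P x) = P x" if \<mu>: "\<mu> \<in> resolvent_set A" for \<mu> x
  proof -
    have "?R \<mu> ((\<mu> - of_real (s + h m)) *\<^sub>C y m x + h m ^ n *\<^sub>R x) = y m x" for m
    proof -
      define w where "w = ?R (of_real (s + h m)) x"
      have "?R \<mu> ((\<mu> - of_real (s + h m)) *\<^sub>C w + x) = w"
        using resolvent_solves[OF h_set[of m], of x]
        by (intro resolvent_eqI[OF \<mu>]) (auto simp: w_def scaleC.diff_left)
      then have "y m x = h m ^ n *\<^sub>R ?R \<mu> ((\<mu> - of_real (s + h m)) *\<^sub>C w + x)"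
        by (simp add: y_def w_def)
      also have "\<dots> = ?R \<mu> ((\<mu> - of_real (s + h m)) *\<^sub>C y m x + h m ^ n *\<^sub>R x)"
        by (simp only: y_def w_def[symmetric] blinfun.scaleR_right[symmetric] scaleR_add_right
            scaleC.scaleR_right)
      finally show ?thesis by (rule sym)
    qed
    moreover have "(\<lambda>m. ?R \<mu> ((\<mu> - of_real (s + h m)) *\<^sub>C y m x + h m ^ n *\<^sub>R x)) \<longlonglongrightarrow>
        ?R \<mu> ((\<mu> - of_real (s + 0)) *\<^sub>C P x + 0 ^ n *\<^sub>R x)"
      by (intro blinfun.tendsto scaleC.tendsto tendsto_intros y_lim h_lim)
    ultimately have "(\<lambda>m. y m x) \<longlonglongrightarrow> ?R \<mu> ((\<mu> - of_real s) *\<^sub>C P x)"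
      using n by (simp add: power_0_left)
    from LIMSEQ_unique[OF y_lim this] have "P x = ?R \<mu> ((\<mu> - of_real s) *\<^sub>C P x)" .
    then show ?thesis using resolvent_scaleC[OF \<mu>] by simp
  qed
  have R_nonneg: "0 \<le> y m f" if "0 \<le> f" for m f
    using resolvent_nonneg[OF h_in that, of m] h[of m] by (simp add: y_def scaleR_nonneg_nonneg)
  have P_nonneg: "0 \<le> P f" if f: "0 \<le> f" for f
  proof -
    have "0 \<le> rpart (P f)"
      by (rule LIMSEQ_nonneg[OF bounded_linear.tendsto[OF bounded_linear_rpart y_lim]])
        (use R_nonneg[OF f] in \<open>simp add: less_eq_complexification_def\<close>)
    moreover have "ipart (P f) = 0"
    proof (rule LIMSEQ_unique[OF bounded_linear.tendsto[OF bounded_linear_ipart y_lim]])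
      show "(\<lambda>m. ipart (y m f)) \<longlonglongrightarrow> 0"
        using R_nonneg[OF f] by (simp add: less_eq_complexification_def)
    qed
    ultimately show ?thesis by (simp add: less_eq_complexification_def)
  qed
  have "positive_operator P" using P_nonneg by (simp add: positive_operator_def)
  from preserves_real_emb[OF positive_operator_preserves_real[OF this]]
  have P_real: "P (emb x) = emb (rpart (P (emb x)))" for x .
  obtain f where f: "0 \<le> f" "P (emb f) \<noteq> 0"
  proof (rule ccontr)
    assume "\<not> thesis"
    then have 0: "P (emb f) = 0" if "0 \<le> f" for f using that \<open>\<And>f. 0 \<le> f \<Longrightarrow> P (emb f) \<noteq> 0 \<Longrightarrow> thesis\<close> by blast
    have 1: "P (emb x) = 0" for x
      by (rule nonneg_difference[of x]) (simp add: 0 emb_linear blinfun.diff_right)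
    have "P z = 0" for z
    proof -
      have "P z = P (emb (rpart z)) + P (\<i> *\<^sub>C emb (ipart z))"
        by (metis complexification_split blinfun.add_right)
      also have "P (\<i> *\<^sub>C emb (ipart z)) = \<i> *\<^sub>C P (emb (ipart z))"
        using P_linear by (simp add: complex_linear_def)
      finally show ?thesis by (simp add: 1 scaleC.zero_right)
    qed
    then have "P = 0" by (intro blinfun_eqI) simp
    then show False using Q0 by (simp add: P_def)
  qed
  \<comment> \<open>On the range of P the operator (\<mu>1 - s) R(\<mu>1) is the identity, so x
    inherits the strong positivity of R(\<mu>1) x.\<close>
  have fixed_strong: "\<exists>\<epsilon>>0. \<epsilon> *\<^sub>R u \<le> x"
    if x: "0 \<le> x" "x \<noteq> 0" "emb x = P z" for x z
  proof -
    have "emb x > 0" unfolding emb_pos_iff using x(1,2) by (simp add: order_less_le)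
    moreover have m1: "\<mu>\<^sub>1 \<in> {s<..\<mu>\<^sub>1}" using \<mu>\<^sub>1 by simp
    ultimately have "strongly_positive (emb u) (?R (of_real \<mu>\<^sub>1) (emb x))" by (intro strong)
    then obtain \<epsilon> where \<epsilon>: "\<epsilon> > 0" "emb (\<epsilon> *\<^sub>R u) \<le> ?R (of_real \<mu>\<^sub>1) (emb x)"
      by (auto simp: strongly_positive_def emb_linear)
    have "emb ((\<mu>\<^sub>1 - s) *\<^sub>R \<epsilon> *\<^sub>R u) = (\<mu>\<^sub>1 - s) *\<^sub>R emb (\<epsilon> *\<^sub>R u)" by (simp add: emb_linear)
    also have "\<dots> \<le> (\<mu>\<^sub>1 - s) *\<^sub>R ?R (of_real \<mu>\<^sub>1) (emb x)"
      using \<mu>\<^sub>1 \<epsilon> by (intro scaleR_left_mono) auto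
    also have "\<dots> = emb x"
      using RP[OF resolvent_set[OF m1], of z] x(3) by (simp add: scaleC_of_real flip: of_real_diff)
    finally have "((\<mu>\<^sub>1 - s) * \<epsilon>) *\<^sub>R u \<le> x" by simp
    moreover have "(\<mu>\<^sub>1 - s) * \<epsilon> > 0" using \<mu>\<^sub>1 \<epsilon> by simp
    ultimately show ?thesis by blast
  qed
  define v where "v = rpart (P (emb f))"
  have v: "emb v = P (emb f)" unfolding v_def using P_real by simp
  have v0: "0 \<le> v" "v \<noteq> 0"
    using f P_nonneg[of "emb f"] v by (auto simp: less_eq_complexification_def v_def emb_linear)
  obtain \<epsilon> where \<epsilon>: "\<epsilon> > 0" "\<epsilon> *\<^sub>R u \<le> v" using fixed_strong[OF v0 v] by blast
  have dom: "x \<le> (c * norm x / \<epsilon>) *\<^sub>R v" for x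
  proof -
    have "x \<le> (c * norm x) *\<^sub>R u" by (rule le_unit)
    also have "\<dots> = (c * norm x / \<epsilon>) *\<^sub>R \<epsilon> *\<^sub>R u" using \<epsilon> by simp
    also have "\<dots> \<le> (c * norm x / \<epsilon>) *\<^sub>R v" using \<epsilon> c by (intro scaleR_left_mono) auto
    finally show ?thesis .
  qed
  have yP: "h m *\<^sub>R ?R (of_real (s + h m)) (P x) = P x" for m x
    using RP[OF h_set[of m], of x] by (simp add: scaleC_of_real)
  \<comment> \<open>If n > 1, then (h m)^n R(s + h m) v = (h m)^(n-1) v tends to 0, so P v = 0. But
    v dominates a positive multiple of f (or f = 0), and positivity of P would give v = P f \<le>
    0.\<close>
  have n1: "n = 1"
  proof (rule ccontr)
    assume "n \<noteq> 1"
    then obtain j where j: "n = Suc j" "j \<ge> 1" using n by (metis One_nat_def Suc_le_D le_SucE le_antisym not_less_eq_eq)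
    have "y m (emb v) = h m ^ j *\<^sub>R emb v" for m
      using yP[of m "emb f"] unfolding v y_def j by (simp add: mult.commute[of "h m"] flip: scaleR_scaleR)
    moreover have "(\<lambda>m. h m ^ j *\<^sub>R emb v) \<longlonglongrightarrow> 0 ^ j *\<^sub>R emb v" by (intro tendsto_intros h_lim)
    ultimately have "P (emb v) = 0" using LIMSEQ_unique[OF y_lim[of "emb v"]] j by (simp add: power_0_left)
    moreover have "P (emb ((c * norm f / \<epsilon>) *\<^sub>R v - f)) \<ge> 0"
      using dom[of f] by (intro P_nonneg) (simp add: less_eq_complexification_def)
    ultimately have "emb v \<le> 0" by (simp add: emb_linear blinfun.diff_right blinfun.scaleR_right v)
    then show False using v0 by (simp add: less_eq_complexification_def)
  qed
  have P_idem: "P (P x) = P x" for x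
  proof -
    have "y m (P x) = P x" for m using yP[of m x] by (simp add: y_def n1)
    then show ?thesis using y_lim[of "P x"] by (simp add: LIMSEQ_const_iff)
  qed
  \<comment> \<open>Subtract from w the largest multiple \<alpha> v below it, which exists as the
    cone is closed. A nonzero remainder would dominate some multiple of u, hence of v, and \<alpha>
    could be increased.\<close>
  have rank_one: "\<exists>a. P (emb x) = emb (a *\<^sub>R v)" for x
  proof -
    define w where "w = rpart (P (emb x))"
    have w: "emb w = P (emb x)" unfolding w_def using P_real by simp
    define S where "S = {a. a *\<^sub>R v \<le> w}"
    have "(- (c * norm w / \<epsilon>)) *\<^sub>R v \<le> w" using dom[of "- w"] by (simp add: minus_le_iff)
    then have "- (c * norm w / \<epsilon>) \<in> S" by (simp add: S_def)
    then have ne: "S \<noteq> {}" by blast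
    have bdd: "bdd_above S"
    proof (rule bdd_aboveI[of _ "c * norm w / \<epsilon>"])
      fix a assume "a \<in> S"
      then have "a *\<^sub>R v \<le> (c * norm w / \<epsilon>) *\<^sub>R v" using dom[of w] by (auto simp: S_def)
      then have le: "(a - c * norm w / \<epsilon>) *\<^sub>R v \<le> 0" by (simp add: scaleR_diff_left)
      show "a \<le> c * norm w / \<epsilon>"
      proof (rule ccontr)
        assume "\<not> ?thesis"
        then have pos: "a - c * norm w / \<epsilon> > 0" by simp
        then have "(a - c * norm w / \<epsilon>) *\<^sub>R v \<ge> 0" using v0 by (intro scaleR_nonneg_nonneg) auto
        with le have "(a - c * norm w / \<epsilon>) *\<^sub>R v = 0" by (rule antisym)
        with pos v0 show False by simp
      qed
    qed
    define \<alpha> where "\<alpha> = Sup S"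
    have below: "(\<alpha> - inverse (real (Suc m))) *\<^sub>R v \<le> w" for m
    proof -
      obtain a where a: "a \<in> S" "\<alpha> - inverse (real (Suc m)) < a"
        using less_cSup_iff[OF ne bdd, of "\<alpha> - inverse (real (Suc m))"] by (auto simp: \<alpha>_def)
      then have "(\<alpha> - inverse (real (Suc m))) *\<^sub>R v \<le> a *\<^sub>R v" using v0 by (intro scaleR_right_mono) auto
      also have "\<dots> \<le> w" using a by (simp add: S_def)
      finally show ?thesis .
    qed
    have "(\<lambda>m. (\<alpha> - inverse (real (Suc m))) *\<^sub>R v) \<longlonglongrightarrow> (\<alpha> - 0) *\<^sub>R v"
      by (intro tendsto_intros LIMSEQ_inverse_real_of_nat)
    from LIMSEQ_le_lattice[OF this tendsto_const below] have "(\<alpha> - 0) *\<^sub>R v \<le> w" .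
    then have nn: "0 \<le> w - \<alpha> *\<^sub>R v" by simp
    have "w - \<alpha> *\<^sub>R v = 0"
    proof (rule ccontr)
      assume ne0: "w - \<alpha> *\<^sub>R v \<noteq> 0"
      have "emb (w - \<alpha> *\<^sub>R v) = P (emb x - \<alpha> *\<^sub>R emb f)"
        by (simp add: emb_linear w v blinfun.diff_right blinfun.scaleR_right)
      from fixed_strong[OF nn ne0 this] obtain \<epsilon>' where \<epsilon>': "\<epsilon>' > 0" "\<epsilon>' *\<^sub>R u \<le> w - \<alpha> *\<^sub>R v" by blast
      define b where "b = \<epsilon>' / (c * norm v)"
      have b: "b > 0" using \<epsilon>' c v0 by (simp add: b_def)
      have "b *\<^sub>R v \<le> b *\<^sub>R (c * norm v) *\<^sub>R u" using b by (intro scaleR_left_mono le_unit) simp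
      also have "\<dots> = \<epsilon>' *\<^sub>R u" using c v0 by (simp add: b_def)
      also note \<epsilon>'(2)
      finally have "\<alpha> + b \<in> S" by (simp add: S_def scaleR_add_left le_diff_eq add.commute)
      then have "\<alpha> + b \<le> \<alpha>" unfolding \<alpha>_def using bdd by (rule cSup_upper)
      with b show False by simp
    qed
    then show ?thesis using w by (intro exI[of _ \<alpha>]) simp
  qed
  then obtain g where g: "\<And>x. P (emb x) = emb (g x *\<^sub>R v)" by metis
  have "bounded_linear g"
  proof (rule bounded_linear_intro)
    show "g (x + x') = g x + g x'" for x x'
    proof -
      have "emb (g (x + x') *\<^sub>R v) = emb ((g x + g x') *\<^sub>R v)"
        using g[of "x + x'"] g[of x] g[of x'] by (simp add: emb_linear blinfun.add_right scaleR_add_left)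
      then show ?thesis using v0 by simp
    qed
    show "g (a *\<^sub>R x) = a *\<^sub>R g x" for a x
    proof -
      have "emb (g (a *\<^sub>R x) *\<^sub>R v) = emb ((a * g x) *\<^sub>R v)"
        using g[of "a *\<^sub>R x"] g[of x] by (auto simp: emb_linear blinfun.scaleR_right)
      then show ?thesis using v0 by simp
    qed
    show "norm (g x) \<le> norm x * (norm P / norm v)" for x
      using norm_blinfun[of P "emb x"] v0 by (simp add: g field_simps)
  qed
  then have \<phi>: "blinfun_apply (Blinfun g) = g" by (rule bounded_linear_Blinfun_apply)
  have "g v = 1"
  proof -
    have "emb (g v *\<^sub>R v) = emb (1 *\<^sub>R v)" using g[of v] P_idem[of "emb f"] by (simp add: v)
    then have "g v *\<^sub>R v = 1 *\<^sub>R v" by (simp only: emb_inject)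
    then show ?thesis using v0 by (simp only: scaleR_cancel_right) simp
  qed
  moreover have "norm (\<xi> *\<^sub>C ?R (of_real s + \<xi>) x - P x) \<le> K * cmod \<xi> * norm x"
    if "\<xi> \<noteq> 0" "cmod \<xi> < \<delta>" for \<xi> x using K[OF that, of x] by (simp add: n1 P_def)
  ultimately show ?thesis
    using that[of P "Blinfun g" v \<delta> K] P_linear P_idem P_T g \<epsilon> \<delta>(1) RP by (auto simp: \<phi>)
qed

end


section \<open>Perturbation of a rank-one projection\<close>

text \<open>With N\<kappa> = (1 - \<kappa>D)^(-1), the vector v' = N\<kappa> v is an eigenvector of
  \<phi> \<otimes> v + D for 1/\<kappa> as soon as \<kappa> \<phi>(N\<kappa> v) = 1, and then \<psi>
  = \<phi> \<circ> N\<kappa> is a dual eigenvector. All estimates follow from N\<kappa> being within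
  4d of the identity.\<close>

lemma rank_one_perturbation:
  fixes \<phi> :: "'b::banach \<Rightarrow>\<^sub>L real" and v :: 'b and D :: "'b \<Rightarrow>\<^sub>L 'b"
  assumes \<phi>v: "\<phi> v = 1" and D: "norm D \<le> d" and small: "16 * (d * norm \<phi> * norm v) \<le> 1"
  obtains \<kappa> v' and \<psi> :: "'b \<Rightarrow>\<^sub>L real" where "1 / 2 \<le> \<kappa>" "\<kappa> \<le> 2"
    "\<kappa> *\<^sub>R (\<phi> v' *\<^sub>R v + D v') = v'" "\<And>x. \<kappa> * \<psi> (\<phi> x *\<^sub>R v + D x) = \<psi> x"
    "norm (v' - v) \<le> 4 * d * norm v" "\<psi> v' > 0"
    "\<And>w. \<psi> w = 0 \<Longrightarrow> \<bar>\<phi> w\<bar> \<le> 4 * d * norm \<phi> * norm w"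
proof -
  have d0: "0 \<le> d" using D norm_ge_zero[of D] by linarith
  have \<phi>_le: "\<bar>\<phi> x\<bar> \<le> norm \<phi> * norm x" for x using norm_blinfun[of \<phi> x] by simp
  have "1 \<le> norm \<phi> * norm v" using \<phi>_le[of v] \<phi>v by simp
  from mult_left_mono[OF this d0] have d: "16 * d \<le> 1" using small by (simp add: mult.assoc)
  define I where "I = {1 / 2..2::real}"
  have "\<exists>N :: 'b \<Rightarrow>\<^sub>L 'b. \<forall>x. blinfun_apply N (x - \<kappa> *\<^sub>R D x) = x \<and>
      blinfun_apply N x - \<kappa> *\<^sub>R D (blinfun_apply N x) = x \<and> norm (blinfun_apply N x) \<le> 2 * norm x"
    if \<kappa>: "\<kappa> \<in> I" for \<kappa>
  proof -
    have "norm (\<kappa> *\<^sub>R D) \<le> 2 * d" using \<kappa> D d0 by (simp add: I_def mult_mono)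
    then have L: "norm (\<kappa> *\<^sub>R D) \<le> 1 / 2" using d by linarith
    then have "norm (\<kappa> *\<^sub>R D) < 1" by linarith
    then obtain N :: "'b \<Rightarrow>\<^sub>L 'b" where
      N: "\<And>x. blinfun_apply N (x - blinfun_apply (\<kappa> *\<^sub>R D) x) = x"
      "\<And>x. blinfun_apply N x - blinfun_apply (\<kappa> *\<^sub>R D) (blinfun_apply N x) = x"
      "norm N \<le> 1 / (1 - norm (\<kappa> *\<^sub>R D))" by (rule Neumann_series) blast
    have "1 / (1 - norm (\<kappa> *\<^sub>R D)) \<le> 2" using L by (simp add: divide_le_eq)
    with N(3) have "norm N \<le> 2" by linarith
    then have "norm (N x) \<le> 2 * norm x" for x
      by (rule order_trans[OF norm_blinfun mult_right_mono]) simp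
    with N(1,2) show ?thesis by (intro exI[of _ N]) (simp add: blinfun.scaleR_left)
  qed
  then obtain N :: "real \<Rightarrow> 'b \<Rightarrow>\<^sub>L 'b" where N1: "\<And>\<kappa> x. \<kappa> \<in> I \<Longrightarrow> N \<kappa> (x - \<kappa> *\<^sub>R D x) = x"
    and N2: "\<And>\<kappa> x. \<kappa> \<in> I \<Longrightarrow> N \<kappa> x - \<kappa> *\<^sub>R D (N \<kappa> x) = x"
    and N3: "\<And>\<kappa> x. \<kappa> \<in> I \<Longrightarrow> norm (N \<kappa> x) \<le> 2 * norm x" by metis
  have Dx: "norm (D x) \<le> d * norm x" for x
    by (rule order_trans[OF norm_blinfun mult_right_mono[OF D]]) simp
  have N_near: "norm (N \<kappa> x - x) \<le> 4 * d * norm x" if \<kappa>: "\<kappa> \<in> I" for \<kappa> x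
  proof -
    have "N \<kappa> x - x = \<kappa> *\<^sub>R D (N \<kappa> x)" using N2[OF \<kappa>, of x] by (metis add_diff_cancel_left' diff_add_cancel)
    then have "norm (N \<kappa> x - x) = \<kappa> * norm (D (N \<kappa> x))" using \<kappa> by (simp add: I_def)
    also have "\<dots> \<le> 2 * (d * (2 * norm x))"
      using \<kappa> d0 by (intro mult_mono order_trans[OF Dx mult_left_mono[OF N3]]) (auto simp: I_def)
    finally show ?thesis by simp
  qed
  define f where "f \<kappa> = \<kappa> * \<phi> (N \<kappa> v)" for \<kappa>
  have lip: "norm (N \<kappa> x - N \<kappa>' x) \<le> \<bar>\<kappa> - \<kappa>'\<bar> * norm x" if \<kappa>: "\<kappa> \<in> I" "\<kappa>' \<in> I" for \<kappa> \<kappa>' x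
  proof -
    let ?a = "N \<kappa> x" and ?b = "N \<kappa>' x"
    have "?a - ?b = \<kappa> *\<^sub>R D ?a - \<kappa>' *\<^sub>R D ?b"
      using N2[OF \<kappa>(1), of x] N2[OF \<kappa>(2), of x] by (metis diff_diff_eq2 add_diff_cancel_left' diff_add_cancel add_diff_add)
    also have "\<dots> = \<kappa> *\<^sub>R D (?a - ?b) + (\<kappa> - \<kappa>') *\<^sub>R D ?b"
      by (simp add: blinfun.diff_right algebra_simps)
    finally have "norm (?a - ?b) \<le> norm (\<kappa> *\<^sub>R D (?a - ?b)) + norm ((\<kappa> - \<kappa>') *\<^sub>R D ?b)"
      by (metis norm_triangle_ineq)
    also have "\<dots> = \<kappa> * norm (D (?a - ?b)) + \<bar>\<kappa> - \<kappa>'\<bar> * norm (D ?b)" using \<kappa> by (simp add: I_def)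
    also have "\<dots> \<le> 2 * (d * norm (?a - ?b)) + \<bar>\<kappa> - \<kappa>'\<bar> * (d * (2 * norm x))"
      using \<kappa> d0 by (intro add_mono mult_mono order_trans[OF Dx mult_left_mono[OF N3]] Dx) (auto simp: I_def)
    also have "\<dots> = 2 * d * norm (?a - ?b) + 2 * d * (\<bar>\<kappa> - \<kappa>'\<bar> * norm x)" by (simp add: algebra_simps)
    also have "\<dots> \<le> 1 / 8 * norm (?a - ?b) + 1 / 8 * (\<bar>\<kappa> - \<kappa>'\<bar> * norm x)"
      using d by (intro add_mono mult_right_mono) auto
    finally have "7 / 8 * norm (?a - ?b) \<le> 1 / 8 * (\<bar>\<kappa> - \<kappa>'\<bar> * norm x)" by simp
    moreover have "0 \<le> \<bar>\<kappa> - \<kappa>'\<bar> * norm x" by simp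
    ultimately show ?thesis by linarith
  qed
  have cont: "continuous_on I (\<lambda>\<kappa>. N \<kappa> v)" unfolding continuous_on_def
  proof
    fix \<kappa> assume \<kappa>: "\<kappa> \<in> I"
    have "((\<lambda>\<kappa>'. N \<kappa>' v - N \<kappa> v) \<longlongrightarrow> 0) (at \<kappa> within I)"
    proof (rule Lim_null_comparison)
      show "eventually (\<lambda>\<kappa>'. norm (N \<kappa>' v - N \<kappa> v) \<le> \<bar>\<kappa>' - \<kappa>\<bar> * norm v) (at \<kappa> within I)"
        using lip[OF _ \<kappa>] by (auto simp: eventually_at_filter)
      show "((\<lambda>\<kappa>'. \<bar>\<kappa>' - \<kappa>\<bar> * norm v) \<longlongrightarrow> 0) (at \<kappa> within I)" by (auto intro!: tendsto_eq_intros)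
    qed
    then show "((\<lambda>\<kappa>'. N \<kappa>' v) \<longlongrightarrow> N \<kappa> v) (at \<kappa> within I)" by (rule LIM_zero_cancel)
  qed
  have dev: "\<bar>\<phi> (N \<kappa> v) - 1\<bar> \<le> 1 / 4" if "\<kappa> \<in> I" for \<kappa>
  proof -
    have "\<bar>\<phi> (N \<kappa> v) - 1\<bar> = \<bar>\<phi> (N \<kappa> v - v)\<bar>" by (simp add: blinfun.diff_right \<phi>v)
    also have "\<dots> \<le> norm \<phi> * (4 * d * norm v)"
      by (intro order_trans[OF \<phi>_le] mult_left_mono N_near that) simp
    also have "\<dots> \<le> 1 / 4" using small by (simp add: mult_ac)
    finally show ?thesis .
  qed
  \<comment> \<open>By \<open>dev\<close> the factor \<phi>(N\<kappa> v) lies in [3/4, 5/4], so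
    \<kappa> \<phi>(N\<kappa> v) is below 1 at 1/2 and above 1 at 2.\<close>
  have "\<exists>\<kappa>\<ge>1 / 2. \<kappa> \<le> 2 \<and> f \<kappa> = 1"
  proof (rule IVT')
    have "1 / 2 \<in> I" "2 \<in> I" by (auto simp: I_def)
    from dev[OF this(1)] dev[OF this(2)] have "\<phi> (N (1 / 2) v) \<le> 2" "1 / 2 \<le> \<phi> (N 2 v)" by linarith+
    then show "f (1 / 2) \<le> 1" "1 \<le> f 2" by (simp_all add: f_def)
    show "continuous_on {1 / 2..2} f" using cont unfolding f_def I_def
      by (intro continuous_on_mult continuous_on_id blinfun.continuous_on[OF continuous_on_const])
  qed simp
  then obtain \<kappa> where \<kappa>: "\<kappa> \<in> I" "\<kappa> * \<phi> (N \<kappa> v) = 1" by (auto simp: f_def I_def)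
  have \<kappa>0: "\<kappa> > 0" using \<kappa> by (simp add: I_def)
  define v' where "v' = N \<kappa> v"
  show ?thesis
  proof (rule that[of \<kappa> v' "\<phi> o\<^sub>L N \<kappa>"])
    show "1 / 2 \<le> \<kappa>" "\<kappa> \<le> 2" using \<kappa> by (auto simp: I_def)
    show "\<kappa> *\<^sub>R (\<phi> v' *\<^sub>R v + D v') = v'"
      using N2[OF \<kappa>(1), of v] \<kappa>(2) by (simp add: v'_def scaleR_add_right) (metis diff_add_cancel)
    show "\<kappa> * (\<phi> o\<^sub>L N \<kappa>) (\<phi> x *\<^sub>R v + D x) = (\<phi> o\<^sub>L N \<kappa>) x" for x
    proof -
      have "N \<kappa> x - \<kappa> *\<^sub>R N \<kappa> (D x) = x"
        using N1[OF \<kappa>(1), of x] by (simp add: blinfun.diff_right blinfun.scaleR_right)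
      then have "\<phi> (N \<kappa> x) - \<kappa> * \<phi> (N \<kappa> (D x)) = \<phi> x"
        by (metis blinfun.diff_right blinfun.scaleR_right real_scaleR_def)
      moreover have "\<kappa> * (\<phi> x * \<phi> (N \<kappa> v)) = \<phi> x" using \<kappa>(2) by (metis mult.left_commute mult.right_neutral)
      ultimately have "\<kappa> * (\<phi> x * \<phi> (N \<kappa> v)) + \<kappa> * \<phi> (N \<kappa> (D x)) = \<phi> (N \<kappa> x)" by linarith
      then show ?thesis by (simp add: blinfun.add_right blinfun.scaleR_right distrib_left)
    qed
    show "norm (v' - v) \<le> 4 * d * norm v" unfolding v'_def by (rule N_near[OF \<kappa>(1)])
    \<comment> \<open>The inverse is applied twice, to v and to v'; the deviations 4d * 2 and 4d add
      up to 12d, so \<psi>(v') \<ge> 1/4.\<close>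
    have "norm (N \<kappa> v' - v) \<le> norm (N \<kappa> v' - v') + norm (v' - v)"
      using norm_triangle_ineq[of "N \<kappa> v' - v'" "v' - v"] by simp
    also have "\<dots> \<le> 4 * d * (2 * norm v) + 4 * d * norm v" unfolding v'_def using d0 \<kappa>
      by (intro add_mono order_trans[OF N_near mult_left_mono[OF N3]] N_near) auto
    finally have near: "norm (N \<kappa> v' - v) \<le> 12 * d * norm v" by simp
    have "\<bar>\<phi> (N \<kappa> v') - 1\<bar> = \<bar>\<phi> (N \<kappa> v' - v)\<bar>" by (simp add: blinfun.diff_right \<phi>v)
    also have "\<dots> \<le> norm \<phi> * (12 * d * norm v)"
      by (intro order_trans[OF \<phi>_le] mult_left_mono near) simp
    also have "\<dots> \<le> 3 / 4" using small by (simp add: mult_ac)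
    finally have "0 < \<phi> (N \<kappa> v')" by linarith
    then show "(\<phi> o\<^sub>L N \<kappa>) v' > 0" by simp
    show "\<bar>\<phi> w\<bar> \<le> 4 * d * norm \<phi> * norm w" if "(\<phi> o\<^sub>L N \<kappa>) w = 0" for w
    proof -
      have "\<bar>\<phi> w\<bar> = \<bar>\<phi> (N \<kappa> w - w)\<bar>" using that by (simp add: blinfun.diff_right)
      also have "\<dots> \<le> norm \<phi> * (4 * d * norm w)"
        by (intro order_trans[OF \<phi>_le] mult_left_mono N_near \<kappa>) simp
      finally show ?thesis by (simp add: mult_ac)
    qed
  qed
qed

text \<open>Write f = a v + w with \<psi>(w) = 0. The positive vectors L^n f = a v + L^n w converge
  to a v, since L contracts the kernel of \<psi>; hence a \<ge> 0. Positivity of \<psi> thus comes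
  from that of L alone.\<close>

lemma dual_eigenvector_nonneg:
  fixes L :: "'a::banach_lattice \<Rightarrow>\<^sub>L 'a" and \<psi> :: "'a \<Rightarrow>\<^sub>L real"
  assumes L: "\<And>f. 0 \<le> f \<Longrightarrow> 0 \<le> L f" and v: "L v = v" "0 \<le> v" "\<psi> v > 0"
    and \<psi>: "\<And>x. \<psi> (L x) = \<psi> x"
    and contr: "\<And>w. \<psi> w = 0 \<Longrightarrow> norm (L w) \<le> q * norm w" and q: "0 \<le> q" "q < 1"
    and f: "0 \<le> f"
  shows "0 \<le> \<psi> f"
proof -
  define a where "a = \<psi> f / \<psi> v"
  define w where "w = f - a *\<^sub>R v"
  have w: "\<psi> w = 0" using v by (simp add: w_def a_def blinfun.diff_right blinfun.scaleR_right)
  have pow: "\<psi> ((blinfun_apply L ^^ n) w) = 0 \<and> norm ((blinfun_apply L ^^ n) w) \<le> q ^ n * norm w" for n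
  proof (induction n)
    case (Suc n)
    then have "norm (L ((blinfun_apply L ^^ n) w)) \<le> q * norm ((blinfun_apply L ^^ n) w)" by (intro contr) simp
    also have "\<dots> \<le> q * (q ^ n * norm w)" using Suc q by (intro mult_left_mono) auto
    finally show ?case using Suc by (simp add: \<psi> mult.assoc)
  qed (simp add: w)
  have dec: "0 \<le> (blinfun_apply L ^^ n) f \<and> (blinfun_apply L ^^ n) f = a *\<^sub>R v + (blinfun_apply L ^^ n) w" for n
  proof (induction n)
    case (Suc n)
    then have "L ((blinfun_apply L ^^ n) f) = a *\<^sub>R v + L ((blinfun_apply L ^^ n) w)"
      by (metis blinfun.add_right blinfun.scaleR_right v(1))
    moreover have "0 \<le> L ((blinfun_apply L ^^ n) f)" using Suc by (intro L) blast
    ultimately show ?case unfolding funpow.simps o_def by blast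
  qed (simp add: w_def f)
  have "(\<lambda>n. (blinfun_apply L ^^ n) w) \<longlonglongrightarrow> 0"
  proof (rule Lim_null_comparison)
    show "eventually (\<lambda>n. norm ((blinfun_apply L ^^ n) w) \<le> q ^ n * norm w) sequentially" using pow by simp
    have "(\<lambda>n. q ^ n * norm w) \<longlonglongrightarrow> 0 * norm w" using q by (intro tendsto_intros LIMSEQ_realpow_zero)
    then show "(\<lambda>n. q ^ n * norm w) \<longlonglongrightarrow> 0" by simp
  qed
  then have "(\<lambda>n. a *\<^sub>R v + (blinfun_apply L ^^ n) w) \<longlonglongrightarrow> a *\<^sub>R v + 0" by (intro tendsto_intros)
  moreover have "0 \<le> a *\<^sub>R v + (blinfun_apply L ^^ n) w" for n using dec[of n] by metis
  ultimately have av: "0 \<le> a *\<^sub>R v" using LIMSEQ_nonneg by fastforce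
  have "0 \<le> a"
  proof (rule ccontr)
    assume "\<not> 0 \<le> a"
    then have "a *\<^sub>R v \<le> 0" using v by (intro scaleR_nonpos_nonneg) auto
    with av have "a *\<^sub>R v = 0" by (intro antisym)
    then have "v = 0" using \<open>\<not> 0 \<le> a\<close> by simp
    then show False using v by simp
  qed
  then show ?thesis using v by (simp add: a_def zero_le_divide_iff)
qed

section \<open>Orbits of eigenvectors and decay on invariant sets\<close>

context semigroup
begin

lemma eigenvector_orbit:
  assumes z: "A z = Some (a *\<^sub>R z)" and t: "t \<ge> 0"
  shows "T t z = exp (a * t) *\<^sub>R z"
proof -
  have "exp (a * t) *\<^sub>R z = T t (exp (a * 0) *\<^sub>R z)"
  proof (rule semigroup_eq_on_solution[OF C0 _ _ t, where z = "\<lambda>r. a *\<^sub>R exp (a * r) *\<^sub>R z"])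
    show "((\<lambda>r. exp (a * r) *\<^sub>R z) has_vector_derivative a *\<^sub>R exp (a * r) *\<^sub>R z) (at r within {0..t})" for r
      by (auto intro!: derivative_eq_intros simp: has_real_derivative_iff_has_vector_derivative[symmetric]
          has_vector_derivative_def)
    show "A (exp (a * r) *\<^sub>R z) = Some (a *\<^sub>R exp (a * r) *\<^sub>R z)" for r
      using generator_scaleC[OF z, of "of_real (exp (a * r))"] unfolding scaleC_of_real
      by (simp add: mult.commute)
  qed
  then show ?thesis by simp
qed

text \<open>Contraction over one time step \<tau> suffices: N is invariant, so the steps can be
  iterated, and C bounds the growth within a step.\<close>

lemma orbit_decay:
  assumes \<tau>: "\<tau> > 0" and q: "0 \<le> q" "q < 1"
    and inv: "\<And>w t. w \<in> N \<Longrightarrow> t \<ge> 0 \<Longrightarrow> T t w \<in> N"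
    and contr: "\<And>w. w \<in> N \<Longrightarrow> exp (- b * \<tau>) * norm (T \<tau> w) \<le> q * norm w"
    and w: "w \<in> N" and e: "e > 0"
  obtains t1 where "t1 \<ge> 0" "\<And>t. t \<ge> t1 \<Longrightarrow> exp (- b * t) * norm (T t w) \<le> e"
proof -
  obtain M \<omega> where M: "M \<ge> 1" "\<omega> \<ge> 0" "\<And>t. t \<ge> 0 \<Longrightarrow> norm (T t) \<le> M * exp (\<omega> * t)"
    by (rule growth_bound) blast
  define C where "C = exp (\<bar>b\<bar> * \<tau>) * (M * exp (\<omega> * \<tau>))"
  have C: "exp (- b * r) * norm (T r x) \<le> C * norm x" if r: "0 \<le> r" "r \<le> \<tau>" for r x
  proof -
    have "- b * r \<le> \<bar>b\<bar> * \<tau>" using r \<tau> by (metis abs_ge_minus_self abs_ge_zero mult_mono)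
    then have 1: "exp (- b * r) \<le> exp (\<bar>b\<bar> * \<tau>)" by simp
    have "norm (T r x) \<le> norm (T r) * norm x" by (rule norm_blinfun)
    also have "\<dots> \<le> (M * exp (\<omega> * r)) * norm x" using r by (intro mult_right_mono M) auto
    also have "\<dots> \<le> (M * exp (\<omega> * \<tau>)) * norm x"
      using r M by (intro mult_right_mono mult_left_mono) (auto intro: mult_left_mono)
    finally have "exp (- b * r) * norm (T r x) \<le> exp (\<bar>b\<bar> * \<tau>) * ((M * exp (\<omega> * \<tau>)) * norm x)"
      using 1 by (intro mult_mono) auto
    then show ?thesis by (simp add: C_def mult.assoc)
  qed
  have C0: "C \<ge> 0" using M by (simp add: C_def)
  have pow: "T (real n * \<tau>) w \<in> N \<and> exp (- b * (real n * \<tau>)) * norm (T (real n * \<tau>) w) \<le> q ^ n * norm w" for n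
  proof (induction n)
    case (Suc n)
    let ?w = "T (real n * \<tau>) w"
    have eq: "T (real (Suc n) * \<tau>) w = T \<tau> ?w"
      using T_add[of \<tau> "real n * \<tau>" w] \<tau> by (simp add: distrib_right add.commute)
    have "exp (- b * (real (Suc n) * \<tau>)) = exp (- b * (real n * \<tau>)) * exp (- b * \<tau>)"
      by (simp add: exp_add[symmetric] algebra_simps)
    then have "exp (- b * (real (Suc n) * \<tau>)) * norm (T \<tau> ?w) =
        exp (- b * (real n * \<tau>)) * (exp (- b * \<tau>) * norm (T \<tau> ?w))" by simp
    also have "\<dots> \<le> exp (- b * (real n * \<tau>)) * (q * norm ?w)"
      using Suc by (intro mult_left_mono contr) auto
    also have "\<dots> = q * (exp (- b * (real n * \<tau>)) * norm ?w)" by simp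
    also have "\<dots> \<le> q * (q ^ n * norm w)" using Suc q by (intro mult_left_mono) auto
    finally show ?case unfolding eq using Suc inv \<tau> by simp
  qed (use w in simp)
  have "(\<lambda>n. C * (q ^ n * norm w)) \<longlonglongrightarrow> C * (0 * norm w)"
    using q by (intro tendsto_intros LIMSEQ_realpow_zero)
  then have "eventually (\<lambda>n. C * (q ^ n * norm w) < e) sequentially"
    using e by (intro order_tendstoD) auto
  then obtain n0 where n0: "\<And>n. n \<ge> n0 \<Longrightarrow> C * (q ^ n * norm w) < e"
    by (auto simp: eventually_sequentially)
  show ?thesis
  proof (rule that[of "real n0 * \<tau>"])
    fix t assume t: "t \<ge> real n0 * \<tau>"
    define n where "n = nat \<lfloor>t / \<tau>\<rfloor>"
    have t0: "0 \<le> t" using t \<tau> by (meson mult_nonneg_nonneg of_nat_0_le_iff less_imp_le order_trans)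
    have "real n \<le> t / \<tau>" "t / \<tau> < real n + 1" using t0 \<tau> unfolding n_def by auto
    then have n: "real n * \<tau> \<le> t" "t \<le> real n * \<tau> + \<tau>" using \<tau> by (auto simp: field_simps)
    have "n \<ge> n0" unfolding n_def using t \<tau> by (intro le_nat_floor) (simp add: pos_le_divide_eq)
    let ?w = "T (real n * \<tau>) w"
    define r where "r = t - real n * \<tau>"
    have r: "0 \<le> r" "r \<le> \<tau>" "t = r + real n * \<tau>" using n by (auto simp: r_def)
    have "exp (- b * t) * norm (T t w) = exp (- b * (real n * \<tau>)) * (exp (- b * r) * norm (T r ?w))"
      using T_add[of r "real n * \<tau>" w] r \<tau> by (simp add: exp_add[symmetric] distrib_left mult.assoc[symmetric])
    also have "\<dots> \<le> exp (- b * (real n * \<tau>)) * (C * norm ?w)" using r by (intro mult_left_mono C) auto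
    also have "\<dots> = C * (exp (- b * (real n * \<tau>)) * norm ?w)" by simp
    also have "\<dots> \<le> C * (q ^ n * norm w)" using pow C0 by (intro mult_left_mono) auto
    also have "\<dots> < e" by (rule n0[OF \<open>n \<ge> n0\<close>])
    finally show "exp (- b * t) * norm (T t w) \<le> e" by simp
  qed (use \<tau> in simp)
qed

end


section \<open>Positivity of the perturbed semigroup\<close>

context perturbed_semigroup
begin

text \<open>K = R (1 - BR)^(-1) is the resolvent of A + B at \<mu>; the two inverse relations are
  stated in terms of the generator of S, the form in which they are used.\<close>

lemma perturbed_resolvent:
  fixes \<mu> :: real
  defines "R \<equiv> resolvent A (of_real \<mu>)"
  assumes \<mu>: "of_real \<mu> \<in> resolvent_set A" and small: "norm B * norm R \<le> 1 / 2"
  obtains K :: "'a bounded_operator" where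
    "\<And>x. generator S (K x) = Some (\<mu> *\<^sub>R K x - x)"
    "\<And>z w. generator S z = Some w \<Longrightarrow> K (\<mu> *\<^sub>R z - w) = z"
    "norm (K - R) \<le> 2 * (norm R)\<^sup>2 * norm B"
    "\<And>f. positive_operator B \<Longrightarrow> positive_operator R \<Longrightarrow> 0 \<le> f \<Longrightarrow> R f \<le> K f"
proof -
  define L where "L = B o\<^sub>L R"
  have L: "norm L \<le> 1 / 2" using norm_blinfun_compose[of B R] small by (simp add: L_def)
  then have "norm L < 1" by linarith
  then obtain N :: "'a bounded_operator" where N1: "\<And>x. N (x - L x) = x"
    and N2: "\<And>x. N x - L (N x) = x"
    and N_sums: "\<And>x. (\<lambda>n. (blinfun_apply L ^^ n) x) sums N x"
    and N3: "norm N \<le> 1 / (1 - norm L)" by (rule Neumann_series) blast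
  have "1 / (1 - norm L) \<le> 2" using L by (simp add: divide_le_eq)
  with N3 have N: "norm N \<le> 2" by linarith
  define K where "K = R o\<^sub>L N"
  have N_eq: "N x = x + B (K x)" for x using N2[of x] by (simp add: K_def L_def algebra_simps)
  show ?thesis
  proof (rule that[of K])
    show "generator S (K x) = Some (\<mu> *\<^sub>R K x - x)" for x
    proof -
      have "A (K x) = Some (\<mu> *\<^sub>R K x - N x)"
        using resolvent_solves[OF \<mu>, of "N x"] by (simp add: K_def R_def scaleC_of_real)
      then have "generator S (K x) = Some (\<mu> *\<^sub>R K x - N x + B (K x))"
        by (simp add: generator_S perturbed_def)
      also have "\<mu> *\<^sub>R K x - N x + B (K x) = \<mu> *\<^sub>R K x - x" by (subst N_eq) simp
      finally show ?thesis .
    qed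
    show "K (\<mu> *\<^sub>R z - w) = z" if z: "generator S z = Some w" for z w
    proof -
      obtain y where y: "A z = Some y" "w = y + B z"
        using z by (auto simp: generator_S perturbed_def)
      define p where "p = \<mu> *\<^sub>R z - y"
      have "R p = z" unfolding R_def p_def
        by (rule resolvent_eqI[OF \<mu> y(1)]) (simp add: scaleC_of_real)
      then have "p - L p = \<mu> *\<^sub>R z - w" by (simp add: L_def p_def y)
      then have "N (\<mu> *\<^sub>R z - w) = p" using N1[of p] by simp
      then show ?thesis using \<open>R p = z\<close> by (simp add: K_def)
    qed
    show "norm (K - R) \<le> 2 * (norm R)\<^sup>2 * norm B"
    proof (rule norm_blinfun_bound)
      fix x
      have "(K - R) x = R (N x - x)" by (simp add: K_def blinfun.diff_left blinfun.diff_right)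
      also have "N x - x = B (R (N x))" by (subst N_eq) (simp add: K_def)
      finally have "norm ((K - R) x) \<le> norm R * (norm B * (norm R * (norm N * norm x)))"
        by (auto intro!: order_trans[OF norm_blinfun mult_left_mono])
      also have "\<dots> \<le> norm R * (norm B * (norm R * (2 * norm x)))"
        by (intro mult_left_mono mult_right_mono N) auto
      finally show "norm ((K - R) x) \<le> 2 * (norm R)\<^sup>2 * norm B * norm x"
        by (simp add: power2_eq_square mult_ac)
    qed simp
    \<comment> \<open>The Neumann series for (1 - BR)^(-1) f has nonnegative terms and starts with
      f, so its sum dominates f; then R is applied.\<close>
    show "R f \<le> K f" if B: "positive_operator B" and R: "positive_operator R" and f: "0 \<le> f" for f
    proof -
      have term_nonneg: "0 \<le> (blinfun_apply L ^^ n) f" for n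
        using B R f by (induction n) (simp_all add: L_def positive_operator_def)
      define p where "p n = (\<Sum>i<Suc n. (blinfun_apply L ^^ i) f)" for n
      have p: "f \<le> p n" for n
      proof (induction n)
        case (Suc n)
        have "f \<le> p n + (blinfun_apply L ^^ Suc n) f"
          using add_mono[OF Suc term_nonneg[of "Suc n"]] by simp
        then show ?case by (simp add: p_def)
      qed (simp add: p_def)
      have lim: "p \<longlonglongrightarrow> N f" using N_sums[of f] LIMSEQ_Suc unfolding sums_def p_def by blast
      have "rpart f \<le> rpart (N f)"
        by (rule LIMSEQ_le_lattice[OF tendsto_const bounded_linear.tendsto[OF bounded_linear_rpart lim]])
          (use p in \<open>auto simp: less_eq_complexification_def\<close>)
      moreover have "ipart (N f) = ipart f"
      proof (rule LIMSEQ_unique[OF bounded_linear.tendsto[OF bounded_linear_ipart lim]])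
        show "(\<lambda>n. ipart (p n)) \<longlonglongrightarrow> ipart f" using p by (simp add: less_eq_complexification_def)
      qed
      ultimately have "0 \<le> N f - f" by (simp add: less_eq_complexification_def)
      then have "0 \<le> R (N f - f)" using R by (simp add: positive_operator_def)
      then show ?thesis by (simp add: K_def blinfun.diff_right)
    qed
  qed
qed

text \<open>\<phi> \<otimes> v stands for the residue, h = \<mu> - s for the distance to the pole
  and d for the tolerance within which h R(\<mu>, A + B) agrees with the residue. The numerical
  assumptions make the kernel of \<psi> contract under both the resolvent and S(\<tau>).\<close>

lemma eventually_strongly_positive:
  fixes \<phi> :: "'a \<Rightarrow>\<^sub>L real" and u v :: 'a and s \<mu> \<tau> c d \<epsilon> :: real
  defines "R \<equiv> resolvent A (of_real \<mu>)"
  assumes u: "u \<ge> 0" and c: "c > 0" and unit: "\<And>x. \<bar>x\<bar> \<le> (c * norm x) *\<^sub>R u"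
    and B: "positive_operator B" and T_real: "\<And>t. t \<ge> 0 \<Longrightarrow> preserves_real (T t)"
    and \<mu>: "of_real \<mu> \<in> resolvent_set A" "\<mu> > s"
    and R_strong: "\<And>f. f > 0 \<Longrightarrow> strongly_positive (emb u) (R f)"
    and B_R: "norm B * norm R \<le> 1 / 2"
    and R_near: "\<And>x. norm ((\<mu> - s) *\<^sub>R R (emb x) - emb (\<phi> x *\<^sub>R v)) \<le> d / 2 * norm x"
    and R_pert: "(\<mu> - s) * (2 * (norm R)\<^sup>2 * norm B) \<le> d / 2"
    and \<phi>v: "\<phi> v = 1" and d_small: "32 * (d * norm \<phi> * norm v) \<le> 1"
    and \<epsilon>: "\<epsilon> > 0" "\<epsilon> *\<^sub>R u \<le> v" "4 * d * norm v * c \<le> \<epsilon> / 2"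
    and \<tau>: "\<tau> > 0" "(\<mu> - s) * \<tau> \<le> ln 2"
    and decay: "\<And>x. exp (- s * \<tau>) * norm (T \<tau> (emb x)) \<le> 1 / 8 * norm x + \<bar>\<phi> x\<bar> * norm v"
    and close: "exp (- s * \<tau>) * norm (S \<tau> - T \<tau>) \<le> 1 / 8"
  shows "individually_eventually_strongly_positive S (emb u)"
proof -
  interpret S: semigroup S by standard (rule C0_S)
  define h where "h = \<mu> - s"
  have h: "h > 0" using \<mu> by (simp add: h_def)
  have le_unit: "x \<le> (c * norm x) *\<^sub>R u" for x using unit abs_ge_self order_trans by blast
  have R_pos: "positive_operator R" by (rule strongly_positive_imp_positive_operator[OF u R_strong])
  obtain K :: "'a bounded_operator" where K1: "\<And>x. generator S (K x) = Some (\<mu> *\<^sub>R K x - x)"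
    and K2: "\<And>z w. generator S z = Some w \<Longrightarrow> K (\<mu> *\<^sub>R z - w) = z"
    and K3: "norm (K - R) \<le> 2 * (norm R)\<^sup>2 * norm B"
    and K_ge: "\<And>f. positive_operator B \<Longrightarrow> positive_operator R \<Longrightarrow> 0 \<le> f \<Longrightarrow> R f \<le> K f"
    by (rule perturbed_resolvent[OF \<mu>(1) B_R[unfolded R_def], folded R_def]) blast
  note K4 = K_ge[OF B R_pos]
  define Kr where "Kr = Blinfun (\<lambda>x. rpart (K (emb x)))"
  have Kr: "Kr x = rpart (K (emb x))" for x unfolding Kr_def by (subst bounded_linear_Blinfun_apply)
      (auto intro: bounded_linear_compose[OF bounded_linear_rpart
          bounded_linear_compose[OF blinfun.bounded_linear_right bounded_linear_emb]])
  have K_nonneg: "0 \<le> K f" if "0 \<le> f" for f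
    using order_trans[OF _ K4[OF that]] R_pos that by (simp add: positive_operator_def)
  have "positive_operator K" using K_nonneg by (simp add: positive_operator_def)
  from preserves_real_emb[OF positive_operator_preserves_real[OF this]]
  have K_emb: "K (emb x) = emb (Kr x)" for x unfolding Kr .
  define D where "D = Blinfun (\<lambda>x. h *\<^sub>R Kr x - \<phi> x *\<^sub>R v)"
  have D: "D x = h *\<^sub>R Kr x - \<phi> x *\<^sub>R v" for x unfolding D_def
    by (subst bounded_linear_Blinfun_apply)
      (auto intro!: bounded_linear_sub bounded_linear_compose[OF bounded_linear_scaleR_right]
        bounded_linear_compose[OF bounded_linear_scaleR_left] blinfun.bounded_linear_right)
  have d0: "d \<ge> 0" using R_pert h zero_le_mult_iff[of h] by (simp add: h_def) (smt (verit) mult_nonneg_nonneg norm_ge_zero zero_le_power2)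
  \<comment> \<open>Half of d is spent on the distance from h R to the residue, half on replacing R
    by the perturbed resolvent K.\<close>
  have norm_D: "norm D \<le> d"
  proof (rule norm_blinfun_bound[OF d0])
    fix x
    have "emb (D x) = h *\<^sub>R (K - R) (emb x) + (h *\<^sub>R R (emb x) - emb (\<phi> x *\<^sub>R v))"
      by (simp add: D emb_linear K_emb blinfun.diff_left scaleR_diff_right)
    then have "norm (D x) \<le> h * norm ((K - R) (emb x)) + norm (h *\<^sub>R R (emb x) - emb (\<phi> x *\<^sub>R v))"
      using h by (metis abs_of_pos norm_emb norm_scaleR norm_triangle_ineq)
    also have "\<dots> \<le> h * (2 * (norm R)\<^sup>2 * norm B * norm x) + d / 2 * norm x"
      using h R_near[of x] order_trans[OF norm_blinfun mult_right_mono[OF K3], of "emb x"]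
      by (intro add_mono mult_left_mono) (auto simp: h_def)
    also have "h * (2 * (norm R)\<^sup>2 * norm B * norm x) \<le> d / 2 * norm x"
      using mult_right_mono[OF R_pert norm_ge_zero[of x]] by (simp add: h_def mult.assoc)
    finally show "norm (D x) \<le> d * norm x" by simp
  qed
  have "1 \<le> norm \<phi> * norm v" using norm_blinfun[of \<phi> v] \<phi>v by simp
  from mult_left_mono[OF this d0] have d32: "32 * d \<le> 1" using d_small by (simp add: mult.assoc)
  have "16 * (d * norm \<phi> * norm v) \<le> 1" using d_small d0 by simp
  from rank_one_perturbation[OF \<phi>v norm_D this]
  obtain \<kappa> v' and \<psi> :: "'a \<Rightarrow>\<^sub>L real" where \<kappa>: "1 / 2 \<le> \<kappa>" "\<kappa> \<le> 2"
    and v'_eq: "\<kappa> *\<^sub>R (\<phi> v' *\<^sub>R v + D v') = v'"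
    and \<psi>_eq: "\<And>x. \<kappa> * \<psi> (\<phi> x *\<^sub>R v + D x) = \<psi> x"
    and v'_near: "norm (v' - v) \<le> 4 * d * norm v" and \<psi>v': "\<psi> v' > 0"
    and \<psi>_ker: "\<And>w. \<psi> w = 0 \<Longrightarrow> \<bar>\<phi> w\<bar> \<le> 4 * d * norm \<phi> * norm w" by blast
  define L where "L = (\<kappa> * h) *\<^sub>R Kr"
  have L: "L x = (\<kappa> * h) *\<^sub>R Kr x" and L': "L x = \<kappa> *\<^sub>R (\<phi> x *\<^sub>R v + D x)" for x
    by (simp_all add: L_def D blinfun.scaleR_left)
  have v'_ge: "(\<epsilon> / 2) *\<^sub>R u \<le> v'"
  proof -
    have "v - v' \<le> (c * norm (v - v')) *\<^sub>R u" by (rule le_unit)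
    also have "\<dots> \<le> (\<epsilon> / 2) *\<^sub>R u"
    proof (rule scaleR_right_mono[OF _ u])
      have "c * norm (v - v') \<le> c * (4 * d * norm v)"
        using c v'_near by (intro mult_left_mono) (auto simp: norm_minus_commute)
      then show "c * norm (v - v') \<le> \<epsilon> / 2" using \<epsilon>(3) by (simp add: mult_ac)
    qed
    finally have "v - v' \<le> (\<epsilon> / 2) *\<^sub>R u" .
    moreover have "(\<epsilon> / 2) *\<^sub>R u + (\<epsilon> / 2) *\<^sub>R u \<le> v" using \<epsilon>(2) by (simp flip: scaleR_add_left)
    ultimately have "(\<epsilon> / 2) *\<^sub>R u + (\<epsilon> / 2) *\<^sub>R u \<le> (\<epsilon> / 2) *\<^sub>R u + v'"
      by (metis add.commute diff_le_eq order_trans add_left_mono)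
    then show ?thesis by simp
  qed
  have v'0: "0 \<le> v'" using v'_ge \<epsilon> u by (metis order_trans scaleR_nonneg_nonneg less_imp_le half_gt_zero)
  have v'_ne: "v' \<noteq> 0" using \<psi>v' by auto
  have Kr_nonneg: "0 \<le> Kr f" if "0 \<le> f" for f using K_nonneg[of "emb f"] that by (simp add: K_emb)
  have \<kappa>0: "\<kappa> > 0" using \<kappa> by linarith
  \<comment> \<open>The ratio 5/16 is 8/32 + 2/32: on the kernel of \<psi> the rank-one part is
    small by \<open>\<psi>_ker\<close>, the remainder is at most d with 32 d \<le> 1, and \<kappa>
    \<le> 2 doubles both.\<close>
  have \<psi>_nonneg: "0 \<le> \<psi> f" if "0 \<le> f" for f
  proof (rule dual_eigenvector_nonneg[where L = L and v = v' and q = "5 / 16", OF _ _ v'0 \<psi>v' _ _ _ _ that])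
    show "0 \<le> L g" if "0 \<le> g" for g
      using that h \<kappa>0 unfolding L by (intro scaleR_nonneg_nonneg Kr_nonneg) auto
    show "L v' = v'" unfolding L' by (rule v'_eq)
    show "\<psi> (L x) = \<psi> x" for x unfolding L' using \<psi>_eq[of x] by (simp add: blinfun.scaleR_right)
    show "norm (L w) \<le> 5 / 16 * norm w" if "\<psi> w = 0" for w
    proof -
      have "norm (L w) \<le> \<kappa> * (\<bar>\<phi> w\<bar> * norm v + norm (D w))"
        unfolding L' using \<kappa>0 norm_triangle_ineq[of "\<phi> w *\<^sub>R v" "D w"] by simp
      also have "\<dots> \<le> 2 * ((4 * d * norm \<phi> * norm w) * norm v + d * norm w)"
        using \<kappa> d0 \<psi>_ker[OF that] order_trans[OF norm_blinfun mult_right_mono[OF norm_D]]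
        by (intro mult_mono add_mono) auto
      also have "\<dots> = (8 * (d * norm \<phi> * norm v) + 2 * d) * norm w" by (simp add: algebra_simps)
      also have "\<dots> \<le> 5 / 16 * norm w" using d_small d32 by (intro mult_right_mono) auto
      finally show ?thesis .
    qed
  qed auto
  have \<psi>_Kr: "\<kappa> * h * \<psi> (Kr x) = \<psi> x" for x
    using \<psi>_eq[of x] by (simp add: L'[symmetric, THEN arg_cong] D blinfun.scaleR_right)
  \<comment> \<open>K f \<ge> R f \<ge> \<eta> u, and u dominates a multiple of v'. So \<psi>(K f)
    is at least a positive multiple of \<psi>(v'), and \<psi>(f) is a positive multiple of \<psi>(K
    f).\<close>
  have \<psi>_pos: "0 < \<psi> f" if f: "0 < f" for f
  proof -
    obtain \<eta> where \<eta>: "\<eta> > 0" "emb (\<eta> *\<^sub>R u) \<le> R (emb f)"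
      using R_strong[of "emb f"] f by (auto simp: strongly_positive_def emb_linear)
    have "emb (\<eta> *\<^sub>R u) \<le> emb (Kr f)"
      using \<eta>(2) K4[of "emb f"] f by (auto simp: K_emb[symmetric] less_imp_le intro: order_trans)
    then have le: "\<eta> *\<^sub>R u \<le> Kr f" by simp
    define b where "b = \<eta> / (c * norm v')"
    have b: "b > 0" using \<eta> c v'_ne by (simp add: b_def)
    have "b *\<^sub>R v' \<le> b *\<^sub>R (c * norm v') *\<^sub>R u" using b by (intro scaleR_left_mono le_unit) simp
    also have "\<dots> = \<eta> *\<^sub>R u" using c v'_ne by (simp add: b_def)
    also note le
    finally have "0 \<le> Kr f - b *\<^sub>R v'" by simp
    from \<psi>_nonneg[OF this] have "b * \<psi> v' \<le> \<psi> (Kr f)"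
      by (simp add: blinfun.diff_right blinfun.scaleR_right)
    moreover have "b * \<psi> v' > 0" using b \<psi>v' by simp
    ultimately have "\<psi> (Kr f) > 0" by linarith
    then show ?thesis using \<psi>_Kr[of f] \<kappa>0 h by (metis mult_pos_pos)
  qed
  \<comment> \<open>From \<kappa> h K v' = v' it follows that (A + B) v' = (\<mu> - \<kappa>h) v';
    equivalently b = s + (1 - \<kappa>) h.\<close>
  define b where "b = \<mu> - \<kappa> * h"
  have S_v': "S t (emb v') = exp (b * t) *\<^sub>R emb v'" if "t \<ge> 0" for t
  proof (rule S.eigenvector_orbit[OF _ that])
    have "(\<kappa> * h) *\<^sub>R K (emb v') = emb v'"
      using v'_eq unfolding K_emb L'[symmetric] L by (simp flip: emb_linear)
    then have "\<mu> *\<^sub>R emb v' - (\<kappa> * h) *\<^sub>R emb v' = (\<kappa> * h) *\<^sub>R (\<mu> *\<^sub>R K (emb v') - emb v')"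
      by (metis scaleR_diff_right scaleR_left_commute)
    with S.generator_scaleC[OF K1, of "of_real (\<kappa> * h)" "emb v'"] \<open>(\<kappa> * h) *\<^sub>R K (emb v') = emb v'\<close>
    show "generator S (emb v') = Some (b *\<^sub>R emb v')"
      unfolding scaleC_of_real by (simp add: b_def scaleR_diff_left)
  qed
  have S_real: "S t (emb x) = emb (rpart (S t (emb x)))" if "t \<ge> 0" for t x
    by (intro preserves_real_emb S_preserves_real T_real positive_operator_preserves_real B that)
  \<comment> \<open>For general x the orbit need not be differentiable, so it is smoothed to z = K
    x. Since \<kappa> h \<psi> \<circ> K = \<psi> and K commutes with S, the function g satisfies g'
    = b g.\<close>
  have \<psi>_S: "\<psi> (rpart (S t (emb x))) = exp (b * t) * \<psi> x" if t: "t \<ge> 0" for t x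
  proof -
    define z where "z = K (emb x)"
    define g where "g r = \<psi> (rpart (S r z))" for r
    have gz: "generator S z = Some (\<mu> *\<^sub>R z - emb x)" unfolding z_def by (rule K1)
    have g_eq: "\<kappa> * h * g r = \<psi> (rpart (S r (emb x)))" if r: "r \<ge> 0" for r
    proof -
      have "K (\<mu> *\<^sub>R S r z - S r (\<mu> *\<^sub>R z - emb x)) = S r z" by (rule K2[OF S.generator_T[OF gz r]])
      then have "S r z = K (S r (emb x))" by (simp add: blinfun.diff_right blinfun.scaleR_right)
      also have "\<dots> = emb (Kr (rpart (S r (emb x))))" by (subst S_real[OF r]) (simp add: K_emb)
      finally show ?thesis using \<psi>_Kr[of "rpart (S r (emb x))"] by (simp add: g_def)
    qed
    have bl: "bounded_linear (\<lambda>y. \<psi> (rpart y))"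
      by (intro bounded_linear_compose[OF blinfun.bounded_linear_right bounded_linear_rpart])
    have g': "(g has_vector_derivative b * g r) (at r within {0..t})" if r: "r \<in> {0..t}" for r
    proof -
      have "((\<lambda>r. S r z) has_vector_derivative S r (\<mu> *\<^sub>R z - emb x)) (at r within {0..t})"
        using r by (intro has_vector_derivative_within_subset[OF S.orbit_derivative[OF gz]]) auto
      from bounded_linear.has_vector_derivative[OF bl this]
      have "(g has_vector_derivative \<mu> * g r - \<kappa> * h * g r) (at r within {0..t})"
        using g_eq[of r] r by (simp add: g_def[abs_def] blinfun.diff_right blinfun.scaleR_right)
      then show ?thesis by (simp add: b_def left_diff_distrib)
    qed
    have "((\<lambda>r. exp (- b * r) * g r) has_vector_derivative 0) (at r within {0..t})" if r: "r \<in> {0..t}" for r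
    proof -
      have "((\<lambda>r. exp (- b * r)) has_real_derivative - b * exp (- b * r)) (at r within {0..t})"
        by (auto intro!: derivative_eq_intros)
      from DERIV_mult[OF this g'[OF r, folded has_real_derivative_iff_has_vector_derivative]]
      show ?thesis by (simp add: has_real_derivative_iff_has_vector_derivative[symmetric] mult_ac)
    qed
    from fundamental_theorem_of_calculus[OF t this]
    have "((\<lambda>_. 0::real) has_integral exp (- b * t) * g t - exp (- b * 0) * g 0) {0..t}" .
    then have "exp (- b * t) * g t = g 0" by (simp add: has_integral_0_eq)
    then have "g t = exp (b * t) * g 0" by (simp add: exp_minus field_simps)
    then have "\<kappa> * h * g t = exp (b * t) * (\<kappa> * h * g 0)" by simp
    then show ?thesis using g_eq[OF t] g_eq[of 0] by simp
  qed
  \<comment> \<open>Passing from the rate s to b costs e^((\<kappa>-1)h\<tau>) \<le> 2. The rest is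
    1/8 for S - T, 1/8 for the decay of T, and the small rank-one part: 2 (1/8 + 1/8 + 4/32) =
    3/4.\<close>
  have contr: "exp (- b * \<tau>) * norm (S \<tau> (emb x)) \<le> 3 / 4 * norm x" if x: "\<psi> x = 0" for x
  proof -
    have "exp (- b * \<tau>) = exp (- s * \<tau>) * exp ((\<kappa> - 1) * (h * \<tau>))"
      by (simp add: exp_add[symmetric] b_def h_def algebra_simps)
    also have "exp ((\<kappa> - 1) * (h * \<tau>)) \<le> exp (1 * ln 2)"
    proof -
      have "(\<kappa> - 1) * (h * \<tau>) \<le> 1 * (h * \<tau>)" using \<kappa> h \<tau> by (intro mult_right_mono) auto
      also have "\<dots> \<le> 1 * ln 2" using \<tau>(2) by (simp add: h_def)
      finally show ?thesis by (simp only: exp_le_cancel_iff)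
    qed
    finally have e: "exp (- b * \<tau>) \<le> exp (- s * \<tau>) * 2" by simp
    have "norm (S \<tau> (emb x)) \<le> norm ((S \<tau> - T \<tau>) (emb x)) + norm (T \<tau> (emb x))"
      using norm_triangle_ineq[of "(S \<tau> - T \<tau>) (emb x)" "T \<tau> (emb x)"] by (simp add: blinfun.diff_left)
    also have "norm ((S \<tau> - T \<tau>) (emb x)) \<le> norm (S \<tau> - T \<tau>) * norm x"
      using norm_blinfun[of "S \<tau> - T \<tau>" "emb x"] by simp
    finally have "exp (- b * \<tau>) * norm (S \<tau> (emb x)) \<le>
        (exp (- s * \<tau>) * 2) * (norm (S \<tau> - T \<tau>) * norm x + norm (T \<tau> (emb x)))"
      using e by (intro mult_mono) auto
    also have "\<dots> = 2 * ((exp (- s * \<tau>) * norm (S \<tau> - T \<tau>)) * norm x + exp (- s * \<tau>) * norm (T \<tau> (emb x)))"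
      by (simp add: algebra_simps)
    also have "\<dots> \<le> 2 * (1 / 8 * norm x + (1 / 8 * norm x + (4 * d * norm \<phi> * norm x) * norm v))"
      by (intro mult_left_mono add_mono mult_right_mono close order_trans[OF decay] \<psi>_ker[OF x]) auto
    also have "\<dots> = (1 / 2 + 8 * (d * norm \<phi> * norm v)) * norm x" by (simp add: algebra_simps)
    also have "\<dots> \<le> 3 / 4 * norm x" using d_small by (intro mult_right_mono) auto
    finally show ?thesis .
  qed
  show ?thesis unfolding individually_eventually_strongly_positive_def
  proof (intro allI impI)
    fix F :: "'a complexification" assume F: "F > 0"
    define f where "f = rpart F"
    have Ff: "F = emb f" unfolding f_def using F by (intro nonneg_eq_emb) (simp add: less_complexification_def)
    have f: "f > 0" using F unfolding Ff by simp
    define a where "a = \<psi> f / \<psi> v'"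
    have a: "a > 0" using \<psi>_pos[OF f] \<psi>v' by (simp add: a_def)
    define w where "w = f - a *\<^sub>R v'"
    have w: "\<psi> w = 0" using \<psi>v' by (simp add: w_def a_def blinfun.diff_right blinfun.scaleR_right)
    define N where "N = {emb x | x. \<psi> x = 0}"
    \<comment> \<open>With this e the remainder is at most e^(bt) a \<epsilon>/4 times u, half of
      the lower bound e^(bt) a \<epsilon>/2 times u for the main term.\<close>
    define e where "e = a * \<epsilon> / (4 * c)"
    have e: "e > 0" using a \<epsilon> c by (simp add: e_def)
    obtain t1 where t1: "t1 \<ge> 0" "\<And>t. t \<ge> t1 \<Longrightarrow> exp (- b * t) * norm (S t (emb w)) \<le> e"
    proof (rule S.orbit_decay[OF \<tau>(1), of "3 / 4" N b "emb w" e])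
      show "S t y \<in> N" if "y \<in> N" "t \<ge> 0" for y t
      proof -
        obtain x where x: "y = emb x" "\<psi> x = 0" using \<open>y \<in> N\<close> by (auto simp: N_def)
        have "S t y = emb (rpart (S t (emb x)))" using S_real[OF \<open>t \<ge> 0\<close>, of x] x by simp
        moreover have "\<psi> (rpart (S t (emb x))) = 0" using \<psi>_S[OF \<open>t \<ge> 0\<close>, of x] x by simp
        ultimately show ?thesis by (auto simp: N_def)
      qed
      show "exp (- b * \<tau>) * norm (S \<tau> y) \<le> 3 / 4 * norm y" if "y \<in> N" for y
        using that contr by (auto simp: N_def)
    qed (use w e in \<open>auto simp: N_def\<close>)
    show "\<exists>t0\<ge>0. \<forall>t\<ge>t0. strongly_positive (emb u) (S t F)"
    proof (intro exI[of _ t1] conjI allI impI t1(1))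
      fix t assume t: "t \<ge> t1"
      have t0: "t \<ge> 0" using t t1 by simp
      define y where "y = rpart (S t (emb w))"
      have y: "S t (emb w) = emb y" unfolding y_def by (rule S_real[OF t0])
      have "norm y \<le> exp (b * t) * e" using t1(2)[OF t] by (simp add: y exp_minus field_simps)
      then have "c * norm y \<le> exp (b * t) * (a * \<epsilon> / 4)" using c by (simp add: e_def field_simps)
      then have "(c * norm (- y)) *\<^sub>R u \<le> (exp (b * t) * (a * \<epsilon> / 4)) *\<^sub>R u"
        using u by (intro scaleR_right_mono) auto
      with le_unit[of "- y"] have "- y \<le> (exp (b * t) * (a * \<epsilon> / 4)) *\<^sub>R u" by (rule order_trans)
      moreover have "(exp (b * t) * a) *\<^sub>R (\<epsilon> / 2) *\<^sub>R u \<le> (exp (b * t) * a) *\<^sub>R v'"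
        using a by (intro scaleR_left_mono v'_ge) auto
      moreover have "(exp (b * t) * a) *\<^sub>R (\<epsilon> / 2) *\<^sub>R u =
          (exp (b * t) * (a * \<epsilon> / 4)) *\<^sub>R u + (exp (b * t) * (a * \<epsilon> / 4)) *\<^sub>R u"
        by (simp flip: scaleR_add_left)
      moreover have "X \<le> W + y" if "- y \<le> X" "Z \<le> W" "Z = X + X" for X W Z :: 'a
      proof -
        have "X + - y \<le> X + X" using that(1) by (rule add_left_mono)
        also have "\<dots> \<le> W" using that by simp
        finally show ?thesis by (simp add: diff_le_eq)
      qed
      ultimately have "(exp (b * t) * (a * \<epsilon> / 4)) *\<^sub>R u \<le> (exp (b * t) * a) *\<^sub>R v' + y" by blast
      moreover have "S t F = emb ((exp (b * t) * a) *\<^sub>R v' + y)"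
      proof -
        have "F = a *\<^sub>R emb v' + emb w" unfolding Ff w_def by (simp add: emb_linear)
        then have "S t F = a *\<^sub>R exp (b * t) *\<^sub>R emb v' + emb y"
          by (simp add: blinfun.add_right blinfun.scaleR_right S_v'[OF t0] y)
        then show ?thesis by (simp add: emb_linear mult.commute)
      qed
      ultimately have "(exp (b * t) * (a * \<epsilon> / 4)) *\<^sub>R emb u \<le> S t F"
        by (metis emb_le_iff emb_linear(3))
      moreover have "exp (b * t) * (a * \<epsilon> / 4) > 0" using a \<epsilon> by simp
      ultimately show "strongly_positive (emb u) (S t F)" unfolding strongly_positive_def by blast
    qed
  qed
qed

end


section \<open>Stability of eventual strong positivity\<close>

text \<open>Near the pole \<xi> R(s + \<xi>)(I - P) = \<xi> R(s + \<xi>) - P is O(\<xi>), so one may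
  divide by \<xi>. The rest of the bounded half-disc is compact and lies in the resolvent set after
  translation by s.\<close>

lemma (in semigroup) resolvent_regular_part_bounded:
  fixes P :: "'a bounded_operator"
  assumes rho: "\<And>\<mu>. Re \<mu> \<ge> 0 \<Longrightarrow> \<mu> \<noteq> 0 \<Longrightarrow> of_real s + \<mu> \<in> resolvent_set A"
    and RP: "\<And>\<mu> x. \<mu> \<in> resolvent_set A \<Longrightarrow>
      (\<mu> - of_real s) *\<^sub>C resolvent A \<mu> (P x) = P x"
    and "\<delta> > 0" and K: "\<And>\<xi> x. \<xi> \<noteq> 0 \<Longrightarrow> cmod \<xi> < \<delta> \<Longrightarrow>
      norm (\<xi> *\<^sub>C resolvent A (of_real s + \<xi>) x - P x) \<le> K * cmod \<xi> * norm x"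
  shows "\<exists>C. \<forall>\<mu>. Re \<mu> \<ge> 0 \<and> \<mu> \<noteq> 0 \<and> cmod \<mu> \<le> b \<longrightarrow>
      (\<forall>x. norm (resolvent A (of_real s + \<mu>) (x - P x)) \<le> C * norm x)"
proof -
  define Q where "Q = cball 0 b \<inter> {\<mu>. Re \<mu> \<ge> 0} \<inter> - ball 0 \<delta>"
  have "compact Q" unfolding Q_def
    by (intro compact_Int_closed closed_halfspace_Re_ge) (auto simp: closed_def)
  then have "compact ((+) (of_real s) ` Q)" by (rule compact_translation)
  moreover have "(+) (of_real s) ` Q \<subseteq> resolvent_set A"
    using \<open>\<delta> > 0\<close> by (auto simp: Q_def intro!: rho)
  ultimately obtain C where C: "\<And>\<mu>. \<mu> \<in> (+) (of_real s) ` Q \<Longrightarrow> norm (resolvent A \<mu>) \<le> C"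
    by (rule resolvent_bounded_on_compact) blast
  have "norm (resolvent A (of_real s + \<mu>) (x - P x)) \<le> max K (\<bar>C\<bar> * (1 + norm P)) * norm x"
    if \<mu>: "Re \<mu> \<ge> 0" "\<mu> \<noteq> 0" "cmod \<mu> \<le> b" for \<mu> x
  proof (cases "cmod \<mu> < \<delta>")
    case True
    let ?R = "resolvent A (of_real s + \<mu>)"
    have "\<mu> *\<^sub>C ?R (x - P x) = \<mu> *\<^sub>C ?R x - P x"
      using RP[OF rho[OF \<mu>(1,2)], of x] by (simp add: blinfun.diff_right scaleC.diff_right)
    then have "cmod \<mu> * norm (?R (x - P x)) \<le> K * cmod \<mu> * norm x"
      using K[OF \<mu>(2) True, of x] by (metis norm_scaleC)
    then have "norm (?R (x - P x)) \<le> K * norm x"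
      using \<mu>(2) by (simp add: mult.assoc mult.left_commute[of K])
    also have "\<dots> \<le> max K (\<bar>C\<bar> * (1 + norm P)) * norm x" by (intro mult_right_mono) auto
    finally show ?thesis .
  next
    case False
    then have "norm (resolvent A (of_real s + \<mu>)) \<le> \<bar>C\<bar>"
      using C[of "of_real s + \<mu>"] \<mu> by (auto simp: Q_def)
    moreover have "norm (x - P x) \<le> (1 + norm P) * norm x"
      using norm_triangle_ineq4[of x "P x"] norm_blinfun[of P x] by (simp add: distrib_right)
    ultimately have "norm (resolvent A (of_real s + \<mu>) (x - P x)) \<le> \<bar>C\<bar> * ((1 + norm P) * norm x)"
      by (intro order_trans[OF norm_blinfun mult_mono]) auto
    also have "\<dots> \<le> max K (\<bar>C\<bar> * (1 + norm P)) * norm x"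
      by (simp add: mult.assoc[symmetric] mult_right_mono)
    finally show ?thesis .
  qed
  then show ?thesis by blast
qed

context strong_pole
begin

text \<open>The order of the choices matters: \<tau> from the decay, d from \<phi>, v and the order
  unit, then h depending on \<tau> and d, and the bound for B last, depending on all of
  them.\<close>

lemma perturbation_eventually_strongly_positive:
  assumes T_real: "\<And>t. t \<ge> 0 \<Longrightarrow> preserves_real (T t)"
    and dominant: "\<And>\<mu>. Re \<mu> \<ge> 0 \<Longrightarrow> \<mu> \<noteq> 0 \<Longrightarrow> of_real s + \<mu> \<in> resolvent_set A"
    and enc: "eventually_norm_continuous T"
  obtains \<epsilon> where "\<epsilon> > 0" "\<And>B. complex_linear B \<Longrightarrow> positive_operator B \<Longrightarrow> norm B < \<epsilon> \<Longrightarrow>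
    \<exists>S. C0_semigroup S \<and> generator S = perturbed A B \<and>
      individually_eventually_strongly_positive S (emb u)"
proof -
  let ?R = "resolvent A"
  obtain P :: "'a bounded_operator" and \<phi> :: "'a \<Rightarrow>\<^sub>L real" and v K \<delta> where P: "complex_linear P"
    "\<And>x. P (P x) = P x"
    "\<And>t x. t \<ge> 0 \<Longrightarrow> P (T t x) = T t (P x)"
    and P\<phi>: "\<And>x. P (emb x) = emb (\<phi> x *\<^sub>R v)" and \<phi>v: "\<phi> v = 1"
    and "\<exists>\<epsilon>>0. \<epsilon> *\<^sub>R u \<le> v" and \<delta>: "\<delta> > 0"
    and RP: "\<And>\<mu> x. \<mu> \<in> resolvent_set A \<Longrightarrow> (\<mu> - of_real s) *\<^sub>C ?R \<mu> (P x) = P x"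
    and K: "\<And>\<xi> x. \<xi> \<noteq> 0 \<Longrightarrow> cmod \<xi> < \<delta> \<Longrightarrow>
      norm (\<xi> *\<^sub>C ?R (of_real s + \<xi>) x - P x) \<le> K * cmod \<xi> * norm x" by (rule pole_projection) blast
  then obtain \<epsilon> where \<epsilon>: "\<epsilon> > 0" "\<epsilon> *\<^sub>R u \<le> v" by blast
  obtain t0 where t0: "t0 \<ge> 0" "continuous_on {t0<..} T"
    using enc by (auto simp: eventually_norm_continuous_def)
  have bdd: "\<exists>C. \<forall>\<mu>. Re \<mu> \<ge> 0 \<and> \<mu> \<noteq> 0 \<and> cmod \<mu> \<le> b \<longrightarrow>
      (\<forall>x. norm (?R (of_real s + \<mu>) (x - P x)) \<le> C * norm x)" for b
    by (rule resolvent_regular_part_bounded[OF dominant RP \<delta> K])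
  interpret gap: spectral_gap T P s t0 by unfold_locales (fact P dominant bdd t0)+
  obtain \<tau> where \<tau>: "\<tau> > 0" "norm (gap.U \<tau>) < 1 / 8" using gap.U_decay[of "1 / 8"] by auto
  \<comment> \<open>So e^(-s\<tau>) T(\<tau>) acts as the identity on the range of P, which
    contributes the term with \<phi> in the decay estimate.\<close>
  have T_v: "T \<tau> (emb v) = exp (s * \<tau>) *\<^sub>R emb v"
  proof (rule eigenvector_orbit)
    have \<mu>: "of_real \<mu>\<^sub>1 \<in> resolvent_set A" using \<mu>\<^sub>1 by (intro resolvent_set) simp
    define r where "r = \<mu>\<^sub>1 - s"
    have Pv: "P (emb v) = emb v" using P\<phi>[of v] \<phi>v by simp
    have Rv: "r *\<^sub>R ?R (of_real \<mu>\<^sub>1) (emb v) = emb v"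
      using RP[OF \<mu>, of "emb v"] unfolding Pv r_def by (simp add: scaleC_of_real flip: of_real_diff)
    have "A (r *\<^sub>R ?R (of_real \<mu>\<^sub>1) (emb v)) =
        Some (r *\<^sub>R (\<mu>\<^sub>1 *\<^sub>R ?R (of_real \<mu>\<^sub>1) (emb v) - emb v))"
      using generator_scaleC[OF resolvent_solves[OF \<mu>], of "of_real r" "emb v"] unfolding scaleC_of_real .
    also have "r *\<^sub>R (\<mu>\<^sub>1 *\<^sub>R ?R (of_real \<mu>\<^sub>1) (emb v) - emb v) = s *\<^sub>R emb v"
      unfolding scaleR_diff_right scaleR_left_commute[of r] Rv by (simp add: r_def scaleR_diff_left)
    finally show "A (emb v) = Some (s *\<^sub>R emb v)" unfolding Rv .
  qed (use \<tau> in simp)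
  have decay: "exp (- s * \<tau>) * norm (T \<tau> (emb x)) \<le> 1 / 8 * norm x + \<bar>\<phi> x\<bar> * norm v" for x
  proof -
    have "exp (- s * \<tau>) *\<^sub>R T \<tau> (emb x) = gap.U \<tau> (emb x) + exp (- s * \<tau>) *\<^sub>R T \<tau> (P (emb x))"
      by (simp add: gap.U_apply blinfun.diff_right scaleR_diff_right)
    also have "exp (- s * \<tau>) *\<^sub>R T \<tau> (P (emb x)) = \<phi> x *\<^sub>R emb v"
      using T_v by (simp add: P\<phi> emb_linear blinfun.scaleR_right exp_minus)
    finally have "norm (exp (- s * \<tau>) *\<^sub>R T \<tau> (emb x)) \<le> norm (gap.U \<tau> (emb x)) + norm (\<phi> x *\<^sub>R emb v)"
      by (metis norm_triangle_ineq)
    also have "norm (gap.U \<tau> (emb x)) \<le> 1 / 8 * norm (emb x)"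
      using \<tau>(2) by (intro order_trans[OF norm_blinfun mult_right_mono]) auto
    finally show ?thesis by simp
  qed
  have v0: "v \<noteq> 0" using \<phi>v by auto
  have \<phi>0: "norm \<phi> > 0" using \<phi>v by auto
  \<comment> \<open>The first entry keeps the eigenvector equation solvable and the kernel
    contractive; the second keeps v' above \<epsilon>/2 times u.\<close>
  define d where "d = min (1 / (32 * norm \<phi> * norm v)) (\<epsilon> / (8 * norm v * c))"
  have d: "d > 0" using v0 \<phi>0 \<epsilon> c by (simp add: d_def)
  have d1: "32 * (d * norm \<phi> * norm v) \<le> 1"
  proof -
    have "d \<le> 1 / (32 * norm \<phi> * norm v)" by (simp add: d_def)
    then show ?thesis using v0 \<phi>0 by (simp add: pos_le_divide_eq mult_ac)
  qed
  have d2: "4 * d * norm v * c \<le> \<epsilon> / 2"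
  proof -
    have "d \<le> \<epsilon> / (8 * norm v * c)" by (simp add: d_def)
    then show ?thesis using v0 c by (simp add: pos_le_divide_eq mult_ac)
  qed
  \<comment> \<open>The four entries: strong positivity at \<mu>, validity of the residue estimate,
    at most a factor 2 between the growth rates over time \<tau>, and distance at most d/2 to the
    residue.\<close>
  define h where "h = min (min (\<mu>\<^sub>1 - s) (\<delta> / 2)) (min (ln 2 / \<tau>) (d / (2 * (\<bar>K\<bar> + 1))))"
  have h: "h > 0" using \<mu>\<^sub>1 \<delta> \<tau> d by (simp add: h_def add_nonneg_pos)
  have h_le: "h \<le> \<mu>\<^sub>1 - s" "h < \<delta>" "h * \<tau> \<le> ln 2" "\<bar>K\<bar> * h \<le> d / 2"
  proof -
    show "h \<le> \<mu>\<^sub>1 - s" by (simp add: h_def)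
    have "h \<le> \<delta> / 2" unfolding h_def by (intro min.coboundedI1 min.cobounded2)
    then show "h < \<delta>" using \<delta> by linarith
    have "h \<le> ln 2 / \<tau>" by (simp add: h_def)
    then show "h * \<tau> \<le> ln 2" using \<tau> by (simp add: pos_le_divide_eq)
    have "h \<le> d / (2 * (\<bar>K\<bar> + 1))" by (simp add: h_def)
    then have "h * (2 * (\<bar>K\<bar> + 1)) \<le> d" by (simp add: pos_le_divide_eq add_nonneg_pos)
    then show "\<bar>K\<bar> * h \<le> d / 2" using h by (simp add: algebra_simps)
  qed
  define \<mu> where "\<mu> = s + h"
  have \<mu>: "\<mu> \<in> {s<..\<mu>\<^sub>1}" using h h_le by (simp add: \<mu>_def)
  define R where "R = ?R (of_real \<mu>)"
  have near: "norm ((\<mu> - s) *\<^sub>R R (emb x) - emb (\<phi> x *\<^sub>R v)) \<le> d / 2 * norm x" for x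
  proof -
    have "norm ((\<mu> - s) *\<^sub>R R (emb x) - emb (\<phi> x *\<^sub>R v)) \<le> K * h * norm x"
      using K[of "of_real h" "emb x"] h h_le(2) by (simp add: R_def \<mu>_def scaleC_of_real P\<phi>)
    also have "\<dots> \<le> (\<bar>K\<bar> * h) * norm x" using h by (intro mult_right_mono) auto
    also have "\<dots> \<le> d / 2 * norm x" by (intro mult_right_mono h_le(4)) simp
    finally show ?thesis .
  qed
  obtain M \<omega> where M: "M \<ge> 1" "\<omega> \<ge> 0" "\<And>t. t \<ge> 0 \<Longrightarrow> norm (T t) \<le> M * exp (\<omega> * t)"
    by (rule growth_bound) blast
  define C1 where "C1 = 2 * M"
  define C2 where "C2 = 2 * norm R"
  define C3 where "C3 = h * (2 * (norm R)\<^sup>2) * 2 / d"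
  define C4 where "C4 = 8 * (exp (- s * \<tau>) * (2 * M\<^sup>2 * exp ((\<omega> + 1) * \<tau>)))"
  \<comment> \<open>The reciprocal of the sum makes norm B * Ci \<le> 1 for each Ci separately, and
    the four constants correspond to \<open>s1\<close> to \<open>s4\<close>.\<close>
  define \<epsilon>B where "\<epsilon>B = 1 / (1 + C1 + C2 + C3 + C4)"
  have C0: "0 \<le> C1" "0 \<le> C2" "0 \<le> C3" "0 \<le> C4" using M h d by (simp_all add: C1_def C2_def C3_def C4_def)
  show ?thesis
  proof (rule that[of \<epsilon>B])
    show "\<epsilon>B > 0" using C0 by (simp add: \<epsilon>B_def)
    fix B :: "'a bounded_operator"
    assume B: "complex_linear B" "positive_operator B" "norm B < \<epsilon>B"
    have nB: "norm B * (1 + C1 + C2 + C3 + C4) \<le> 1" using B(3) C0 by (simp add: \<epsilon>B_def pos_less_divide_eq)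
    have sm: "norm B * C \<le> 1" if "C \<le> 1 + C1 + C2 + C3 + C4" for C
      using mult_left_mono[OF that norm_ge_zero[of B]] nB by linarith
    have s1: "M * norm B \<le> 1 / 2" using sm[of C1] C0 by (simp add: C1_def mult_ac)
    have s2: "norm B * norm R \<le> 1 / 2" using sm[of C2] C0 by (simp add: C2_def mult_ac)
    have s3: "(\<mu> - s) * (2 * (norm R)\<^sup>2 * norm B) \<le> d / 2"
      using sm[of C3] C0 d by (simp add: C3_def \<mu>_def field_simps)
    have s4: "exp (- s * \<tau>) * (2 * M\<^sup>2 * norm B * exp ((\<omega> + 1) * \<tau>)) \<le> 1 / 8"
      using sm[of C4] C0 by (simp add: C4_def mult_ac)
    interpret pert: perturbed_semigroup T B M \<omega> by unfold_locales (fact B M s1)+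
    have close: "exp (- s * \<tau>) * norm (pert.S \<tau> - T \<tau>) \<le> 1 / 8"
    proof (rule order_trans[OF mult_left_mono s4])
      show "norm (pert.S \<tau> - T \<tau>) \<le> 2 * M\<^sup>2 * norm B * exp ((\<omega> + 1) * \<tau>)"
        using pert.S_close[of \<tau>] \<tau> by (simp add: pert.weight_def)
    qed simp
    have "individually_eventually_strongly_positive pert.S (emb u)"
    proof (rule pert.eventually_strongly_positive[where \<phi> = \<phi> and v = v and s = s and \<mu> = \<mu> and \<tau> = \<tau>
          and c = c and d = d and \<epsilon> = \<epsilon>])
      show "strongly_positive (emb u) (?R (of_real \<mu>) f)" if "f > 0" for f by (rule strong[OF \<mu> that])
      show "of_real \<mu> \<in> resolvent_set A" by (rule resolvent_set[OF \<mu>])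
    qed (use u c unit B T_real \<mu> s2 s3 near \<phi>v d1 d2 \<epsilon> \<tau> h_le decay close in
        \<open>auto simp: R_def \<mu>_def\<close>)
    then show "\<exists>S. C0_semigroup S \<and> generator S = perturbed A B \<and>
        individually_eventually_strongly_positive S (emb u)"
      using pert.C0_S pert.generator_S by blast
  qed
qed

end

theorem theorem4p4:
  fixes T :: "real \<Rightarrow> 'a::banach_lattice bounded_operator"
    and A :: "'a operator"
    and u :: "'a complexification"
    and s :: real
  assumes "C0_semigroup T" and "real_semigroup T" and "A = generator T"
    and "dominant_spectral_bound A s"
    and "resolvent_pole A (complex_of_real s)"
    and "quasi_interior u"
    and "resolvent_uniformly_eventually_strongly_positive A u s"
    and "eventually_norm_continuous T"
    and "principal_ideal u = UNIV"
  shows "\<exists>\<epsilon>>0. \<forall>B :: 'a bounded_operator.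
    complex_linear B \<and> compact_operator B \<and> positive_operator B \<and> norm B < \<epsilon> \<longrightarrow>
      (\<exists>S. C0_semigroup S \<and> generator S = perturbed A B) \<and>
      (\<forall>S. C0_semigroup S \<and> generator S = perturbed A B \<longrightarrow>
        individually_eventually_strongly_positive S u)"
proof -
  define u0 where "u0 = rpart u"
  have "0 \<le> u" using assms(6) by (simp add: quasi_interior_def)
  then have u_emb: "u = emb u0" "0 \<le> u0"
    by (auto simp: u0_def nonneg_eq_emb[symmetric] less_eq_complexification_def)
  \<comment> \<open>Equality of the principal ideal with the whole space, tested on real vectors,
    says that the real part of u is an order unit.\<close>
  have "\<exists>c. \<bar>x\<bar> \<le> c *\<^sub>R u0" for x
  proof -
    obtain c where "\<bar>emb x\<bar> \<le> c *\<^sub>R u" using assms(9) unfolding principal_ideal_def by blast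
    then have "\<bar>x\<bar> \<le> c *\<^sub>R u0"
      by (simp add: u_emb abs_complexification_def modulus_emb less_eq_complexification_def)
    then show ?thesis ..
  qed
  from order_unit_norm[OF u_emb(2) this]
  obtain c where c: "c > 0" "\<And>x. \<bar>x\<bar> \<le> (c * norm x) *\<^sub>R u0" by blast
  obtain \<mu>1 where \<mu>1: "\<mu>1 > s" "complex_of_real ` {s<..\<mu>1} \<subseteq> resolvent_set A"
    "\<And>\<mu> f. \<mu> \<in> {s<..\<mu>1} \<Longrightarrow> f > 0 \<Longrightarrow> strongly_positive u (resolvent A (complex_of_real \<mu>) f)"
    using assms(7) unfolding resolvent_uniformly_eventually_strongly_positive_def by blast
  interpret strong_pole T u0 s \<mu>1 c by unfold_locales (use assms(1,3,5) u_emb c \<mu>1 in auto)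
  have T_real: "preserves_real (T t)" if "t \<ge> 0" for t
    using assms(2) that unfolding real_semigroup_def real_operator_def preserves_real_def
    by (auto simp: real_elements_def dom_def)
  have dominant: "of_real s + \<mu> \<in> resolvent_set (generator T)" if "Re \<mu> \<ge> 0" "\<mu> \<noteq> 0" for \<mu>
  proof (rule ccontr)
    assume "\<not> ?thesis"
    then have "of_real s + \<mu> \<in> spectrum A - {complex_of_real s}"
      using that assms(3) by (simp add: spectrum_def)
    then have "Re (of_real s + \<mu>) < s" using assms(4) unfolding dominant_spectral_bound_def by blast
    with that show False by simp
  qed
  obtain \<epsilon> where \<epsilon>: "\<epsilon> > 0" "\<And>B. complex_linear B \<Longrightarrow> positive_operator B \<Longrightarrow> norm B < \<epsilon> \<Longrightarrow>
      \<exists>S. C0_semigroup S \<and> generator S = perturbed (generator T) B \<and>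
        individually_eventually_strongly_positive S (emb u0)"
    using perturbation_eventually_strongly_positive[OF T_real dominant assms(8)] by blast
  show ?thesis
  proof (intro exI[of _ \<epsilon>] conjI allI impI \<epsilon>(1))
    fix B :: "'a bounded_operator"
    assume B: "complex_linear B \<and> compact_operator B \<and> positive_operator B \<and> norm B < \<epsilon>"
    then obtain S where "C0_semigroup S" "generator S = perturbed (generator T) B"
        "individually_eventually_strongly_positive S (emb u0)" using \<epsilon>(2) by blast
    then have S: "C0_semigroup S" "generator S = perturbed A B"
        "individually_eventually_strongly_positive S u" unfolding assms(3) u_emb(1) .
    then show "\<exists>S. C0_semigroup S \<and> generator S = perturbed A B" by blast
    fix S' assume S': "C0_semigroup S' \<and> generator S' = perturbed A B"
    \<comment> \<open>The generator determines a semigroup at times t \<ge> 0 only; values at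
      negative times may differ, but strong positivity is asserted from some nonnegative time
      on.\<close>
    have "S' t = S t" if "t \<ge> 0" for t
      by (rule generator_determines_semigroup[OF S(1)]) (use S S' that in auto)
    then show "individually_eventually_strongly_positive S' u"
      using S(3) unfolding individually_eventually_strongly_positive_def by (metis order_trans)
  qed
qed

end
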